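(* Fix $p\ge 2$, and let $G=(V,E)$ be any graph that can be obtained from copies of the complete graph $K_p$ by parallel connection, series connection, direct sum, deletion and contraction. Then $T_G^{-\beta}$ is completely monotone on $(0,\infty)^E$ for $\beta=0,\frac12,1,\frac32,\ldots$ and for all real $\beta\ge(p-2)/2$.
   Context: Graphs are finite and undirected, and may have loops and multiple edges. For a connected graph $G$, $T_G(\mathbf{x})=\sum_{T\in\mathcal{T}(G)}\prod_{e\in T}x_e$, where $\mathcal{T}(G)$ is the family of edge sets of spanning trees; for disconnected $G$, $T_G$ is the product of the spanning-tree polynomials of the connected components (so $T_G$ generates maximal spanning forests). A $C^\infty$ function $f$ on $(0,\infty)^E$ is completely monotone if $(-1)^k\,\partial^kf/\partial x_{e_1}\cdots\partial x_{e_k}\ge 0$ everywhere on $(0,\infty)^E$ for all $k\ge 0$ and all $e_1,\ldots,e_k\in E$. Operations. Direct sum of graphs means either disjoint union or gluing at a vertex. Deletion and contraction are the usual operations on edges. For $i=1,2$ let $G_i$ be a graph (with disjoint vertex and edge sets) and let $e_i$ be an edge of $G_i$ with a chosen orientation $\vec e_i=\overrightarrow{x_iy_i}$ (it is convenient, though not necessary, to take $e_i$ neither a loop nor a bridge). The parallel connection of $(G_1,\vec e_1)$ and $(G_2,\vec e_2)$ is obtained from the disjoint union $G_1\cup G_2$ by identifying $x_1$ with $x_2$, $y_1$ with $y_2$, and $e_1$ with $e_2$. The series connection is obtained from the disjoint union $(G_1\setminus e_1)\cup(G_2\setminus e_2)$ by identifying $x_1$ with $x_2$ and adding a new edge $e$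 from $y_1$ to $y_2$. *)

theory Defs
  imports "HOL-Analysis.Analysis"
begin

section \<open>Finite undirected multigraphs\<close>

text \<open>
  An edge carries its set of endpoints: two vertices, or a single one for a loop.  Parallel
  edges are distinct edges with the same endpoints.  The value of \<open>ends\<close> outside \<open>edges\<close> is
  irrelevant.
\<close>

record ('v, 'e) mgraph =
  verts :: "'v set"
  edges :: "'e set"
  ends :: "'e \<Rightarrow> 'v set"

definition multigraph :: "('v, 'e) mgraph \<Rightarrow> bool" where
  "multigraph G \<longleftrightarrow> finite (verts G) \<and> finite (edges G) \<and>
     (\<forall>e\<in>edges G. ends G e \<subseteq> verts G \<and> card (ends G e) \<in> {1, 2})"

definition adjacency :: "('v, 'e) mgraph \<Rightarrow> ('v \<times> 'v) set" where
  "adjacency G = {(u, v). \<exists>e\<in>edges G. ends G e = {u, v}}"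

definition graph_connected :: "('v, 'e) mgraph \<Rightarrow> bool" where
  "graph_connected G \<longleftrightarrow>
     verts G \<noteq> {} \<and> (\<forall>u\<in>verts G. \<forall>v\<in>verts G. (u, v) \<in> (adjacency G)\<^sup>*)"

definition induced :: "('v, 'e) mgraph \<Rightarrow> 'v set \<Rightarrow> ('v, 'e) mgraph" where
  "induced G C = \<lparr>verts = C, edges = {e \<in> edges G. ends G e \<subseteq> C}, ends = ends G\<rparr>"

definition component_sets :: "('v, 'e) mgraph \<Rightarrow> 'v set set" where
  "component_sets G = verts G // (adjacency G)\<^sup>*"

text \<open>
  The edge \<open>es ! i\<close> joins the \<open>i\<close>-th vertex to the next one, cyclically; a loop is a cycle of
  length 1 and a pair of parallel edges gives a cycle of length 2.
\<close>

definition graph_cycle :: "('v, 'e) mgraph \<Rightarrow> 'v list \<Rightarrow> 'e list \<Rightarrow> bool" where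
  "graph_cycle G vs es \<longleftrightarrow>
     es \<noteq> [] \<and> length vs = length es \<and> distinct vs \<and> distinct es \<and> set es \<subseteq> edges G \<and>
     (\<forall>i<length es. ends G (es ! i) = {vs ! i, vs ! (Suc i mod length es)})"

definition graph_acyclic :: "('v, 'e) mgraph \<Rightarrow> bool" where
  "graph_acyclic G \<longleftrightarrow> \<not> (\<exists>vs es. graph_cycle G vs es)"

definition spanning_trees :: "('v, 'e) mgraph \<Rightarrow> 'e set set" where
  "spanning_trees G =
     {T. T \<subseteq> edges G \<and> graph_connected (G\<lparr>edges := T\<rparr>) \<and> graph_acyclic (G\<lparr>edges := T\<rparr>)}"

text \<open>
  The product runs over the connected components; for connected \<open>G\<close> its only factor is the sum
  over the spanning trees of \<open>G\<close> itself.
\<close>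

definition spanning_tree_poly :: "('v, 'e) mgraph \<Rightarrow> ('e \<Rightarrow> real) \<Rightarrow> real" where
  "spanning_tree_poly G x =
     (\<Prod>C\<in>component_sets G. \<Sum>T\<in>spanning_trees (induced G C). \<Prod>e\<in>T. x e)"


section \<open>Graph operations\<close>

definition graph_iso :: "('v, 'e) mgraph \<Rightarrow> ('w, 'f) mgraph \<Rightarrow> bool" where
  "graph_iso G H \<longleftrightarrow>
     (\<exists>f g. bij_betw f (verts G) (verts H) \<and> bij_betw g (edges G) (edges H) \<and>
            (\<forall>e\<in>edges G. ends H (g e) = f ` ends G e))"

definition complete_graph :: "nat \<Rightarrow> ('v, 'e) mgraph \<Rightarrow> bool" where
  "complete_graph p G \<longleftrightarrow> finite (verts G) \<and> card (verts G) = p \<and>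
     bij_betw (ends G) (edges G) {A. A \<subseteq> verts G \<and> card A = 2}"

definition disjoint_graphs :: "('v, 'e) mgraph \<Rightarrow> ('v, 'e) mgraph \<Rightarrow> bool" where
  "disjoint_graphs G H \<longleftrightarrow> verts G \<inter> verts H = {} \<and> edges G \<inter> edges H = {}"

definition graph_union :: "('v, 'e) mgraph \<Rightarrow> ('v, 'e) mgraph \<Rightarrow> ('v, 'e) mgraph" where
  "graph_union G H = \<lparr>verts = verts G \<union> verts H, edges = edges G \<union> edges H,
     ends = (\<lambda>e. if e \<in> edges G then ends G e else ends H e)\<rparr>"

definition merge_vertex :: "'v \<Rightarrow> 'v \<Rightarrow> 'v \<Rightarrow> 'v" where
  "merge_vertex x y = (\<lambda>v. if v = y then x else v)"

definition identify :: "'v \<Rightarrow> 'v \<Rightarrow> ('v, 'e) mgraph \<Rightarrow> ('v, 'e) mgraph" where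
  "identify x y G = \<lparr>verts = merge_vertex x y ` verts G, edges = edges G,
     ends = (\<lambda>e. merge_vertex x y ` ends G e)\<rparr>"

definition delete_edge :: "'e \<Rightarrow> ('v, 'e) mgraph \<Rightarrow> ('v, 'e) mgraph" where
  "delete_edge e G = G\<lparr>edges := edges G - {e}\<rparr>"

definition add_edge :: "'e \<Rightarrow> 'v \<Rightarrow> 'v \<Rightarrow> ('v, 'e) mgraph \<Rightarrow> ('v, 'e) mgraph" where
  "add_edge e x y G = G\<lparr>edges := insert e (edges G), ends := (ends G)(e := {x, y})\<rparr>"

definition contract_edge :: "'e \<Rightarrow> 'v \<Rightarrow> 'v \<Rightarrow> ('v, 'e) mgraph \<Rightarrow> ('v, 'e) mgraph" where
  "contract_edge e x y G = identify x y (delete_edge e G)"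

text \<open>
  In the two connections \<open>e1\<close> and \<open>e2\<close> may be loops, so \<open>y1\<close> and \<open>y2\<close> have to be replaced by
  their images under the identification of \<open>x1\<close> with \<open>x2\<close>.  Once the endpoints of \<open>e1\<close> and
  \<open>e2\<close> have been identified, these edges have the same endpoints, so identifying them amounts
  to keeping only \<open>e1\<close>.
\<close>

definition parallel_connection ::
  "('v, 'e) mgraph \<Rightarrow> 'e \<Rightarrow> 'v \<Rightarrow> 'v \<Rightarrow> ('v, 'e) mgraph \<Rightarrow> 'e \<Rightarrow> 'v \<Rightarrow> 'v \<Rightarrow> ('v, 'e) mgraph" where
  "parallel_connection G1 e1 x1 y1 G2 e2 x2 y2 =
     delete_edge e2
       (identify (merge_vertex x1 x2 y1) (merge_vertex x1 x2 y2) (identify x1 x2 (graph_union G1 G2)))"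

definition series_connection ::
  "('v, 'e) mgraph \<Rightarrow> 'e \<Rightarrow> 'v \<Rightarrow> 'v \<Rightarrow> ('v, 'e) mgraph \<Rightarrow> 'e \<Rightarrow> 'v \<Rightarrow> 'v \<Rightarrow> 'e \<Rightarrow>
     ('v, 'e) mgraph" where
  "series_connection G1 e1 x1 y1 G2 e2 x2 y2 e =
     add_edge e (merge_vertex x1 x2 y1) (merge_vertex x1 x2 y2)
       (identify x1 x2 (graph_union (delete_edge e1 G1) (delete_edge e2 G2)))"

text \<open>
  The pair \<open>(x, y)\<close> with \<open>ends G e = {x, y}\<close> is the chosen orientation of \<open>e\<close>.
\<close>

inductive generated :: "nat \<Rightarrow> ('v, 'e) mgraph \<Rightarrow> bool" for p :: nat where
  complete: "complete_graph p G \<Longrightarrow> generated p G"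
| iso: "generated p G \<Longrightarrow> graph_iso G H \<Longrightarrow> generated p H"
| disjoint_union:
    "generated p G1 \<Longrightarrow> generated p G2 \<Longrightarrow> disjoint_graphs G1 G2 \<Longrightarrow>
     generated p (graph_union G1 G2)"
| glue:
    "generated p G1 \<Longrightarrow> generated p G2 \<Longrightarrow> disjoint_graphs G1 G2 \<Longrightarrow>
     x1 \<in> verts G1 \<Longrightarrow> x2 \<in> verts G2 \<Longrightarrow>
     generated p (identify x1 x2 (graph_union G1 G2))"
| parallel:
    "generated p G1 \<Longrightarrow> generated p G2 \<Longrightarrow> disjoint_graphs G1 G2 \<Longrightarrow>
     e1 \<in> edges G1 \<Longrightarrow> ends G1 e1 = {x1, y1} \<Longrightarrow>
     e2 \<in> edges G2 \<Longrightarrow> ends G2 e2 = {x2, y2} \<Longrightarrow>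
     generated p (parallel_connection G1 e1 x1 y1 G2 e2 x2 y2)"
| series:
    "generated p G1 \<Longrightarrow> generated p G2 \<Longrightarrow> disjoint_graphs G1 G2 \<Longrightarrow>
     e1 \<in> edges G1 \<Longrightarrow> ends G1 e1 = {x1, y1} \<Longrightarrow>
     e2 \<in> edges G2 \<Longrightarrow> ends G2 e2 = {x2, y2} \<Longrightarrow>
     e \<notin> edges G1 \<union> edges G2 \<Longrightarrow>
     generated p (series_connection G1 e1 x1 y1 G2 e2 x2 y2 e)"
| deletion:
    "generated p G \<Longrightarrow> e \<in> edges G \<Longrightarrow> generated p (delete_edge e G)"
| contraction:
    "generated p G \<Longrightarrow> e \<in> edges G \<Longrightarrow> ends G e = {x, y} \<Longrightarrow>
     generated p (contract_edge e x y G)"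

lemma multigraph_graph_iso:
  assumes "multigraph G" "graph_iso G H"
  shows "multigraph H"
proof -
  obtain f g where f: "bij_betw f (verts G) (verts H)" and g: "bij_betw g (edges G) (edges H)"
    and fg: "\<And>e. e \<in> edges G \<Longrightarrow> ends H (g e) = f ` ends G e"
    using assms(2) unfolding graph_iso_def by blast
  have "ends H e' \<subseteq> verts H \<and> card (ends H e') \<in> {1, 2}" if "e' \<in> edges H" for e'
  proof -
    obtain e where e: "e \<in> edges G" "e' = g e"
      using g \<open>e' \<in> edges H\<close> by (auto simp: bij_betw_def)
    have sub: "ends G e \<subseteq> verts G" and c: "card (ends G e) \<in> {1, 2}"
      using assms(1) e by (auto simp: multigraph_def)
    have "inj_on f (ends G e)"
      using f sub by (auto simp: bij_betw_def intro: inj_on_subset)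
    then have "card (f ` ends G e) = card (ends G e)" by (rule card_image)
    moreover have "f ` ends G e \<subseteq> verts H"
      using f sub by (auto simp: bij_betw_def)
    ultimately show ?thesis using fg[OF e(1)] e(2) c by simp
  qed
  then show ?thesis
    using assms(1) bij_betw_finite[OF f] bij_betw_finite[OF g] by (simp add: multigraph_def)
qed

lemma multigraph_identify:
  assumes "multigraph G" shows "multigraph (identify x y G)"
proof -
  have "card (merge_vertex x y ` ends G e) \<in> {1, 2}" if "e \<in> edges G" for e
  proof -
    have c: "card (ends G e) \<in> {1, 2}" using assms that by (auto simp: multigraph_def)
    then have fin: "finite (ends G e)" by (intro card_ge_0_finite) auto
    have ne: "ends G e \<noteq> {}" using c by auto
    have "card (merge_vertex x y ` ends G e) \<le> card (ends G e)" by (rule card_image_le[OF fin])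
    moreover have "card (merge_vertex x y ` ends G e) \<noteq> 0" using fin ne by simp
    ultimately show ?thesis using c by auto
  qed
  then show ?thesis
    using assms by (auto simp: multigraph_def identify_def image_mono)
qed

lemma multigraph_graph_union:
  "multigraph G \<Longrightarrow> multigraph H \<Longrightarrow> multigraph (graph_union G H)"
  by (auto simp: multigraph_def graph_union_def)

lemma multigraph_delete_edge: "multigraph G \<Longrightarrow> multigraph (delete_edge e G)"
  by (auto simp: multigraph_def delete_edge_def)

lemma multigraph_add_edge:
  "multigraph G \<Longrightarrow> x \<in> verts G \<Longrightarrow> y \<in> verts G \<Longrightarrow> multigraph (add_edge e x y G)"
  by (auto simp: multigraph_def add_edge_def card_insert_if)

lemma multigraph_generated: "generated p G \<Longrightarrow> multigraph G"
proof (induction rule: generated.induct)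
  case (complete G)
  then have "finite {A. A \<subseteq> verts G \<and> card A = 2}"
    by (auto simp: complete_graph_def intro: finite_subset[of _ "Pow (verts G)"])
  then have "finite (edges G)"
    using complete bij_betw_finite[of "ends G" "edges G"] by (auto simp: complete_graph_def)
  then show ?case
    using complete by (auto simp: multigraph_def complete_graph_def bij_betw_def)
next
  case (series G1 G2 e1 x1 y1 e2 x2 y2 e)
  have "y1 \<in> verts G1" "y2 \<in> verts G2"
    using series.IH series.hyps by (auto simp: multigraph_def)
  then show ?case
    unfolding series_connection_def using series.IH
    by (intro multigraph_add_edge multigraph_identify multigraph_graph_union
        multigraph_delete_edge) (auto simp: identify_def graph_union_def delete_edge_def)
qed (auto simp: parallel_connection_def contract_edge_def
    intro: multigraph_graph_iso multigraph_identify multigraph_graph_union multigraph_delete_edge)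

text \<open>
  The construction may pass through graphs with more vertices or edges than the types
  \<open>'v\<close> and \<open>'e\<close> can accommodate, so it is carried out over \<open>nat\<close>.
\<close>

definition obtainable_from_complete :: "nat \<Rightarrow> ('v, 'e) mgraph \<Rightarrow> bool" where
  "obtainable_from_complete p G \<longleftrightarrow> (\<exists>H :: (nat, nat) mgraph. generated p H \<and> graph_iso H G)"

lemma multigraph_obtainable: "obtainable_from_complete p G \<Longrightarrow> multigraph G"
  unfolding obtainable_from_complete_def
  using multigraph_generated multigraph_graph_iso by blast


section \<open>Complete monotonicity\<close>

definition pos_orthant :: "'e set \<Rightarrow> ('e \<Rightarrow> real) set" where
  "pos_orthant E = (\<Pi>\<^sub>E e\<in>E. {0<..})"

definition partial_deriv :: "'e \<Rightarrow> (('e \<Rightarrow> real) \<Rightarrow> real) \<Rightarrow> ('e \<Rightarrow> real) \<Rightarrow> real" where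
  "partial_deriv e f x = deriv (\<lambda>t. f (x(e := t))) (x e)"

text \<open>\<open>\<partial>\<^sup>k f / \<partial>x\<^sub>e\<^sub>1 \<dots> \<partial>x\<^sub>e\<^sub>k\<close> for the list \<open>[e1, \<dots>, ek]\<close>\<close>

definition iterated_partial_deriv ::
  "'e list \<Rightarrow> (('e \<Rightarrow> real) \<Rightarrow> real) \<Rightarrow> ('e \<Rightarrow> real) \<Rightarrow> real" where
  "iterated_partial_deriv es f = foldr partial_deriv es f"

text \<open>
  A function is \<open>C\<^sup>\<infinity>\<close> if all its iterated partial derivatives exist and are continuous.
  Existence has to be required separately, since \<open>deriv\<close> is total.
\<close>

definition smooth_on_orthant :: "'e set \<Rightarrow> (('e \<Rightarrow> real) \<Rightarrow> real) \<Rightarrow> bool" where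
  "smooth_on_orthant E f \<longleftrightarrow>
     (\<forall>es. set es \<subseteq> E \<longrightarrow>
        continuous_on (pos_orthant E) (iterated_partial_deriv es f) \<and>
        (\<forall>e\<in>E. \<forall>x\<in>pos_orthant E.
           (\<lambda>t. iterated_partial_deriv es f (x(e := t))) differentiable (at (x e))))"

definition completely_monotone :: "'e set \<Rightarrow> (('e \<Rightarrow> real) \<Rightarrow> real) \<Rightarrow> bool" where
  "completely_monotone E f \<longleftrightarrow>
     smooth_on_orthant E f \<and>
     (\<forall>es. set es \<subseteq> E \<longrightarrow>
        (\<forall>x\<in>pos_orthant E. (-1) ^ length es * iterated_partial_deriv es f x \<ge> 0))"

end

theory Submission imports Defs "HOL-Probability.Distributions"
begin

text \<open>
  Call a function on the positive orthant completely monotone in the difference sense if all its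
  alternating finite differences are nonnegative.  This property passes to products, integrals,
  pointwise limits and affine substitutions without any smoothness, and for smooth functions it
  implies complete monotonicity, derivatives being limits of difference quotients.

  For an edge \<open>e\<close> write \<open>T\<^sub>G = A + x\<^sub>e B\<close> with \<open>A\<close> from deletion and \<open>B\<close> from contraction.
  Differentiating \<open>n\<close> times in \<open>x\<^sub>e\<close>, setting \<open>x\<^sub>e = n / t\<close> and letting \<open>n\<close> tend to infinity shows
  that \<open>B powr - \<beta> * exp (- t * A / B)\<close> inherits the property from \<open>T\<^sub>G powr - \<beta>\<close>.  A parallel
  connection adds the effective conductances \<open>A / B\<close>, so the Gamma integral recovers it from such
  factors; for a series connection a one-dimensional Gaussian integral is needed as well, which
  costs \<open>\<beta> \<ge> 1/2\<close>.  The remaining case \<open>0 < \<beta> < 1/2\<close> occurs only for \<open>p = 2\<close>, where all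
  graphs are forests and \<open>T\<^sub>G\<close> is a monomial.

  For \<open>K\<^sub>p\<close>, eliminating a vertex by the star-mesh transformation writes \<open>T\<close> as a product of
  vertex degrees.  Going backwards, each factor \<open>s powr - \<beta>\<close> is a Gaussian integral over the
  position of the eliminated vertex in Euclidean space times a Gamma integral, and the starting
  point is the exponential of a negative linear form.
\<close>

section \<open>Finite-difference complete monotonicity\<close>

text \<open>Why the exponential is the right object: T = B (x_e + A/B), so T^(-\<beta>) is the
  Laplace transform in x_e of t^(\<beta>-1)/Gamma(\<beta>) times B^(-\<beta>) exp(-tA/B). High
  derivatives recover this density at t, as in the Post-Widder inversion formula, and finite
  differences survive the limit; no integral representation of functions of several variables is
  needed.

  Both thresholds come from Gaussian integrals. Integrating a point of R^d against a star of springs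
  of total weight s yields exactly s^(-d/2). The missing factor s^(-(\<beta>-d/2)) is a Gamma
  integral if its exponent is at most 0, and exp(-ts) is realised by lifting the point into one more
  dimension. For the complete graph the dimension therefore grows with every vertex put back; the
  last one is placed over dimension p-2, whence \<beta> \<ge> (p-2)/2. If \<beta> = d/2 no factor is
  missing and the dimension stays, whence the half-integers. The series connection is the case d =
  1, whence \<beta> \<ge> 1/2.\<close>

definition pos_fun :: "('e \<Rightarrow> real) \<Rightarrow> bool" where
  "pos_fun x \<longleftrightarrow> (\<forall>e. 0 < x e)"

definition nonneg_fun :: "('e \<Rightarrow> real) \<Rightarrow> bool" where
  "nonneg_fun h \<longleftrightarrow> (\<forall>e. 0 \<le> h e)"

definition shift :: "('e \<Rightarrow> real) \<Rightarrow> ('e \<Rightarrow> real) \<Rightarrow> 'e \<Rightarrow> real" where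
  "shift h x = (\<lambda>e. x e + h e)"

text \<open>Differences of every order up to \<open>k\<close> with arbitrary vector shifts, the sign
  being absorbed by subtracting the shifted value. Positivity is asked on the whole edge type, so
  that graphs with different edge sets share one domain.\<close>

primrec alternating :: "nat \<Rightarrow> (('e \<Rightarrow> real) \<Rightarrow> real) \<Rightarrow> bool" where
  "alternating 0 F \<longleftrightarrow> (\<forall>x. pos_fun x \<longrightarrow> 0 \<le> F x)"
| "alternating (Suc k) F \<longleftrightarrow> (\<forall>x. pos_fun x \<longrightarrow> 0 \<le> F x) \<and>
     (\<forall>h. nonneg_fun h \<longrightarrow> alternating k (\<lambda>x. F x - F (shift h x)))"

definition fdcm :: "(('e \<Rightarrow> real) \<Rightarrow> real) \<Rightarrow> bool" where
  "fdcm F \<longleftrightarrow> (\<forall>k. alternating k F)"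

lemma pos_fun_shift: "pos_fun x \<Longrightarrow> nonneg_fun h \<Longrightarrow> pos_fun (shift h x)"
  by (auto simp: pos_fun_def nonneg_fun_def shift_def add_pos_nonneg)

lemma shift_commute: "shift h (shift g x) = shift g (shift h x)"
  by (simp add: shift_def add_ac)

lemma alternating_nonneg: "alternating k F \<Longrightarrow> pos_fun x \<Longrightarrow> 0 \<le> F x"
  by (cases k) auto

lemma fdcm_nonneg: "fdcm F \<Longrightarrow> pos_fun x \<Longrightarrow> 0 \<le> F x"
  using alternating_nonneg fdcm_def by blast

lemma alternating_cong:
  assumes "\<And>x. pos_fun x \<Longrightarrow> F x = G x" "alternating k F"
  shows "alternating k G"
  using assms
proof (induction k arbitrary: F G)
  case (Suc k)
  have "alternating k (\<lambda>x. G x - G (shift h x))" if h: "nonneg_fun h" for h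
    by (rule Suc.IH[of "\<lambda>x. F x - F (shift h x)"]) (use Suc.prems h in \<open>auto simp: pos_fun_shift\<close>)
  with Suc.prems show ?case by auto
qed auto

lemma fdcm_cong: "(\<And>x. pos_fun x \<Longrightarrow> F x = G x) \<Longrightarrow> fdcm F \<Longrightarrow> fdcm G"
  unfolding fdcm_def using alternating_cong by blast

lemma alternating_Suc_D: "alternating (Suc k) F \<Longrightarrow> alternating k F"
proof (induction k arbitrary: F)
  case 0
  then show ?case unfolding alternating.simps by blast
next
  case (Suc k)
  then have "alternating k (\<lambda>x. F x - F (shift h x))" if "nonneg_fun h" for h
    using that by (metis alternating.simps(2))
  moreover have "\<forall>x. pos_fun x \<longrightarrow> 0 \<le> F x"
    using Suc.prems by (metis alternating_nonneg)
  ultimately show ?case unfolding alternating.simps(2)[of k] by blast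
qed

text \<open>\<open>M\<close> is the linear part of the affine map \<open>L\<close>; the third
  hypothesis makes a difference of the composite the composite of a difference.\<close>

lemma alternating_subst:
  assumes pos: "\<And>x. pos_fun x \<Longrightarrow> pos_fun (L x)"
    and M: "\<And>h. nonneg_fun h \<Longrightarrow> nonneg_fun (M h)"
    and L: "\<And>x h. L (shift h x) = shift (M h) (L x)"
    and F: "alternating k F"
  shows "alternating k (\<lambda>x. F (L x))"
  using F
proof (induction k arbitrary: F)
  case (Suc k)
  then show ?case
    using Suc.IH[of "\<lambda>x. F x - F (shift (M h) x)" for h] by (auto simp: L pos M)
qed (use pos in auto)

lemma fdcm_subst:
  assumes "\<And>x. pos_fun x \<Longrightarrow> pos_fun (L x)" "\<And>h. nonneg_fun h \<Longrightarrow> nonneg_fun (M h)"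
    and "\<And>x h. L (shift h x) = shift (M h) (L x)" "fdcm F"
  shows "fdcm (\<lambda>x. F (L x))"
  using assms alternating_subst[of L M] unfolding fdcm_def by blast

lemma fdcm_comp: "fdcm F \<Longrightarrow> fdcm (\<lambda>x. F (x \<circ> g))"
  by (rule fdcm_subst[where M = "\<lambda>h. h \<circ> g" and L = "\<lambda>x. x \<circ> g" and F = F]) (auto simp: pos_fun_def nonneg_fun_def shift_def)

lemma fdcm_fix: "0 < y \<Longrightarrow> fdcm F \<Longrightarrow> fdcm (\<lambda>x. F (x(e := y)))"
  by (rule fdcm_subst[where M = "\<lambda>h. h(e := 0)" and L = "\<lambda>x. x(e := y)" and F = F]) (auto simp: pos_fun_def nonneg_fun_def shift_def)

text \<open>Serves the series connection with a loop, where the new edge takes over the role of one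
  of the two marked edges.\<close>

lemma fdcm_rename: "fdcm F \<Longrightarrow> fdcm (\<lambda>x. F (x(e := x e')))"
  by (rule fdcm_subst[where M = "\<lambda>h. h(e := h e')" and L = "\<lambda>x. x(e := x e')" and F = F]) (auto simp: pos_fun_def nonneg_fun_def shift_def)

lemma fdcm_difference: "nonneg_fun h \<Longrightarrow> fdcm F \<Longrightarrow> fdcm (\<lambda>x. F x - F (shift h x))"
  unfolding fdcm_def by (metis alternating.simps(2))

lemma alternating_add: "alternating k F \<Longrightarrow> alternating k G \<Longrightarrow> alternating k (\<lambda>x. F x + G x)"
proof (induction k arbitrary: F G)
  case (Suc k)
  have "alternating k (\<lambda>x. (F x + G x) - (F (shift h x) + G (shift h x)))" if "nonneg_fun h" for h
    using Suc.IH[of "\<lambda>x. F x - F (shift h x)" "\<lambda>x. G x - G (shift h x)"] Suc.prems that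
    by (simp add: add_diff_add)
  then show ?case using Suc.prems by simp
qed simp

text \<open>Discrete Leibniz rule: a difference of the product is (difference of F) times G plus
  (shifted F) times (difference of G), and each product consists of factors of order
  \<open>k\<close>.\<close>

lemma alternating_mult: "alternating k F \<Longrightarrow> alternating k G \<Longrightarrow> alternating k (\<lambda>x. F x * G x)"
proof (induction k arbitrary: F G)
  case (Suc k)
  have "alternating k (\<lambda>x. F x * G x - F (shift h x) * G (shift h x))" if h: "nonneg_fun h" for h
  proof -
    have Fh: "alternating k (\<lambda>x. F (shift h x))"
      by (rule alternating_subst[where M = "\<lambda>h. h" and L = "shift h" and F = F])
        (auto intro: pos_fun_shift[OF _ h] shift_commute alternating_Suc_D[OF Suc.prems(1)])
    have "alternating k (\<lambda>x. (F x - F (shift h x)) * G x + F (shift h x) * (G x - G (shift h x)))"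
      using Suc.prems h by (intro alternating_add Suc.IH Fh alternating_Suc_D[OF Suc.prems(2)]) simp_all
    moreover have "(F x - F (shift h x)) * G x + F (shift h x) * (G x - G (shift h x))
        = F x * G x - F (shift h x) * G (shift h x)" for x
      by (simp add: algebra_simps)
    ultimately show ?thesis by simp
  qed
  moreover have "0 \<le> F x * G x" if "pos_fun x" for x
    using Suc.prems[THEN alternating_nonneg, OF that] by simp
  ultimately show ?case unfolding alternating.simps by blast
qed simp

lemma fdcm_mult: "fdcm F \<Longrightarrow> fdcm G \<Longrightarrow> fdcm (\<lambda>x. F x * G x)"
  unfolding fdcm_def using alternating_mult by blast

lemma alternating_const: "0 \<le> c \<Longrightarrow> alternating k (\<lambda>x. c)"
  by (induction k arbitrary: c) auto

lemma fdcm_const: "0 \<le> c \<Longrightarrow> fdcm (\<lambda>x. c)"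
  unfolding fdcm_def using alternating_const by blast

lemma fdcm_cmult: "0 \<le> c \<Longrightarrow> fdcm F \<Longrightarrow> fdcm (\<lambda>x. c * F x)"
  by (intro fdcm_mult fdcm_const)

lemma fdcm_prod: "(\<And>i. i \<in> I \<Longrightarrow> fdcm (F i)) \<Longrightarrow> fdcm (\<lambda>x. \<Prod>i\<in>I. F i x)"
  by (induction I rule: infinite_finite_induct) (auto intro: fdcm_mult fdcm_const)

lemma alternating_limit:
  assumes "\<And>n. alternating k (F n)"
    and "\<And>x. pos_fun x \<Longrightarrow> (\<lambda>n::nat. F n x) \<longlonglongrightarrow> G x"
  shows "alternating k G"
  using assms
proof (induction k arbitrary: F G)
  case 0
  have "0 \<le> G x" if "pos_fun x" for x
    using 0(1) that by (intro LIMSEQ_le_const[OF 0(2)[OF that]]) auto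
  then show ?case by simp
next
  case (Suc k)
  have "0 \<le> G x" if "pos_fun x" for x
    using Suc.prems(1) by (intro LIMSEQ_le_const[OF Suc.prems(2)[OF that]]) (auto simp: that)
  moreover have "alternating k (\<lambda>x. G x - G (shift h x))" if h: "nonneg_fun h" for h
    by (rule Suc.IH[of "\<lambda>n x. F n x - F n (shift h x)"])
      (use Suc.prems h in \<open>auto intro!: tendsto_diff simp: pos_fun_shift\<close>)
  ultimately show ?case by auto
qed

lemma fdcm_limit:
  assumes "\<And>n. fdcm (F n)" "\<And>x. pos_fun x \<Longrightarrow> (\<lambda>n::nat. F n x) \<longlonglongrightarrow> G x"
  shows "fdcm G"
  using assms alternating_limit[of _ F G] unfolding fdcm_def by blast

text \<open>Differences commute with the integral, integrability being part of
  \<open>has_bochner_integral\<close>. The integrand must be alternating for every \<open>t\<close>,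
  so integrals over a half-line carry an indicator.\<close>

lemma alternating_integral:
  assumes "\<And>t. alternating k (F t)"
    and "\<And>x. pos_fun x \<Longrightarrow> has_bochner_integral M (\<lambda>t. F t x) (G x)"
  shows "alternating k G"
  using assms
proof (induction k arbitrary: F G)
  case 0
  have "0 \<le> G x" if "pos_fun x" for x
    using integral_nonneg_AE[of "\<lambda>t. F t x" M] 0(1) that
    by (subst has_bochner_integral_integral_eq[OF 0(2)[OF that], symmetric]) auto
  then show ?case by simp
next
  case (Suc k)
  have "0 \<le> G x" if "pos_fun x" for x
    using integral_nonneg_AE[of "\<lambda>t. F t x" M] Suc.prems(1) that
    by (subst has_bochner_integral_integral_eq[OF Suc.prems(2)[OF that], symmetric]) auto
  moreover have "alternating k (\<lambda>x. G x - G (shift h x))" if h: "nonneg_fun h" for h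
    by (rule Suc.IH[of "\<lambda>n x. F n x - F n (shift h x)"])
      (use Suc.prems h in \<open>auto intro!: has_bochner_integral_diff simp: pos_fun_shift\<close>)
  ultimately show ?case by auto
qed

lemma fdcm_integral:
  assumes "\<And>t. fdcm (F t)" "\<And>x. pos_fun x \<Longrightarrow> has_bochner_integral M (\<lambda>t. F t x) (G x)"
  shows "fdcm G"
  using assms alternating_integral[of _ F M G] unfolding fdcm_def by blast

text \<open>Scaled first differences along the single coordinate \<open>e\<close> are again
  \<open>fdcm\<close> and converge to the negated partial derivative.\<close>

lemma fdcm_derivative:
  assumes "fdcm F"
    and der: "\<And>x. pos_fun x \<Longrightarrow> ((\<lambda>t. F (x(e := t))) has_real_derivative D x) (at (x e))"
  shows "fdcm (\<lambda>x. - D x)"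
proof (rule fdcm_limit)
  define h :: "nat \<Rightarrow> 'a \<Rightarrow> real" where "h n = (\<lambda>_. 0)(e := inverse (real (Suc n)))" for n
  have h: "nonneg_fun (h n)" for n by (auto simp: nonneg_fun_def h_def)
  show "fdcm (\<lambda>x. real (Suc n) * (F x - F (shift (h n) x)))" for n
    by (intro fdcm_cmult fdcm_difference assms h) auto
  show "(\<lambda>n. real (Suc n) * (F x - F (shift (h n) x))) \<longlonglongrightarrow> - D x" if x: "pos_fun x" for x
  proof -
    have lim: "((\<lambda>t. (F (x(e := x e + t)) - F x) / t) \<longlongrightarrow> D x) (at 0)"
      using der[OF x] unfolding DERIV_def by simp
    have "filterlim (\<lambda>n. inverse (real (Suc n))) (at 0) sequentially"
      unfolding filterlim_at using LIMSEQ_inverse_real_of_nat by auto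
    from filterlim_compose[OF lim this]
    have "(\<lambda>n. - ((F (x(e := x e + inverse (real (Suc n)))) - F x) / inverse (real (Suc n)))) \<longlonglongrightarrow> - D x"
      by (intro tendsto_minus)
    moreover have "shift (h n) x = x(e := x e + inverse (real (Suc n)))" for n
      by (auto simp: shift_def h_def)
    moreover have "- ((a - b) / inverse (real (Suc n))) = real (Suc n) * (b - a)" for a b n
      by (simp add: divide_inverse algebra_simps del: of_nat_Suc)
    ultimately show ?thesis by (simp only:)
  qed
qed

text \<open>The factor \<open>b\<close> is there for the induction: a difference has the same form
  with \<open>b * (1 - exp (- (c * h e)))\<close> in place of \<open>b\<close>.\<close>

lemma exp_alternating: "0 \<le> c \<Longrightarrow> 0 \<le> b \<Longrightarrow> alternating k (\<lambda>x. b * exp (- (c * x e)))"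
proof (induction k arbitrary: b)
  case (Suc k)
  have "alternating k (\<lambda>x. b * exp (- (c * x e)) - b * exp (- (c * shift h x e)))" if "nonneg_fun h" for h
  proof -
    have "0 \<le> b * (1 - exp (- (c * h e)))"
      using Suc.prems that by (simp add: nonneg_fun_def)
    from Suc.IH[OF Suc.prems(1) this]
    have "alternating k (\<lambda>x. b * (1 - exp (- (c * h e))) * exp (- (c * x e)))" .
    moreover have "b * (1 - exp (- (c * h e))) * exp (- (c * x e))
        = b * exp (- (c * x e)) - b * exp (- (c * shift h x e))" for x :: "'a \<Rightarrow> real"
    proof -
      have "- (c * shift h x e) = - (c * h e) + - (c * x e)" by (simp add: shift_def algebra_simps)
      then show ?thesis by (simp only: exp_add) (simp add: algebra_simps)
    qed
    ultimately show ?thesis by simp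
  qed
  then show ?case using Suc.prems unfolding alternating.simps by simp
qed simp

lemma fdcm_exp: "0 \<le> c \<Longrightarrow> fdcm (\<lambda>x. exp (- (c * x e)))"
  unfolding fdcm_def using exp_alternating[of c 1 _ e] by simp

section \<open>Gamma and Gaussian integrals as positive mixtures\<close>

lemma Gamma_integral_scaled:
  fixes s r :: real
  assumes "0 < s" "0 < r"
  shows "has_bochner_integral lborel (\<lambda>t. indicator {0..} t * (t powr (r - 1) * exp (- (t * s)))) (Gamma r * s powr - r)"
proof -
  have "has_bochner_integral lborel (\<lambda>t. indicator {0..} t * t powr (r - 1) / exp t) (Gamma r)"
    by (rule has_bochner_integral_nn_integral)
      (use Gamma_conv_nn_integral_real[OF assms(2)] assms(2) in \<open>auto intro: less_imp_le[OF Gamma_real_pos]\<close>)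
  then have "has_bochner_integral lborel
      (\<lambda>t. indicat_real {0..} (0 + s * t) * (0 + s * t) powr (r - 1) / exp (0 + s * t)) (Gamma r /\<^sub>R \<bar>s\<bar>)"
    by (subst (asm) lborel_has_bochner_integral_real_affine_iff[of s _ _ 0]) (use assms in simp)
  \<comment> \<open>The factor \<open>s powr (1 - r)\<close> cancels the power of \<open>s\<close>
    that the substitution of \<open>s * t\<close> puts into the integrand.\<close>
  then have "has_bochner_integral lborel
      (\<lambda>t. s powr (1 - r) * (indicator {0..} (0 + s * t) * (0 + s * t) powr (r - 1) / exp (0 + s * t)))
      (s powr (1 - r) * (Gamma r /\<^sub>R \<bar>s\<bar>))"
    by (intro has_bochner_integral_mult_right) auto
  moreover have "s powr (1 - r) * (Gamma r /\<^sub>R \<bar>s\<bar>) = Gamma r * s powr - r"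
    using assms by (simp add: powr_diff powr_minus divide_inverse)
  moreover have "s powr (1 - r) * (indicator {0..} (0 + s * t) * (0 + s * t) powr (r - 1) / exp (0 + s * t))
      = indicator {0..} t * (t powr (r - 1) * exp (- (t * s)))" for t
  proof (cases "0 \<le> t")
    case True
    have "s powr (1 - r) * s powr (r - 1) = 1" using assms by (simp flip: powr_add)
    then have "s powr (1 - r) * (s powr (r - 1) * z) = z" for z by (simp flip: mult.assoc)
    then show ?thesis using True assms
      by (simp add: powr_mult exp_minus divide_inverse mult.commute[of t s] mult.assoc)
  next
    case False
    then show ?thesis using assms by (simp add: zero_le_mult_iff)
  qed
  ultimately show ?thesis by (simp only:)
qed

text \<open>The power is a Gamma mixture of the exponentials \<open>exp (- (t * s x))\<close>, so
  only these have to be treated. For \<open>r = 0\<close> the Gamma integral diverges, and the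
  instance \<open>t = 0\<close> is the claim.\<close>

lemma fdcm_laplace_powr:
  assumes F: "\<And>t. 0 \<le> t \<Longrightarrow> fdcm (\<lambda>x. c x * exp (- (t * s x)))"
    and s: "\<And>x. pos_fun x \<Longrightarrow> 0 < s x" and r: "0 \<le> r"
  shows "fdcm (\<lambda>x. c x * s x powr - r)"
proof (cases "r = 0")
  case True
  have "fdcm (\<lambda>x. c x * exp (- (0 * s x)))" by (intro F) simp
  moreover have "c x * exp (- (0 * s x)) = c x * s x powr - r" if "pos_fun x" for x
    using True s[OF that] by simp
  ultimately show ?thesis by (rule fdcm_cong[rotated])
next
  case False
  then have r: "0 < r" using r by simp
  show ?thesis
  proof (rule fdcm_integral)
    fix t :: real
    show "fdcm (\<lambda>x. indicator {0..} t * (t powr (r - 1) / Gamma r) * (c x * exp (- (t * s x))))"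
    proof (cases "0 \<le> t")
      case True
      then show ?thesis using r by (intro fdcm_cmult F) (auto intro: less_imp_le[OF Gamma_real_pos])
    qed (auto intro: fdcm_const)
  next
    fix x :: "'a \<Rightarrow> real" assume "pos_fun x"
    from has_bochner_integral_mult_right[where c = "c x / Gamma r", OF Gamma_integral_scaled[OF s[OF this] r]]
    show "has_bochner_integral lborel
        (\<lambda>t. indicator {0..} t * (t powr (r - 1) / Gamma r) * (c x * exp (- (t * s x)))) (c x * s x powr - r)"
      using Gamma_real_pos[OF r] by (simp add: mult_ac)
  qed
qed

lemma gaussian_integral_quadratic:
  fixes s m V :: real
  assumes "0 < s"
  shows "has_bochner_integral lborel (\<lambda>w. exp (- (s * (w - m)\<^sup>2 + V))) (sqrt pi * s powr - (1/2) * exp (- V))"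
proof -
  \<comment> \<open>With variance 1/(2s) the normal density is a constant multiple of
    \<open>exp (- (s * (w - m)\<^sup>2))\<close>.\<close>
  define \<sigma> where "\<sigma> = 1 / sqrt (2 * s)"
  have \<sigma>: "0 < \<sigma>" "\<sigma>\<^sup>2 = 1 / (2 * s)" using assms by (auto simp: \<sigma>_def power_divide)
  have "has_bochner_integral lborel (normal_density m \<sigma>) 1"
    using normal_moment_even[OF \<sigma>(1), of m 0] by simp
  then have "has_bochner_integral lborel (\<lambda>w. sqrt pi * s powr - (1/2) * exp (- V) * normal_density m \<sigma> w)
      (sqrt pi * s powr - (1/2) * exp (- V) * 1)"
    by (intro has_bochner_integral_mult_right)
  moreover have "sqrt pi * s powr - (1/2) * exp (- V) * normal_density m \<sigma> w = exp (- (s * (w - m)\<^sup>2 + V))" for w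
  proof -
    have "s powr - (1/2) = 1 / sqrt s" 
      unfolding powr_minus using assms by (simp add: powr_half_sqrt inverse_eq_divide)
    moreover have "sqrt (2 * pi * (1 / (2 * s))) = sqrt pi / sqrt s" using assms by (simp add: real_sqrt_divide)
    moreover have "- (w - m)\<^sup>2 / (2 * (1 / (2 * s))) = - (s * (w - m)\<^sup>2)" using assms by simp
    moreover have "exp (- (s * (w - m)\<^sup>2 + V)) = exp (- V) * exp (- (s * (w - m)\<^sup>2))"
      by (simp flip: exp_add)
    ultimately show ?thesis
      using assms unfolding normal_density_def \<sigma>(2) by simp
  qed
  ultimately show ?thesis by simp
qed

text \<open>Write a + x_e b = b (x_e + a/b), where b and a/b are free of x_e. Each negated
  derivative lowers the exponent by one and produces the positive factor
  \<open>\<beta> + real n\<close>, which is divided out.\<close>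

lemma fdcm_edge_powers:
  assumes fd: "fdcm (\<lambda>x. (a x + x e * b x) powr - \<beta>)"
    and a: "\<And>x. pos_fun x \<Longrightarrow> 0 \<le> a x" and b: "\<And>x. pos_fun x \<Longrightarrow> 0 < b x"
    and ind: "\<And>x y. a (x(e := y)) = a x" "\<And>x y. b (x(e := y)) = b x"
    and \<beta>: "0 < \<beta>"
  shows "fdcm (\<lambda>x. b x powr - \<beta> * (x e + a x / b x) powr - (\<beta> + real n))"
proof (induction n)
  case 0
  show ?case
  proof (rule fdcm_cong[OF _ fd])
    fix x :: "'a \<Rightarrow> real" assume x: "pos_fun x"
    have xe: "0 < x e" using x by (simp add: pos_fun_def)
    have "a x + x e * b x = b x * (x e + a x / b x)" using b[OF x] by (simp add: field_simps)
    moreover have "0 \<le> x e + a x / b x" using a[OF x] b[OF x] xe by simp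
    ultimately show "(a x + x e * b x) powr - \<beta> = b x powr - \<beta> * (x e + a x / b x) powr - (\<beta> + real 0)"
      using b[OF x] by (simp add: powr_mult)
  qed
next
  case (Suc n)
  have "fdcm (\<lambda>x. - (b x powr - \<beta> * (- (\<beta> + real n) * (x e + a x / b x) powr (- (\<beta> + real n) - 1))))"
  proof (rule fdcm_derivative[OF Suc])
    fix x :: "'a \<Rightarrow> real" assume x: "pos_fun x"
    have "0 < x e + a x / b x" using x a[OF x] b[OF x] by (simp add: pos_fun_def add_pos_nonneg)
    then have "((\<lambda>t. b x powr - \<beta> * (t + a x / b x) powr - (\<beta> + real n)) has_real_derivative
        b x powr - \<beta> * (- (\<beta> + real n) * (x e + a x / b x) powr (- (\<beta> + real n) - 1))) (at (x e))"
      by (auto intro!: derivative_eq_intros)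
    then show "((\<lambda>t. b (x(e := t)) powr - \<beta> * ((x(e := t)) e + a (x(e := t)) / b (x(e := t))) powr - (\<beta> + real n))
        has_real_derivative b x powr - \<beta> * (- (\<beta> + real n) * (x e + a x / b x) powr (- (\<beta> + real n) - 1))) (at (x e))"
      by (simp add: ind)
  qed
  then have "fdcm (\<lambda>x. (1 / (\<beta> + real n)) *
      - (b x powr - \<beta> * (- (\<beta> + real n) * (x e + a x / b x) powr (- (\<beta> + real n) - 1))))"
    by (rule fdcm_cmult[rotated]) (use \<beta> in simp)
  moreover have "- (\<beta> + real n) - 1 = - (\<beta> + real (Suc n))" by simp
  moreover have "(1 / (\<beta> + real n)) * - (y * (- (\<beta> + real n) * z)) = y * z" for y z
    using \<beta> by (simp add: field_simps)
  ultimately show ?case by (simp only:)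
qed

text \<open>With r = a/b and y = n/t, the normalised power y^(\<beta>+n) (y + r)^(-(\<beta>+n))
  equals (1 + tr/n)^(-n) (1 + tr/n)^(-\<beta>), which tends to exp(-tr).\<close>

lemma fdcm_edge_exp:
  assumes fd: "fdcm (\<lambda>x. (a x + x e * b x) powr - \<beta>)"
    and a: "\<And>x. pos_fun x \<Longrightarrow> 0 \<le> a x" and b: "\<And>x. pos_fun x \<Longrightarrow> 0 < b x"
    and ind: "\<And>x y. a (x(e := y)) = a x" "\<And>x y. b (x(e := y)) = b x"
    and \<beta>: "0 < \<beta>" and t: "0 \<le> t"
  shows "fdcm (\<lambda>x. b x powr - \<beta> * exp (- (t * (a x / b x))))"
proof -
  have pos: "fdcm (\<lambda>x. b x powr - \<beta> * exp (- (t * (a x / b x))))" if t: "0 < t" for t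
  proof (rule fdcm_limit)
    \<comment> \<open>The value at which \<open>x e\<close> is frozen; \<open>Suc n\<close> keeps it
      positive from the start.\<close>
    define y where "y n = real (Suc n) / t" for n
    have y: "0 < y n" for n using t by (simp add: y_def)
    fix n
    have "fdcm (\<lambda>x. b (x(e := y n)) powr - \<beta> *
        ((x(e := y n)) e + a (x(e := y n)) / b (x(e := y n))) powr - (\<beta> + real (Suc n)))"
      by (rule fdcm_fix[OF y fdcm_edge_powers[OF fd a b ind \<beta>]])
    then have "fdcm (\<lambda>x. y n powr (\<beta> + real (Suc n)) *
        (b x powr - \<beta> * (y n + a x / b x) powr - (\<beta> + real (Suc n))))"
      by (intro fdcm_cmult) (simp_all add: ind)
    then show "fdcm (\<lambda>x. b x powr - \<beta> *
        (inverse ((1 + t * (a x / b x) / real (Suc n)) ^ Suc n) *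
         (1 + t * (a x / b x) / real (Suc n)) powr - \<beta>))"
    proof (rule fdcm_cong[rotated])
      fix x :: "'a \<Rightarrow> real" assume x: "pos_fun x"
      define r where "r = a x / b x"
      have r: "0 \<le> r" using a[OF x] b[OF x] by (simp add: r_def)
      define q where "q = 1 + t * r / real (Suc n)"
      have q: "0 < q" using r t by (simp add: q_def add_pos_nonneg)
      have "y n * (t * r / real (Suc n)) = r" using t by (simp add: y_def del: of_nat_Suc)
      then have yr: "y n + r = y n * q" by (simp add: q_def distrib_left)
      have "(y n + r) powr - (\<beta> + real (Suc n))
          = y n powr - (\<beta> + real (Suc n)) * q powr - (\<beta> + real (Suc n))"
        unfolding yr using y[of n] q by (simp add: powr_mult)
      also have "q powr - (\<beta> + real (Suc n)) = inverse (q ^ Suc n) * q powr - \<beta>"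
      proof -
        have "q powr - (\<beta> + real (Suc n)) = q powr - real (Suc n) * q powr - \<beta>"
          by (simp flip: powr_add)
        also have "q powr - real (Suc n) = inverse (q ^ Suc n)"
          unfolding powr_minus using q by (simp only: powr_realpow)
        finally show ?thesis .
      qed
      finally have "y n powr (\<beta> + real (Suc n)) * (y n + r) powr - (\<beta> + real (Suc n))
          = (y n powr (\<beta> + real (Suc n)) * y n powr - (\<beta> + real (Suc n))) * (inverse (q ^ Suc n) * q powr - \<beta>)"
        by simp
      also have "y n powr (\<beta> + real (Suc n)) * y n powr - (\<beta> + real (Suc n)) = 1"
        using y[of n] by (simp flip: powr_add)
      finally have *: "y n powr (\<beta> + real (Suc n)) * (y n + r) powr - (\<beta> + real (Suc n))
          = inverse (q ^ Suc n) * q powr - \<beta>" by simp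
      show "y n powr (\<beta> + real (Suc n)) * (b x powr - \<beta> * (y n + a x / b x) powr - (\<beta> + real (Suc n))) =
          b x powr - \<beta> * (inverse ((1 + t * (a x / b x) / real (Suc n)) ^ Suc n) *
         (1 + t * (a x / b x) / real (Suc n)) powr - \<beta>)"
        unfolding r_def[symmetric] q_def[symmetric] *[symmetric] by (simp only: mult_ac)
    qed
  next
    fix x :: "'a \<Rightarrow> real" assume x: "pos_fun x"
    define z where "z = t * (a x / b x)"
    have "(\<lambda>n. (1 + z / real (Suc n)) ^ Suc n) \<longlonglongrightarrow> exp z"
      by (rule LIMSEQ_Suc[OF tendsto_exp_limit_sequentially])
    moreover have "(\<lambda>n. 1 + z / real (Suc n)) \<longlonglongrightarrow> 1 + z * 0"
      unfolding divide_inverse by (intro tendsto_intros LIMSEQ_inverse_real_of_nat)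
    ultimately have "(\<lambda>n. b x powr - \<beta> * (inverse ((1 + z / real (Suc n)) ^ Suc n) *
         (1 + z / real (Suc n)) powr - \<beta>)) \<longlonglongrightarrow> b x powr - \<beta> * (inverse (exp z) * (1 + z * 0) powr - \<beta>)"
      by (intro tendsto_mult tendsto_const tendsto_inverse tendsto_powr) auto
    then show "(\<lambda>n. b x powr - \<beta> * (inverse ((1 + t * (a x / b x) / real (Suc n)) ^ Suc n) *
         (1 + t * (a x / b x) / real (Suc n)) powr - \<beta>)) \<longlonglongrightarrow> b x powr - \<beta> * exp (- (t * (a x / b x)))"
      by (simp add: z_def exp_minus)
  qed
  show ?thesis
  proof (cases "t = 0")
    case True
    \<comment> \<open>There is no evaluation point n/t for \<open>t = 0\<close>, so this case is the
      limit of the positive parameters 1/(n+1).\<close>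
    have "(\<lambda>n. b x powr - \<beta> * exp (- (inverse (real (Suc n)) * (a x / b x)))) \<longlonglongrightarrow>
        b x powr - \<beta> * exp (- (0 * (a x / b x)))" for x
      by (intro tendsto_intros LIMSEQ_inverse_real_of_nat)
    then show ?thesis unfolding True by (rule fdcm_limit[rotated]) (rule pos, simp)
  qed (use pos t in auto)
qed

section \<open>Connections expressed through effective conductances\<close>

lemma fdcm_parallel:
  assumes 1: "\<And>t. 0 \<le> t \<Longrightarrow> fdcm (\<lambda>x. b1 x powr - \<beta> * exp (- (t * (a1 x / b1 x))))"
    and 2: "\<And>t. 0 \<le> t \<Longrightarrow> fdcm (\<lambda>x. b2 x powr - \<beta> * exp (- (t * (a2 x / b2 x))))"
    and a: "\<And>x. pos_fun x \<Longrightarrow> 0 \<le> a1 x" "\<And>x. pos_fun x \<Longrightarrow> 0 \<le> a2 x"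
    and b: "\<And>x. pos_fun x \<Longrightarrow> 0 < b1 x" "\<And>x. pos_fun x \<Longrightarrow> 0 < b2 x"
    and \<beta>: "0 < \<beta>"
  shows "fdcm (\<lambda>x. (a1 x * b2 x + b1 x * a2 x + x e * (b1 x * b2 x)) powr - \<beta>)"
proof -
  define s where "s x = x e + a1 x / b1 x + a2 x / b2 x" for x
  have s: "0 < s x" if "pos_fun x" for x
    using a(1)[OF that] a(2)[OF that] b(1)[OF that] b(2)[OF that] that
    by (auto simp: s_def pos_fun_def intro!: add_pos_nonneg)
  have "fdcm (\<lambda>x. (b1 x powr - \<beta> * b2 x powr - \<beta>) * s x powr - \<beta>)"
  proof (rule fdcm_laplace_powr[OF _ s])
    fix t :: real assume t: "0 \<le> t"
    have "fdcm (\<lambda>x. exp (- (t * x e)) * ((b1 x powr - \<beta> * exp (- (t * (a1 x / b1 x)))) *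
        (b2 x powr - \<beta> * exp (- (t * (a2 x / b2 x))))))"
      by (intro fdcm_mult fdcm_exp 1 2 t)
    moreover have "exp (- (t * s x)) = exp (- (t * x e)) * (exp (- (t * (a1 x / b1 x))) * exp (- (t * (a2 x / b2 x))))" for x
      unfolding exp_add[symmetric] by (simp add: s_def algebra_simps)
    ultimately show "fdcm (\<lambda>x. (b1 x powr - \<beta> * b2 x powr - \<beta>) * exp (- (t * s x)))"
      by (simp add: mult_ac)
  qed (use \<beta> in auto)
  then show ?thesis
  proof (rule fdcm_cong[rotated])
    fix x :: "'a \<Rightarrow> real" assume x: "pos_fun x"
    have "a1 x * b2 x + b1 x * a2 x + x e * (b1 x * b2 x) = (b1 x * b2 x) * s x"
      using b(1)[OF x] b(2)[OF x] by (simp add: s_def field_simps)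
    then show "(b1 x powr - \<beta> * b2 x powr - \<beta>) * s x powr - \<beta> =
        (a1 x * b2 x + b1 x * a2 x + x e * (b1 x * b2 x)) powr - \<beta>"
      using b(1)[OF x] b(2)[OF x] s[OF x] by (simp add: powr_mult)
  qed
qed

text \<open>Complete the square: the weighted sum of (w - u_i)^2 is s (w - m)^2 + Q, with s the
  total weight and m the centre of mass. Integrating over w gives s^(-1/2) exp(-Q) up to a constant,
  and the variance formula writes Q with pair weights a_i a_j / s, the star-mesh weights.\<close>

lemma fdcm_gaussian:
  fixes u :: "'i \<Rightarrow> real"
  assumes fd: "\<And>w. fdcm (\<lambda>x. c x * exp (- (\<Sum>i\<in>I. a i x * (w - u i)\<^sup>2)))"
    and I: "finite I" "I \<noteq> {}" and a: "\<And>i x. i \<in> I \<Longrightarrow> pos_fun x \<Longrightarrow> 0 < a i x"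
  shows "fdcm (\<lambda>x. c x * ((\<Sum>i\<in>I. a i x) powr - (1/2) *
           exp (- ((\<Sum>i\<in>I. \<Sum>j\<in>I. a i x * a j x * (u i - u j)\<^sup>2) / (2 * (\<Sum>i\<in>I. a i x))))))"
proof -
  define s where "s x = (\<Sum>i\<in>I. a i x)" for x
  define m where "m x = (\<Sum>i\<in>I. a i x * u i) / s x" for x
  define q where "q x = (\<Sum>i\<in>I. a i x * (u i)\<^sup>2)" for x
  define Q where "Q x = (\<Sum>i\<in>I. \<Sum>j\<in>I. a i x * a j x * (u i - u j)\<^sup>2) / (2 * s x)" for x
  have s: "0 < s x" if "pos_fun x" for x unfolding s_def using a I that by (intro sum_pos) auto
  have Q: "Q x = q x - s x * (m x)\<^sup>2" if "pos_fun x" for x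
  proof -
    have "(\<Sum>i\<in>I. \<Sum>j\<in>I. a i x * a j x * (u i - u j)\<^sup>2) =
        (\<Sum>i\<in>I. \<Sum>j\<in>I. (a i x * (u i)\<^sup>2) * a j x) + (\<Sum>i\<in>I. \<Sum>j\<in>I. a i x * (a j x * (u j)\<^sup>2))
        - 2 * (\<Sum>i\<in>I. \<Sum>j\<in>I. (a i x * u i) * (a j x * u j))"
      by (simp add: sum_distrib_left sum.distrib[symmetric] sum_subtractf[symmetric] power2_eq_square algebra_simps)
    also have "\<dots> = q x * s x + s x * q x - 2 * ((m x * s x) * (m x * s x))"
      unfolding q_def s_def m_def sum_product[symmetric] using s[OF that] by (simp add: s_def)
    finally show ?thesis using s[OF that] by (simp add: Q_def field_simps power2_eq_square)
  qed
  have "fdcm (\<lambda>x. c x * (s x powr - (1/2) * exp (- Q x)))"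
  proof (rule fdcm_integral)
    show "fdcm (\<lambda>x. (1 / sqrt pi) * (c x * exp (- (\<Sum>i\<in>I. a i x * (w - u i)\<^sup>2))))" for w
      by (intro fdcm_cmult fd) simp
    fix x :: "'a \<Rightarrow> real" assume x: "pos_fun x"
    have eq: "(\<Sum>i\<in>I. a i x * (w - u i)\<^sup>2) = s x * (w - m x)\<^sup>2 + Q x" for w
    proof -
      have "(\<Sum>i\<in>I. a i x * (w - u i)\<^sup>2) = w\<^sup>2 * s x - 2 * w * (\<Sum>i\<in>I. a i x * u i) + q x"
        unfolding s_def q_def sum_distrib_left sum.distrib[symmetric] sum_subtractf[symmetric]
        by (intro sum.cong) (auto simp: power2_eq_square algebra_simps)
      also have "(\<Sum>i\<in>I. a i x * u i) = s x * m x" using s[OF x] by (simp add: m_def)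
      finally show ?thesis unfolding Q[OF x] by (simp add: power2_eq_square algebra_simps)
    qed
    show "has_bochner_integral lborel (\<lambda>w. (1 / sqrt pi) * (c x * exp (- (\<Sum>i\<in>I. a i x * (w - u i)\<^sup>2))))
        (c x * (s x powr - (1/2) * exp (- Q x)))"
      using has_bochner_integral_mult_right[where c = "c x / sqrt pi",
          OF gaussian_integral_quadratic[OF s[OF x], of "m x" "Q x"]]
      by (simp add: eq mult_ac)
  qed
  then show ?thesis by (simp add: Q_def s_def)
qed

text \<open>With s = r1 + x_e the base is s (r2 + x_e r1 / s), and a Gamma integral handles the
  second factor. In its exponent x_e r1 / s is the conductance of two resistors in series, that is,
  the minimum over w of r1 w^2 + x_e (w - 1)^2. A Gaussian integral over w produces it together with
  s^(-1/2); what remains of s^(-\<beta>) is a second Gamma integral.\<close>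

lemma fdcm_series:
  assumes 1: "\<And>t. 0 \<le> t \<Longrightarrow> fdcm (\<lambda>x. p1 x * exp (- (t * r1 x)))"
    and 2: "\<And>t. 0 \<le> t \<Longrightarrow> fdcm (\<lambda>x. p2 x * exp (- (t * r2 x)))"
    and r: "\<And>x. pos_fun x \<Longrightarrow> 0 < r1 x" "\<And>x. pos_fun x \<Longrightarrow> 0 < r2 x"
    and \<beta>: "1/2 \<le> \<beta>"
  shows "fdcm (\<lambda>x. p1 x * p2 x * (r1 x * r2 x + x e * (r1 x + r2 x)) powr - \<beta>)"
proof -
  define s where "s x = r1 x + x e" for x
  have s: "0 < s x" "0 < x e" if "pos_fun x" for x
    using r(1)[OF that] that by (auto simp: s_def pos_fun_def intro: add_pos_pos)
  have "fdcm (\<lambda>x. (p1 x * p2 x * s x powr - \<beta>) * (r2 x + x e * r1 x / s x) powr - \<beta>)"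
  proof (rule fdcm_laplace_powr)
    show "0 < r2 x + x e * r1 x / s x" if "pos_fun x" for x
      using s[OF that] r(1)[OF that] r(2)[OF that] by (simp add: add_pos_nonneg)
    fix t :: real assume t: "0 \<le> t"
    \<comment> \<open>Two springs meet at \<open>w\<close>; their fixed ends \<open>0\<close> and
      \<open>sqrt t\<close> have squared distance \<open>t\<close>.\<close>
    define a where "a i x = (if i then r1 x else x e)" for i x
    define u where "u i = (if i then 0 else sqrt t)" for i
    have "fdcm (\<lambda>x. (p1 x * p2 x * exp (- (t * r2 x)) * s x powr - (\<beta> - 1/2)) *
        ((\<Sum>i\<in>UNIV. a i x) powr - (1/2) *
           exp (- ((\<Sum>i\<in>UNIV. \<Sum>j\<in>UNIV. a i x * a j x * (u i - u j)\<^sup>2) / (2 * (\<Sum>i\<in>UNIV. a i x))))))"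
    proof (rule fdcm_gaussian)
      show "0 < a i x" if "pos_fun x" for i x using s[OF that] r(1)[OF that] by (simp add: a_def)
      fix w :: real
      have "fdcm (\<lambda>x. (p1 x * p2 x * exp (- (t * r2 x)) * exp (- (r1 x * w\<^sup>2 + x e * (w - sqrt t)\<^sup>2))) * s x powr - (\<beta> - 1/2))"
      proof (rule fdcm_laplace_powr[OF _ s(1)])
        fix \<tau> :: real assume \<tau>: "0 \<le> \<tau>"
        \<comment> \<open>Collected by variable, the exponent has nonnegative coefficients of
          \<open>r1 x\<close>, \<open>r2 x\<close> and \<open>x e\<close>, so the three factors are
          covered by the hypotheses and by \<open>fdcm_exp\<close>.\<close>
        have "fdcm (\<lambda>x. (p1 x * exp (- ((w\<^sup>2 + \<tau>) * r1 x))) * (p2 x * exp (- (t * r2 x))) *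
            exp (- (((w - sqrt t)\<^sup>2 + \<tau>) * x e)))"
          by (intro fdcm_mult fdcm_exp 1 2) (use t \<tau> in auto)
        moreover have "exp (- (r1 x * w\<^sup>2 + x e * (w - sqrt t)\<^sup>2)) * exp (- (\<tau> * s x)) =
            exp (- ((w\<^sup>2 + \<tau>) * r1 x)) * exp (- (((w - sqrt t)\<^sup>2 + \<tau>) * x e))" for x
          unfolding exp_add[symmetric] by (simp add: s_def distrib_left distrib_right mult_ac)
        then have "p1 x * p2 x * exp (- (t * r2 x)) * exp (- (r1 x * w\<^sup>2 + x e * (w - sqrt t)\<^sup>2)) * exp (- (\<tau> * s x))
            = (p1 x * exp (- ((w\<^sup>2 + \<tau>) * r1 x))) * (p2 x * exp (- (t * r2 x))) *
            exp (- (((w - sqrt t)\<^sup>2 + \<tau>) * x e))" for x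
          by (simp only: mult.assoc) (simp only: mult_ac)
        ultimately show "fdcm (\<lambda>x. p1 x * p2 x * exp (- (t * r2 x)) *
            exp (- (r1 x * w\<^sup>2 + x e * (w - sqrt t)\<^sup>2)) * exp (- (\<tau> * s x)))"
          by (simp only:)
      qed (use \<beta> in auto)
      then show "fdcm (\<lambda>x. p1 x * p2 x * exp (- (t * r2 x)) * s x powr - (\<beta> - 1/2) *
          exp (- (\<Sum>i\<in>UNIV. a i x * (w - u i)\<^sup>2)))"
        by (simp add: UNIV_bool a_def u_def mult_ac add_ac)
    qed auto
    then show "fdcm (\<lambda>x. p1 x * p2 x * s x powr - \<beta> * exp (- (t * (r2 x + x e * r1 x / s x))))"
    proof (rule fdcm_cong[rotated])
      fix x :: "'a \<Rightarrow> real" assume x: "pos_fun x"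
      have 1: "(\<Sum>i\<in>UNIV. a i x) = s x" by (simp add: UNIV_bool a_def s_def)
      have 2: "(\<Sum>i\<in>UNIV. \<Sum>j\<in>UNIV. a i x * a j x * (u i - u j)\<^sup>2) = 2 * (t * (x e * r1 x))"
        using t by (simp add: UNIV_bool a_def u_def)
      have 3: "s x powr - (\<beta> - 1/2) * s x powr - (1/2) = s x powr - \<beta>" by (simp flip: powr_add)
      have 4: "2 * (t * (x e * r1 x)) / (2 * s x) = t * (x e * r1 x / s x)" by simp
      have 5: "exp (- (t * (r2 x + x e * r1 x / s x))) = exp (- (t * r2 x)) * exp (- (t * (x e * r1 x / s x)))"
        unfolding exp_add[symmetric] by (simp add: distrib_left)
      show "p1 x * p2 x * exp (- (t * r2 x)) * s x powr - (\<beta> - 1 / 2) *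
         ((\<Sum>i\<in>UNIV. a i x) powr - (1 / 2) *
          exp (- ((\<Sum>i\<in>UNIV. \<Sum>j\<in>UNIV. a i x * a j x * (u i - u j)\<^sup>2) / (2 * (\<Sum>i\<in>UNIV. a i x))))) =
         p1 x * p2 x * s x powr - \<beta> * exp (- (t * (r2 x + x e * r1 x / s x)))"
        unfolding 1 2 4 5 3[symmetric] by (simp only: mult_ac)
    qed
  qed (use \<beta> in auto)
  then show ?thesis
  proof (rule fdcm_cong[rotated])
    fix x :: "'a \<Rightarrow> real" assume x: "pos_fun x"
    have "r1 x * r2 x + x e * (r1 x + r2 x) = s x * (r2 x + x e * r1 x / s x)"
      using s(1)[OF x] by (simp add: field_simps) (simp add: s_def algebra_simps)
    then show "p1 x * p2 x * s x powr - \<beta> * (r2 x + x e * r1 x / s x) powr - \<beta> =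
        p1 x * p2 x * (r1 x * r2 x + x e * (r1 x + r2 x)) powr - \<beta>"
      using s[OF x] r(1)[OF x] r(2)[OF x] by (simp add: powr_mult)
  qed
qed

text \<open>Squared distances are sums over coordinates, so the coordinates are integrated one at a
  time; \<open>c\<close> is arbitrary in order to absorb the factors of the other
  coordinates.\<close>

lemma fdcm_gaussian_multi:
  fixes u :: "'i \<Rightarrow> nat \<Rightarrow> real"
  assumes I: "finite I" "I \<noteq> {}" and a: "\<And>i x. i \<in> I \<Longrightarrow> pos_fun x \<Longrightarrow> 0 < a i x"
    and fd: "\<And>z. fdcm (\<lambda>x. c x * exp (- (\<Sum>i\<in>I. a i x * (\<Sum>k<d. (z k - u i k)\<^sup>2))))"
  shows "fdcm (\<lambda>x. c x * ((\<Sum>i\<in>I. a i x) powr - (real d / 2) *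
           exp (- ((\<Sum>i\<in>I. \<Sum>j\<in>I. a i x * a j x * (\<Sum>k<d. (u i k - u j k)\<^sup>2)) / (2 * (\<Sum>i\<in>I. a i x))))))"
  using fd
proof (induction d arbitrary: c)
  case 0
  have s: "0 < (\<Sum>i\<in>I. a i x)" if "pos_fun x" for x using a I that by (intro sum_pos) auto
  show ?case by (rule fdcm_cong[OF _ 0]) (use s in \<open>simp add: less_imp_neq[symmetric]\<close>)
next
  case (Suc d)
  define s where "s x = (\<Sum>i\<in>I. a i x)" for x
  define Q where "Q x = (\<Sum>i\<in>I. \<Sum>j\<in>I. a i x * a j x * (\<Sum>k<d. (u i k - u j k)\<^sup>2)) / (2 * s x)" for x
  define R where "R x = (\<Sum>i\<in>I. \<Sum>j\<in>I. a i x * a j x * (u i d - u j d)\<^sup>2) / (2 * s x)" for x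
  have "fdcm (\<lambda>x. (c x * (s x powr - (real d / 2) * exp (- Q x))) * (s x powr - (1/2) * exp (- R x)))"
    unfolding s_def R_def
  proof (rule fdcm_gaussian[OF _ I a])
    fix w :: real
    have "fdcm (\<lambda>x. (c x * exp (- (\<Sum>i\<in>I. a i x * (w - u i d)\<^sup>2))) * (s x powr - (real d / 2) * exp (- Q x)))"
      unfolding s_def Q_def
    proof (rule Suc.IH)
      fix z :: "nat \<Rightarrow> real"
      \<comment> \<open>Coordinate \<open>d\<close> of the point is the outer variable
        \<open>w\<close>; the induction hypothesis integrates the coordinates below
        \<open>d\<close>.\<close>
      have "(\<Sum>i\<in>I. a i x * (\<Sum>k<Suc d. ((z(d := w)) k - u i k)\<^sup>2)) =
          (\<Sum>i\<in>I. a i x * (w - u i d)\<^sup>2) + (\<Sum>i\<in>I. a i x * (\<Sum>k<d. (z k - u i k)\<^sup>2))" for x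
        by (simp add: distrib_left sum.distrib add.commute)
      then show "fdcm (\<lambda>x. c x * exp (- (\<Sum>i\<in>I. a i x * (w - u i d)\<^sup>2)) *
          exp (- (\<Sum>i\<in>I. a i x * (\<Sum>k<d. (z k - u i k)\<^sup>2))))"
        using Suc.prems[of "z(d := w)"] by (simp only: minus_add_distrib exp_add mult.assoc)
    qed
    then show "fdcm (\<lambda>x. c x * ((\<Sum>i\<in>I. a i x) powr - (real d / 2) * exp (- Q x)) *
        exp (- (\<Sum>i\<in>I. a i x * (w - u i d)\<^sup>2)))"
      unfolding s_def by (simp only: mult_ac)
  qed
  moreover have "c x * (s x powr - (real d / 2) * exp (- Q x)) * (s x powr - (1/2) * exp (- R x)) =
      c x * (s x powr - (real (Suc d) / 2) * exp (- (Q x + R x)))" for x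
  proof -
    have e: "- (real (Suc d) / 2) = - (real d / 2) + - (1/2)" by (simp add: field_simps)
    show ?thesis unfolding e powr_add minus_add_distrib exp_add by (simp only: mult_ac)
  qed
  moreover have "Q x + R x = (\<Sum>i\<in>I. \<Sum>j\<in>I. a i x * a j x * (\<Sum>k<Suc d. (u i k - u j k)\<^sup>2)) / (2 * s x)" for x
    by (simp add: Q_def R_def distrib_left sum.distrib add_divide_distrib)
  ultimately show ?case unfolding s_def by simp
qed

section \<open>Smoothness, and the passage from differences to derivatives\<close>

inductive smooth_fun :: "'e set \<Rightarrow> (('e \<Rightarrow> real) \<Rightarrow> real) \<Rightarrow> bool" for E where
  const: "smooth_fun E (\<lambda>x. c)"
| coord: "e \<in> E \<Longrightarrow> smooth_fun E (\<lambda>x. x e)"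
| add: "smooth_fun E f \<Longrightarrow> smooth_fun E g \<Longrightarrow> smooth_fun E (\<lambda>x. f x + g x)"
| mult: "smooth_fun E f \<Longrightarrow> smooth_fun E g \<Longrightarrow> smooth_fun E (\<lambda>x. f x * g x)"
| powr: "smooth_fun E f \<Longrightarrow> (\<And>x. (\<forall>e\<in>E. 0 < x e) \<Longrightarrow> 0 < f x) \<Longrightarrow> smooth_fun E (\<lambda>x. f x powr r)"

lemma smooth_fun_sum: "(\<And>i. i \<in> I \<Longrightarrow> smooth_fun E (f i)) \<Longrightarrow> smooth_fun E (\<lambda>x. \<Sum>i\<in>I. f i x)"
  by (induction I rule: infinite_finite_induct) (auto intro: smooth_fun.intros)

lemma smooth_fun_prod: "(\<And>i. i \<in> I \<Longrightarrow> smooth_fun E (f i)) \<Longrightarrow> smooth_fun E (\<lambda>x. \<Prod>i\<in>I. f i x)"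
  by (induction I rule: infinite_finite_induct) (auto intro: smooth_fun.intros)

lemma smooth_fun_continuous: "smooth_fun E f \<Longrightarrow> continuous_on {x. \<forall>e\<in>E. 0 < x e} f"
proof (induction rule: smooth_fun.induct)
  case (coord e)
  show ?case by (rule continuous_on_subset[OF continuous_on_product_coordinates]) auto
next
  case (powr f r)
  have "f x \<noteq> 0" if "\<forall>e\<in>E. 0 < x e" for x using powr.hyps(2)[of x] that by auto
  with powr show ?case by (intro continuous_on_powr continuous_on_const) auto
qed (auto intro!: continuous_intros)

text \<open>The reason for the inductive class: it is closed under partial derivatives and consists
  of continuous functions, so one induction yields derivatives of all orders.\<close>

lemma smooth_fun_derivative:
  assumes "smooth_fun E f" "e \<in> E"
  shows "\<exists>g. smooth_fun E g \<and>
    (\<forall>x. (\<forall>e\<in>E. 0 < x e) \<longrightarrow> ((\<lambda>t. f (x(e := t))) has_real_derivative g x) (at (x e)))"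
  using assms(1)
proof (induction rule: smooth_fun.induct)
  case (const c)
  show ?case by (rule exI[of _ "\<lambda>x. 0"]) (auto intro: smooth_fun.const)
next
  case (coord e')
  show ?case
    by (rule exI[of _ "\<lambda>x. if e' = e then 1 else 0"]) (auto intro: smooth_fun.const)
next
  case (add f g)
  then obtain f' g' where s: "smooth_fun E f'" "smooth_fun E g'"
    and d: "\<And>x. \<forall>e\<in>E. 0 < x e \<Longrightarrow> ((\<lambda>t. f (x(e := t))) has_real_derivative f' x) (at (x e))"
      "\<And>x. \<forall>e\<in>E. 0 < x e \<Longrightarrow> ((\<lambda>t. g (x(e := t))) has_real_derivative g' x) (at (x e))"
    by blast
  have "((\<lambda>t. f (x(e := t)) + g (x(e := t))) has_real_derivative f' x + g' x) (at (x e))"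
    if "\<forall>e\<in>E. 0 < x e" for x
    using DERIV_add[OF d(1)[OF that] d(2)[OF that]] .
  with s show ?case by (intro exI[of _ "\<lambda>x. f' x + g' x"] conjI allI impI smooth_fun.add)
next
  case (mult f g)
  then obtain f' g' where s: "smooth_fun E f'" "smooth_fun E g'"
    and d: "\<And>x. \<forall>e\<in>E. 0 < x e \<Longrightarrow> ((\<lambda>t. f (x(e := t))) has_real_derivative f' x) (at (x e))"
      "\<And>x. \<forall>e\<in>E. 0 < x e \<Longrightarrow> ((\<lambda>t. g (x(e := t))) has_real_derivative g' x) (at (x e))"
    by blast
  have "((\<lambda>t. f (x(e := t)) * g (x(e := t))) has_real_derivative f x * g' x + f' x * g x) (at (x e))"
    if "\<forall>e\<in>E. 0 < x e" for x
    using DERIV_mult'[OF d(1)[OF that] d(2)[OF that]] by simp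
  with mult.hyps s show ?case
    by (intro exI[of _ "\<lambda>x. f x * g' x + f' x * g x"] conjI allI impI smooth_fun.add smooth_fun.mult)
next
  case (powr f r)
  then obtain f' where s: "smooth_fun E f'"
    and d: "\<And>x. \<forall>e\<in>E. 0 < x e \<Longrightarrow> ((\<lambda>t. f (x(e := t))) has_real_derivative f' x) (at (x e))"
    by blast
  have "((\<lambda>t. f (x(e := t)) powr r) has_real_derivative r * (f x powr (r - 1) * f' x)) (at (x e))"
    if "\<forall>e\<in>E. 0 < x e" for x
    using DERIV_fun_powr[OF d[OF that], of r] powr.hyps(2)[OF that] by (simp add: mult.assoc)
  moreover have "smooth_fun E (\<lambda>x. r * (f x powr (r - 1) * f' x))"
    by (intro smooth_fun.mult smooth_fun.powr smooth_fun.const s powr.hyps)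
  ultimately show ?case by blast
qed

text \<open>Equality holds only where the coordinates in \<open>E\<close> are positive; a derivative
  is local, so agreement on an open half-line is enough to differentiate once more.\<close>

lemma iterated_partial_deriv_smooth:
  assumes "smooth_fun E f" "set es \<subseteq> E"
  shows "\<exists>g. smooth_fun E g \<and> (\<forall>x. (\<forall>e\<in>E. 0 < x e) \<longrightarrow> iterated_partial_deriv es f x = g x)"
  using assms(2)
proof (induction es)
  case Nil
  then show ?case using assms(1) by (auto simp: iterated_partial_deriv_def)
next
  case (Cons e es)
  then obtain g where g: "smooth_fun E g" "\<And>x. (\<forall>e\<in>E. 0 < x e) \<Longrightarrow> iterated_partial_deriv es f x = g x"
    by auto
  obtain g' where g': "smooth_fun E g'"
    "\<And>x. (\<forall>e\<in>E. 0 < x e) \<Longrightarrow> ((\<lambda>t. g (x(e := t))) has_real_derivative g' x) (at (x e))"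
    using smooth_fun_derivative[OF g(1), of e] Cons.prems by auto
  have "iterated_partial_deriv (e # es) f x = g' x" if x: "\<forall>e\<in>E. 0 < x e" for x
  proof -
    have "((\<lambda>t. iterated_partial_deriv es f (x(e := t))) has_real_derivative g' x) (at (x e))"
      by (rule has_field_derivative_transform_within_open[OF g'(2)[OF x], of "{0<..}"])
        (use x Cons.prems in \<open>auto intro!: g(2)[symmetric]\<close>)
    then show ?thesis by (simp add: iterated_partial_deriv_def partial_deriv_def DERIV_imp_deriv)
  qed
  with g'(1) show ?case by auto
qed

text \<open>Every derivative contributes one sign through \<open>fdcm_derivative\<close>. Points of
  \<open>pos_orthant E\<close> are \<open>undefined\<close> outside \<open>E\<close> whereas
  \<open>fdcm\<close> speaks of functions positive everywhere; \<open>dep\<close> bridges the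
  two.\<close>

lemma completely_monotone_if_fdcm:
  assumes f: "smooth_fun E f" and fd: "fdcm f" and dep: "\<And>x y. (\<And>e. e \<in> E \<Longrightarrow> x e = y e) \<Longrightarrow> f x = f y"
  shows "completely_monotone E f"
proof -
  have der: "((\<lambda>t. iterated_partial_deriv es f (x(e := t))) has_real_derivative
      iterated_partial_deriv (e # es) f x) (at (x e))"
    if es: "set es \<subseteq> E" and e: "e \<in> E" and x: "\<forall>e\<in>E. 0 < x e" for es e x
  proof -
    obtain g where g: "smooth_fun E g" "\<And>x. (\<forall>e\<in>E. 0 < x e) \<Longrightarrow> iterated_partial_deriv es f x = g x"
      using iterated_partial_deriv_smooth[OF f es] by auto
    obtain g' where g': "((\<lambda>t. g (x(e := t))) has_real_derivative g') (at (x e))"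
      using smooth_fun_derivative[OF g(1) e] x by blast
    have "((\<lambda>t. iterated_partial_deriv es f (x(e := t))) has_real_derivative g') (at (x e))"
      by (rule has_field_derivative_transform_within_open[OF g', of "{0<..}"])
        (use x e in \<open>auto intro!: g(2)[symmetric]\<close>)
    then show ?thesis by (simp add: iterated_partial_deriv_def partial_deriv_def DERIV_imp_deriv)
  qed
  have dep': "iterated_partial_deriv es f x = iterated_partial_deriv es f y"
    if "set es \<subseteq> E" "\<And>e. e \<in> E \<Longrightarrow> x e = y e" for es x y
    using that
  proof (induction es arbitrary: x y)
    case Nil
    show ?case using dep[OF Nil(2)] by (simp add: iterated_partial_deriv_def)
  next
    case (Cons e es)
    have "iterated_partial_deriv es f (x(e := t)) = iterated_partial_deriv es f (y(e := t))" for t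
      by (rule Cons.IH) (use Cons.prems in auto)
    moreover have "x e = y e" using Cons.prems by simp
    ultimately show ?case
      by (simp only: iterated_partial_deriv_def partial_deriv_def foldr.simps comp_apply)
  qed
  have fd': "fdcm (\<lambda>x. (-1) ^ length es * iterated_partial_deriv es f x)" if "set es \<subseteq> E" for es
    using that
  proof (induction es)
    case Nil
    then show ?case using fd by (simp add: iterated_partial_deriv_def)
  next
    case (Cons e es)
    have "fdcm (\<lambda>x. - ((-1) ^ length es * iterated_partial_deriv (e # es) f x))"
      using Cons by (intro fdcm_derivative[where e = e, OF Cons.IH] DERIV_cmult der) (auto simp: pos_fun_def)
    then show ?case by simp
  qed
  have "0 \<le> (-1) ^ length es * iterated_partial_deriv es f x"
    if es: "set es \<subseteq> E" and x: "x \<in> pos_orthant E" for es x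
  proof -
    \<comment> \<open>Any positive value outside \<open>E\<close> would do; by \<open>dep'\<close>
      the derivatives do not see it.\<close>
    define y where "y e = (if e \<in> E then x e else 1)" for e
    have "pos_fun y" using x by (auto simp: y_def pos_fun_def pos_orthant_def PiE_def)
    from fdcm_nonneg[OF fd'[OF es] this] show ?thesis
      using dep'[OF es, of x y] by (simp add: y_def)
  qed
  moreover have "continuous_on (pos_orthant E) (iterated_partial_deriv es f)" if es: "set es \<subseteq> E" for es
  proof -
    obtain g where g: "smooth_fun E g" "\<And>x. (\<forall>e\<in>E. 0 < x e) \<Longrightarrow> iterated_partial_deriv es f x = g x"
      using iterated_partial_deriv_smooth[OF f es] by auto
    have "continuous_on (pos_orthant E) g"
      by (rule continuous_on_subset[OF smooth_fun_continuous[OF g(1)]]) (auto simp: pos_orthant_def PiE_def Pi_def)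
    moreover have "g x = iterated_partial_deriv es f x" if "x \<in> pos_orthant E" for x
      using g(2)[of x] that by (auto simp: pos_orthant_def PiE_def Pi_def)
    ultimately show ?thesis by (rule continuous_on_eq)
  qed
  moreover have "(\<lambda>t. iterated_partial_deriv es f (x(e := t))) differentiable (at (x e))"
    if "set es \<subseteq> E" "e \<in> E" "x \<in> pos_orthant E" for es e x
    using der[OF that(1,2), of x] that(3)
    by (auto simp: pos_orthant_def PiE_def real_differentiable_def)
  ultimately show ?thesis unfolding completely_monotone_def smooth_on_orthant_def by blast
qed

section \<open>Forest polynomials by deletion and contraction\<close>

text \<open>
  The pairs in \<open>R\<close> are vertices that have been identified, so that contracting an edge with
  ends \<open>{a, b}\<close> amounts to inserting \<open>(a, b)\<close> into \<open>R\<close>.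
\<close>

definition conn :: "('e \<Rightarrow> 'v set) \<Rightarrow> ('v \<times> 'v) set \<Rightarrow> 'e set \<Rightarrow> ('v \<times> 'v) set" where
  "conn N R S = (R \<union> R\<inverse> \<union> (\<Union>e\<in>S. N e \<times> N e))\<^sup>*"

lemma conn_refl [simp, intro!]: "(u, u) \<in> conn N R S"
  by (simp add: conn_def)

lemma conn_trans: "(u, v) \<in> conn N R S \<Longrightarrow> (v, w) \<in> conn N R S \<Longrightarrow> (u, w) \<in> conn N R S"
  unfolding conn_def by (rule rtrancl_trans)

lemma conn_sym: "(u, v) \<in> conn N R S \<Longrightarrow> (v, u) \<in> conn N R S"
proof -
  have "sym (R \<union> R\<inverse> \<union> (\<Union>e\<in>S. N e \<times> N e))" by (auto simp: sym_def)
  then have "sym (conn N R S)" unfolding conn_def by (rule sym_rtrancl)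
  then show "(u, v) \<in> conn N R S \<Longrightarrow> (v, u) \<in> conn N R S" by (auto dest: symD)
qed

lemma conn_rel: "(u, v) \<in> R \<Longrightarrow> (u, v) \<in> conn N R S"
  by (auto simp: conn_def)

lemma conn_edge: "e \<in> S \<Longrightarrow> u \<in> N e \<Longrightarrow> v \<in> N e \<Longrightarrow> (u, v) \<in> conn N R S"
  by (auto simp: conn_def)

text \<open>The tool for comparing connectivity in two graphs: check the generating pairs only.
  Typical choices of \<open>f\<close> are retractions that collapse one piece of a glued
  graph.\<close>

lemma conn_map:
  assumes R: "\<And>u v. (u, v) \<in> R \<Longrightarrow> (f u, f v) \<in> conn N' R' S'"
    and S: "\<And>e u v. e \<in> S \<Longrightarrow> u \<in> N e \<Longrightarrow> v \<in> N e \<Longrightarrow> (f u, f v) \<in> conn N' R' S'"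
    and uv: "(u, v) \<in> conn N R S"
  shows "(f u, f v) \<in> conn N' R' S'"
  using uv unfolding conn_def[of N]
proof (induction rule: rtrancl_induct)
  case (step v w)
  have "(f v, f w) \<in> conn N' R' S'" using step.hyps(2) R S conn_sym[OF R] by blast
  with step.IH show ?case by (rule conn_trans)
qed simp

lemma conn_least:
  assumes "R \<subseteq> conn N' R' S'" "\<And>e. e \<in> S \<Longrightarrow> N e \<times> N e \<subseteq> conn N' R' S'"
  shows "conn N R S \<subseteq> conn N' R' S'"
proof
  fix p assume p: "p \<in> conn N R S"
  have "(id (fst p), id (snd p)) \<in> conn N' R' S'"
    by (rule conn_map[where R = R and S = S and N = N]) (use assms p in auto)
  then show "p \<in> conn N' R' S'" by simp
qed

lemma conn_mono: "R \<subseteq> R' \<Longrightarrow> S \<subseteq> S' \<Longrightarrow> conn N R S \<subseteq> conn N R' S'"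
  by (rule conn_least) (auto intro: conn_rel conn_edge)

lemma conn_insert_subset: "conn N R S \<subseteq> conn N (insert p R) S"
  by (rule conn_mono) auto

lemma conn_insert_absorb: "(a, b) \<in> conn N R S \<Longrightarrow> conn N (insert (a, b) R) S = conn N R S"
  by (intro antisym conn_least conn_insert_subset) (auto intro: conn_rel conn_edge)

lemma conn_insert_edge:
  assumes "N e = {a, b}"
  shows "conn N R (insert e S) = conn N (insert (a, b) R) S"
proof (rule antisym)
  have ab: "(a, b) \<in> conn N (insert (a, b) R) S" by (simp add: conn_rel)
  show "conn N R (insert e S) \<subseteq> conn N (insert (a, b) R) S"
    by (rule conn_least) (use assms ab conn_sym[OF ab] in \<open>auto intro: conn_rel conn_edge\<close>)
  show "conn N (insert (a, b) R) S \<subseteq> conn N R (insert e S)"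
    by (rule conn_least) (use assms in \<open>auto intro: conn_rel conn_edge\<close>)
qed

text \<open>A path that uses the new pair several times can be shortened so that it uses it at most
  once, in one of the two directions.\<close>

lemma conn_insert_cases:
  assumes "(u, v) \<in> conn N (insert (a, b) R) S"
  shows "(u, v) \<in> conn N R S \<or> (u, a) \<in> conn N R S \<and> (b, v) \<in> conn N R S \<or>
    (u, b) \<in> conn N R S \<and> (a, v) \<in> conn N R S"
  using assms unfolding conn_def[of _ "insert (a, b) R"]
proof (induction rule: rtrancl_induct)
  case (step v w)
  have "(v, w) \<in> conn N R S \<or> (v = a \<and> w = b) \<or> (v = b \<and> w = a)"
    using step.hyps(2) conn_sym[OF conn_rel[of w v R N S]] by (auto intro: conn_rel conn_edge)
  then show ?case using step.IH conn_trans by (metis conn_refl)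
qed simp

text \<open>The Steinitz exchange property of graphic closure: a connection that needs the pair (a,
  b) runs from u to one of a, b and from the other to v, so joining u to v closes it up.\<close>

lemma conn_exchange:
  assumes uv: "(u, v) \<in> conn N (insert (a, b) R) S" and n: "(u, v) \<notin> conn N R S"
  shows "(a, b) \<in> conn N (insert (u, v) R) S"
proof -
  have m: "conn N R S \<subseteq> conn N (insert (u, v) R) S" by (rule conn_insert_subset)
  have "(u, v) \<in> conn N (insert (u, v) R) S" by (simp add: conn_rel)
  then show ?thesis
    using conn_insert_cases[OF uv] n m conn_sym conn_trans by (meson subsetD)
qed

section \<open>The graphic matroid contracted by \<open>R\<close>: bases, deletion and
  contraction\<close>

definition indep :: "('e \<Rightarrow> 'v set) \<Rightarrow> ('v \<times> 'v) set \<Rightarrow> 'e set \<Rightarrow> bool" where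
  "indep N R S \<longleftrightarrow> (\<forall>e\<in>S. \<not> N e \<times> N e \<subseteq> conn N R (S - {e}))"

definition bases :: "('e \<Rightarrow> 'v set) \<Rightarrow> ('v \<times> 'v) set \<Rightarrow> 'e set \<Rightarrow> 'e set set" where
  "bases N R E = {S. S \<subseteq> E \<and> indep N R S \<and> (\<forall>e\<in>E. N e \<times> N e \<subseteq> conn N R S)}"

definition forest_poly :: "('e \<Rightarrow> 'v set) \<Rightarrow> ('v \<times> 'v) set \<Rightarrow> 'e set \<Rightarrow> ('e \<Rightarrow> real) \<Rightarrow> real" where
  "forest_poly N R E x = (\<Sum>S\<in>bases N R E. \<Prod>e\<in>S. x e)"

definition two_ends :: "('e \<Rightarrow> 'v set) \<Rightarrow> 'e set \<Rightarrow> bool" where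
  "two_ends N E \<longleftrightarrow> (\<forall>e\<in>E. \<exists>a b. N e = {a, b})"

lemma spans_iff: "N e = {a, b} \<Longrightarrow> N e \<times> N e \<subseteq> conn N R S \<longleftrightarrow> (a, b) \<in> conn N R S"
  by (auto intro: conn_sym)

lemma two_endsE:
  assumes "two_ends N E" "e \<in> E" obtains a b where "N e = {a, b}"
  using assms unfolding two_ends_def by blast

lemma two_ends_subset: "two_ends N E \<Longrightarrow> S \<subseteq> E \<Longrightarrow> two_ends N S"
  unfolding two_ends_def by blast

lemma finite_bases: "finite E \<Longrightarrow> finite (bases N R E)"
  by (rule finite_subset[of _ "Pow E"]) (auto simp: bases_def)

text \<open>Otherwise take a smallest subset of \<open>S\<close> that joins \<open>a\<close> to
  \<open>b\<close>. Any edge \<open>f\<close> of it is essential, so by exchange \<open>f\<close> is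
  spanned by the other edges together with (a, b), against independence after contraction.\<close>

lemma indep_not_spanned:
  assumes S: "finite S" "two_ends N S" and i: "indep N (insert (a, b) R) S" and n: "(a, b) \<notin> conn N R {}"
  shows "(a, b) \<notin> conn N R S"
proof
  assume "(a, b) \<in> conn N R S"
  then obtain T where T: "T \<subseteq> S" "(a, b) \<in> conn N R T"
    and min: "\<And>T'. T' \<subseteq> S \<Longrightarrow> (a, b) \<in> conn N R T' \<Longrightarrow> card T \<le> card T'"
    using ex_has_least_nat[of "\<lambda>T. T \<subseteq> S \<and> (a, b) \<in> conn N R T" S card] by blast
  have finT: "finite T" using T(1) S(1) by (rule finite_subset)
  obtain f where f: "f \<in> T" using T(2) n by (cases "T = {}") auto
  obtain c d where cd: "N f = {c, d}" using S(2) T(1) f by (auto elim: two_endsE)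
  have "card (T - {f}) < card T" using f finT by (rule card_Diff1_less[rotated])
  then have nT: "(a, b) \<notin> conn N R (T - {f})" using min[of "T - {f}"] T(1) by auto
  have "(a, b) \<in> conn N (insert (c, d) R) (T - {f})"
    using T(2) f unfolding conn_insert_edge[of N f, OF cd, symmetric] by (simp add: insert_absorb)
  from conn_exchange[OF this nT] have "(c, d) \<in> conn N (insert (a, b) R) (S - {f})"
    using conn_mono[of "insert (a, b) R" "insert (a, b) R" "T - {f}" "S - {f}" N] T(1) by blast
  then show False using i f T(1) spans_iff[of N f, OF cd] unfolding indep_def by blast
qed

lemma indep_insert:
  assumes e: "e \<notin> S" "N e = {a, b}" and S: "finite S" "two_ends N S"
  shows "indep N R (insert e S) \<longleftrightarrow> (a, b) \<notin> conn N R {} \<and> indep N (insert (a, b) R) S"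
proof -
  have 1: "conn N R (insert e S - {f}) = conn N (insert (a, b) R) (S - {f})" if "f \<in> S" for f
    using conn_insert_edge[of N e a b R "S - {f}"] e that by (auto simp: insert_Diff_if)
  have 2: "conn N R (insert e S - {e}) = conn N R S" using e(1) by simp
  have "conn N R {} \<subseteq> conn N R S" by (rule conn_mono) auto
  then have "indep N R (insert e S) \<longleftrightarrow> (a, b) \<notin> conn N R S \<and> indep N (insert (a, b) R) S"
    unfolding indep_def using 1 2 spans_iff[of N e, OF e(2)] e(1) by (auto simp del: Diff_insert0 insert_Diff_single)
  then show ?thesis
    using indep_not_spanned[OF S, of a b R] \<open>conn N R {} \<subseteq> conn N R S\<close> by blast
qed

lemma bases_loop:
  assumes e: "e \<notin> E" "N e = {a, b}" and ab: "(a, b) \<in> conn N R {}"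
  shows "bases N R (insert e E) = bases N R E"
proof -
  have *: "N e \<times> N e \<subseteq> conn N R S" for S
    using ab conn_mono[of R R "{}" S N] spans_iff[of N e, OF e(2)] by blast
  then have "e \<notin> S" if "indep N R S" for S using that unfolding indep_def by blast
  with * show ?thesis by (auto simp: bases_def)
qed

text \<open>Bases with \<open>e\<close> are bases of the contraction plus \<open>e\<close>. Bases
  without \<open>e\<close> are those of the deletion, provided that \<open>E\<close> still joins the
  ends of \<open>e\<close>; for a bridge there are none.\<close>

lemma bases_insert:
  assumes e: "e \<notin> E" "N e = {a, b}" and E: "finite E" "two_ends N E" and ab: "(a, b) \<notin> conn N R {}"
  shows "bases N R (insert e E) =
    (if (a, b) \<in> conn N R E then bases N R E else {}) \<union> insert e ` bases N (insert (a, b) R) E"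
    (is "?L = ?A \<union> ?B")
proof (intro set_eqI)
  fix S
  show "S \<in> ?L \<longleftrightarrow> S \<in> ?A \<union> ?B"
  proof (cases "e \<in> S")
    case False
    then have "S \<notin> ?B" by auto
    moreover have "S \<in> ?L \<longleftrightarrow> S \<in> ?A"
    proof
      assume L: "S \<in> ?L"
      then have "(a, b) \<in> conn N R S" using spans_iff[of N e, OF e(2)] by (auto simp: bases_def)
      moreover have "S \<subseteq> E" using L False by (auto simp: bases_def)
      ultimately have "(a, b) \<in> conn N R E" using conn_mono[of R R S E N] by auto
      then show "S \<in> ?A" using L \<open>S \<subseteq> E\<close> by (auto simp: bases_def)
    next
      assume A: "S \<in> ?A"
      then have A': "(a, b) \<in> conn N R E" "S \<in> bases N R E" by (auto split: if_splits)
      have "conn N R E \<subseteq> conn N R S"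
        by (rule conn_least) (use A' in \<open>auto simp: bases_def intro: conn_rel\<close>)
      then have "N e \<times> N e \<subseteq> conn N R S" using A'(1) spans_iff[of N e, OF e(2)] by blast
      with A'(2) show "S \<in> ?L" by (auto simp: bases_def)
    qed
    ultimately show ?thesis by blast
  next
    case True
    define T where "T = S - {e}"
    have S: "S = insert e T" "e \<notin> T" using True by (auto simp: T_def)
    have "S \<notin> ?A" using True e(1) by (auto simp: bases_def split: if_splits)
    moreover have "S \<in> ?B \<longleftrightarrow> T \<in> bases N (insert (a, b) R) E"
    proof
      assume "S \<in> ?B"
      then obtain T' where T': "S = insert e T'" "T' \<in> bases N (insert (a, b) R) E" by blast
      then have "e \<notin> T'" using e(1) by (auto simp: bases_def)
      then have "T' = T" using T'(1) by (auto simp: T_def)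
      then show "T \<in> bases N (insert (a, b) R) E" using T' by simp
    qed (use S in auto)
    moreover have "S \<in> ?L \<longleftrightarrow> T \<in> bases N (insert (a, b) R) E"
    proof (cases "T \<subseteq> E")
      case T: True
      have "finite T" "two_ends N T" using T E finite_subset two_ends_subset by blast+
      from indep_insert[of e T N, OF S(2) e(2) this, of R]
      have i: "indep N R S \<longleftrightarrow> indep N (insert (a, b) R) T" using ab S(1) by simp
      have c: "conn N R S = conn N (insert (a, b) R) T"
        unfolding S(1) by (rule conn_insert_edge) (rule e(2))
      have "N e \<times> N e \<subseteq> conn N R S" using True by (auto intro: conn_edge)
      then show ?thesis using T i c S(1) by (auto simp: bases_def)
    next
      case False
      then have "\<not> S \<subseteq> insert e E" using S by auto
      then show ?thesis using False by (simp add: bases_def)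
    qed
    ultimately show ?thesis by blast
  qed
qed

lemma forest_poly_empty [simp]: "forest_poly N R {} x = 1"
proof -
  have "bases N R {} = {{}}" by (auto simp: bases_def indep_def)
  then show ?thesis by (simp add: forest_poly_def)
qed

lemma forest_poly_loop:
  "e \<notin> E \<Longrightarrow> N e = {a, b} \<Longrightarrow> (a, b) \<in> conn N R {} \<Longrightarrow> forest_poly N R (insert e E) x = forest_poly N R E x"
  unfolding forest_poly_def by (subst bases_loop) auto

lemma forest_poly_insert:
  assumes e: "e \<notin> E" "N e = {a, b}" and E: "finite E" "two_ends N E" and ab: "(a, b) \<notin> conn N R {}"
  shows "forest_poly N R (insert e E) x =
    (if (a, b) \<in> conn N R E then forest_poly N R E x else 0) + x e * forest_poly N (insert (a, b) R) E x"
proof -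
  let ?B = "bases N (insert (a, b) R) E"
  have nB: "finite T \<and> e \<notin> T" if "T \<in> ?B" for T
    using that e(1) finite_subset[OF _ E(1)] by (auto simp: bases_def)
  have inj: "inj_on (insert e) ?B" using nB by (auto simp: inj_on_def dest: insert_ident)
  have "(\<Sum>S\<in>insert e ` ?B. \<Prod>e\<in>S. x e) = (\<Sum>T\<in>?B. x e * (\<Prod>e\<in>T. x e))"
    unfolding sum.reindex[OF inj] comp_def by (rule sum.cong) (use nB in auto)
  also have "\<dots> = x e * forest_poly N (insert (a, b) R) E x"
    by (simp add: forest_poly_def sum_distrib_left)
  finally have 1: "(\<Sum>S\<in>insert e ` ?B. \<Prod>e\<in>S. x e) = x e * forest_poly N (insert (a, b) R) E x" .
  have "forest_poly N R (insert e E) x =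
      (\<Sum>S\<in>(if (a, b) \<in> conn N R E then bases N R E else {}). \<Prod>e\<in>S. x e) + (\<Sum>S\<in>insert e ` ?B. \<Prod>e\<in>S. x e)"
    unfolding forest_poly_def bases_insert[OF assms]
    by (rule sum.union_disjoint) (use finite_bases[OF E(1)] e(1) in \<open>auto simp: bases_def split: if_splits\<close>)
  then show ?thesis unfolding 1 by (simp add: forest_poly_def)
qed

text \<open>Bases are defined through the connectivity of ends of edges alone, so it suffices to
  compare those pairs; \<open>f\<close> may merge vertices, as it does in an identification.\<close>

lemma forest_poly_map:
  assumes g: "bij_betw g E E'" and N': "\<And>e. e \<in> E \<Longrightarrow> N' (g e) = f ` N e"
    and C: "\<And>S e u v. S \<subseteq> E \<Longrightarrow> e \<in> E \<Longrightarrow> u \<in> N e \<Longrightarrow> v \<in> N e \<Longrightarrow>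
       (f u, f v) \<in> conn N' R' (g ` S) \<longleftrightarrow> (u, v) \<in> conn N R S"
  shows "forest_poly N' R' E' x = forest_poly N R E (x \<circ> g)"
proof -
  have inj: "inj_on g E" and E': "E' = g ` E" using g by (auto simp: bij_betw_def)
  have sp: "N' (g e) \<times> N' (g e) \<subseteq> conn N' R' (g ` S) \<longleftrightarrow> N e \<times> N e \<subseteq> conn N R S"
    if "S \<subseteq> E" "e \<in> E" for S e
    unfolding N'[OF that(2)] using C[OF that] by blast
  have diff: "g ` S - {g e} = g ` (S - {e})" if "S \<subseteq> E" "e \<in> E" for S e
    using inj that by (auto simp: inj_on_def)
  have ind: "indep N' R' (g ` S) \<longleftrightarrow> indep N R S" if S: "S \<subseteq> E" for S
  proof -
    have "N' (g e) \<times> N' (g e) \<subseteq> conn N' R' (g ` S - {g e}) \<longleftrightarrow> N e \<times> N e \<subseteq> conn N R (S - {e})"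
      if "e \<in> S" for e
    proof -
      have e: "e \<in> E" "S - {e} \<subseteq> E" using that S by auto
      show ?thesis unfolding diff[OF S e(1)] by (rule sp[OF e(2,1)])
    qed
    then show ?thesis unfolding indep_def by simp
  qed
  have iff: "g ` S \<in> bases N' R' E' \<longleftrightarrow> S \<in> bases N R E" if "S \<subseteq> E" for S
    using ind[OF that] sp[OF that] that by (auto simp: bases_def E')
  have "bases N' R' E' = (`) g ` bases N R E"
  proof (intro set_eqI iffI)
    fix S' assume S': "S' \<in> bases N' R' E'"
    then obtain S where S: "S \<subseteq> E" "S' = g ` S" by (auto simp: bases_def E' subset_image_iff)
    then show "S' \<in> (`) g ` bases N R E" using iff S' by auto
  next
    fix S' assume "S' \<in> (`) g ` bases N R E"
    then obtain S where S: "S \<in> bases N R E" "S' = g ` S" by auto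
    then show "S' \<in> bases N' R' E'" using iff[of S] by (auto simp: bases_def)
  qed
  moreover have "inj_on ((`) g) (bases N R E)"
    using inj_on_image_Pow[OF inj] by (rule inj_on_subset) (auto simp: bases_def)
  ultimately have "forest_poly N' R' E' x = (\<Sum>S\<in>bases N R E. \<Prod>e\<in>g ` S. x e)"
    by (simp add: forest_poly_def sum.reindex)
  also have "\<dots> = forest_poly N R E (x \<circ> g)"
    unfolding forest_poly_def
    by (intro sum.cong refl) (use inj_on_subset[OF inj] in \<open>auto simp: bases_def prod.reindex comp_def\<close>)
  finally show ?thesis .
qed

lemma forest_poly_cong:
  assumes "\<And>e. e \<in> E \<Longrightarrow> N' e = N e"
    and "\<And>S e u v. S \<subseteq> E \<Longrightarrow> e \<in> E \<Longrightarrow> u \<in> N e \<Longrightarrow> v \<in> N e \<Longrightarrow>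
       (u, v) \<in> conn N' R' S \<longleftrightarrow> (u, v) \<in> conn N R S"
  shows "forest_poly N' R' E x = forest_poly N R E x"
  using forest_poly_map[of id E E N' id N R' R x] assms by simp

lemma conn_cong_ends: "(\<And>e. e \<in> S \<Longrightarrow> N' e = N e) \<Longrightarrow> conn N' R S = conn N R S"
  by (simp add: conn_def)

lemma forest_poly_cong_ends: "(\<And>e. e \<in> E \<Longrightarrow> N' e = N e) \<Longrightarrow> forest_poly N' R E x = forest_poly N R E x"
proof (rule forest_poly_cong)
  fix S u v assume "\<And>e. e \<in> E \<Longrightarrow> N' e = N e" "S \<subseteq> E"
  then have "conn N' R S = conn N R S" by (intro conn_cong_ends) auto
  then show "(u, v) \<in> conn N' R S \<longleftrightarrow> (u, v) \<in> conn N R S" by simp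
qed simp

lemma conn_cong_rel:
  assumes "R \<subseteq> conn N R' {}" "R' \<subseteq> conn N R {}"
  shows "conn N R S = conn N R' S"
proof -
  have "conn N R {} \<subseteq> conn N R S" "conn N R' {} \<subseteq> conn N R' S" by (rule conn_mono; simp)+
  then show ?thesis using assms by (intro antisym conn_least) (auto intro: conn_edge)
qed

lemma forest_poly_cong_rel:
  "R \<subseteq> conn N R' {} \<Longrightarrow> R' \<subseteq> conn N R {} \<Longrightarrow> forest_poly N R E x = forest_poly N R' E x"
  using conn_cong_rel[of R N R'] by (intro forest_poly_cong) auto

lemma forest_poly_insert_absorb:
  "(a, b) \<in> conn N R {} \<Longrightarrow> forest_poly N (insert (a, b) R) E x = forest_poly N R E x"
  by (rule forest_poly_cong_rel) (auto intro: conn_rel)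

text \<open>If merging \<open>a\<close> and \<open>b\<close> connected the ends u, v of an edge
  anew, then by exchange joining u to v would connect \<open>a\<close> to \<open>b\<close>; but u
  and v are joined by an edge of \<open>E\<close>. Hence deleting and contracting a bridge have the
  same polynomial.\<close>

lemma forest_poly_bridge:
  assumes E: "two_ends N E" and ab: "(a, b) \<notin> conn N R E"
  shows "forest_poly N (insert (a, b) R) E x = forest_poly N R E x"
proof (rule forest_poly_cong)
  fix S e u v assume S: "S \<subseteq> E" and e: "e \<in> E" "u \<in> N e" "v \<in> N e"
  have "(u, v) \<in> conn N R S" if uv: "(u, v) \<in> conn N (insert (a, b) R) S"
  proof (rule ccontr)
    assume n: "(u, v) \<notin> conn N R S"
    have "conn N (insert (u, v) R) S \<subseteq> conn N R E"
      by (rule conn_least) (use e S in \<open>auto intro: conn_rel conn_edge\<close>)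
    with conn_exchange[OF uv n] ab show False by blast
  qed
  then show "(u, v) \<in> conn N (insert (a, b) R) S \<longleftrightarrow> (u, v) \<in> conn N R S"
    using conn_insert_subset[of N R S] by blast
qed simp

lemma forest_poly_depends:
  assumes "\<And>e. e \<in> E \<Longrightarrow> x e = y e" shows "forest_poly N R E x = forest_poly N R E y"
  unfolding forest_poly_def by (intro sum.cong prod.cong refl) (use assms in \<open>auto simp: bases_def\<close>)

lemma forest_poly_pos:
  assumes "finite E" "two_ends N E" "\<And>e. e \<in> E \<Longrightarrow> 0 < x e"
  shows "0 < forest_poly N R E x"
  using assms
proof (induction E arbitrary: R rule: finite_induct)
  case (insert e E)
  obtain a b where ab: "N e = {a, b}" using insert.prems(1) by (auto elim: two_endsE)
  have t: "two_ends N E" using insert.prems(1) by (rule two_ends_subset) auto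
  have "0 < forest_poly N R E x" for R using insert t by auto
  then show ?case
    using insert.hyps insert.prems t ab
    by (cases "(a, b) \<in> conn N R {}")
      (auto simp: forest_poly_loop forest_poly_insert intro!: add_nonneg_pos add_pos_pos mult_pos_pos less_imp_le)
qed simp

lemma smooth_fun_forest_poly: "smooth_fun E (forest_poly N R E)"
  unfolding forest_poly_def[abs_def]
  by (intro smooth_fun_sum smooth_fun_prod smooth_fun.coord) (auto simp: bases_def)

section \<open>Gluing two pieces at one vertex and at two vertices\<close>

lemma conn_glue_local:
  assumes V: "V1 \<inter> V2 = {}" and R: "R1 \<subseteq> V1 \<times> V1" "R2 \<subseteq> V2 \<times> V2"
    and S: "\<And>e. e \<in> S1 \<Longrightarrow> N e \<subseteq> V1" "\<And>e. e \<in> S2 \<Longrightarrow> N e \<subseteq> V2"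
    and Q: "Q \<subseteq> {(x1, x2), (x2, x1)}" "x1 \<in> V1" "x2 \<in> V2" and uv: "u \<in> V1" "v \<in> V1"
  shows "(u, v) \<in> conn N (Q \<union> R1 \<union> R2) (S1 \<union> S2) \<longleftrightarrow> (u, v) \<in> conn N R1 S1"
proof
  \<comment> \<open>Retraction onto the first piece: all of the second piece collapses to the gluing
    vertex.\<close>
  define f where "f w = (if w \<in> V1 then w else x1)" for w
  assume "(u, v) \<in> conn N (Q \<union> R1 \<union> R2) (S1 \<union> S2)"
  then have "(f u, f v) \<in> conn N R1 S1"
  proof (rule conn_map[rotated 2])
    fix u v assume "(u, v) \<in> Q \<union> R1 \<union> R2"
    then show "(f u, f v) \<in> conn N R1 S1" using V R Q by (auto simp: f_def intro: conn_rel)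
  next
    fix e u v assume e: "e \<in> S1 \<union> S2" "u \<in> N e" "v \<in> N e"
    show "(f u, f v) \<in> conn N R1 S1"
    proof (cases "e \<in> S1")
      case True
      then show ?thesis using S(1)[OF True] conn_edge[of e S1 u N v R1] True e by (auto simp: f_def)
    next
      case False
      then have "N e \<subseteq> V2" using e S(2) by auto
      then show ?thesis using V e by (auto simp: f_def)
    qed
  qed
  then show "(u, v) \<in> conn N R1 S1" using uv by (simp add: f_def)
next
  show "(u, v) \<in> conn N R1 S1 \<Longrightarrow> (u, v) \<in> conn N (Q \<union> R1 \<union> R2) (S1 \<union> S2)"
    using conn_mono[of R1 "Q \<union> R1 \<union> R2" S1 "S1 \<union> S2" N] by auto
qed

text \<open>Seen from the first piece, the second one matters only through whether it joins its two
  terminals; if so, it acts like the extra pair (x1, y1).\<close>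

lemma conn_parallel_local:
  assumes V: "V1 \<inter> V2 = {}" and R: "R1 \<subseteq> V1 \<times> V1" "R2 \<subseteq> V2 \<times> V2"
    and S: "\<And>e. e \<in> S1 \<Longrightarrow> N e \<subseteq> V1" "\<And>e. e \<in> S2 \<Longrightarrow> N e \<subseteq> V2"
    and xy: "x1 \<in> V1" "x2 \<in> V2" "y1 \<in> V1" "y2 \<in> V2" and uv: "u \<in> V1" "v \<in> V1"
  shows "(u, v) \<in> conn N ({(x1, x2), (y1, y2)} \<union> R1 \<union> R2) (S1 \<union> S2) \<longleftrightarrow>
    (u, v) \<in> conn N (if (x2, y2) \<in> conn N R2 S2 then insert (x1, y1) R1 else R1) S1"
    (is "_ \<in> ?C \<longleftrightarrow> _ \<in> conn N ?R S1")
proof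
  \<comment> \<open>The component of \<open>x2\<close> goes to \<open>x1\<close>, everything else in
    the second piece to \<open>y1\<close>. If \<open>y2\<close> lies in that component it lands on
    \<open>x1\<close>, and the pair (x1, y1) in \<open>?R\<close> repairs this.\<close>
  define f where "f w = (if w \<in> V1 then w else if (w, x2) \<in> conn N R2 S2 then x1 else y1)" for w
  have f1: "w \<in> V1 \<Longrightarrow> f w = w" for w by (simp add: f_def)
  have f2: "w \<in> V2 \<Longrightarrow> f w = (if (w, x2) \<in> conn N R2 S2 then x1 else y1)" for w
    using V by (auto simp: f_def)
  have same: "f w = f w'" if "w \<in> V2" "w' \<in> V2" "(w, w') \<in> conn N R2 S2" for w w'
    using f2[OF that(1)] f2[OF that(2)] that(3) conn_trans[of _ _ N R2 S2] conn_sym[OF that(3)] by metis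
  assume "(u, v) \<in> ?C"
  then have "(f u, f v) \<in> conn N ?R S1"
  proof (rule conn_map[rotated 2])
    fix u v assume "(u, v) \<in> {(x1, x2), (y1, y2)} \<union> R1 \<union> R2"
    then consider "u = x1" "v = x2" | "u = y1" "v = y2" | "(u, v) \<in> R1" | "(u, v) \<in> R2" by blast
    then show "(f u, f v) \<in> conn N ?R S1"
    proof cases
      case 1 then show ?thesis using xy by (simp add: f1 f2)
    next
      case 2
      have "(y1, x1) \<in> conn N (insert (x1, y1) R1) S1" by (rule conn_sym) (simp add: conn_rel)
      then show ?thesis using 2 xy by (auto simp: f1 f2 dest: conn_sym)
    next
      case 3 then show ?thesis using R(1) by (auto simp: f1 intro!: conn_rel)
    next
      case 4
      then have "f u = f v" using R(2) by (intro same conn_rel) auto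
      then show ?thesis by simp
    qed
  next
    fix e u v assume e: "e \<in> S1 \<union> S2" "u \<in> N e" "v \<in> N e"
    show "(f u, f v) \<in> conn N ?R S1"
    proof (cases "e \<in> S1")
      case True
      then have "f u = u" "f v = v" using S(1) e by (auto intro!: f1)
      then show ?thesis using conn_edge[of e S1 u N v] True e(2,3) by simp
    next
      case False
      then have "e \<in> S2" using e by simp
      then have "f u = f v" using e S(2) by (intro same conn_edge[of e]) auto
      then show ?thesis by simp
    qed
  qed
  then show "(u, v) \<in> conn N ?R S1" using uv by (simp add: f1)
next
  assume uv': "(u, v) \<in> conn N ?R S1"
  have m: "conn N R2 S2 \<subseteq> ?C" "conn N R1 S1 \<subseteq> ?C" by (rule conn_mono; auto)+
  have *: "(x1, x2) \<in> ?C" "(y1, y2) \<in> ?C" by (auto intro: conn_rel)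
  have "(x1, y1) \<in> ?C" if "(x2, y2) \<in> conn N R2 S2"
    using conn_trans[OF *(1) conn_trans[OF subsetD[OF m(1) that] conn_sym[OF *(2)]]] .
  then have "conn N ?R S1 \<subseteq> ?C"
    by (intro conn_least) (auto intro: conn_rel conn_edge split: if_splits)
  with uv' show "(u, v) \<in> ?C" by blast
qed

lemma forest_poly_glue_base:
  assumes "V1 \<inter> V2 = {}" "R1 \<subseteq> V1 \<times> V1" "R2 \<subseteq> V2 \<times> V2" "\<And>e. e \<in> E2 \<Longrightarrow> N e \<subseteq> V2"
    and "Q \<subseteq> {(x1, x2)}" "x1 \<in> V1" "x2 \<in> V2"
  shows "forest_poly N (Q \<union> R1 \<union> R2) E2 x = forest_poly N R2 E2 x"
proof (rule forest_poly_cong)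
  fix S e u v assume S: "S \<subseteq> E2" "e \<in> E2" "u \<in> N e" "v \<in> N e"
  have "(u, v) \<in> conn N (Q \<union> R2 \<union> R1) (S \<union> {}) \<longleftrightarrow> (u, v) \<in> conn N R2 S"
    by (rule conn_glue_local[where ?V1.0 = V2 and ?V2.0 = V1 and ?x1.0 = x2 and ?x2.0 = x1])
      (use assms S in blast)+
  then show "(u, v) \<in> conn N (Q \<union> R1 \<union> R2) S \<longleftrightarrow> (u, v) \<in> conn N R2 S" by (simp add: Un_ac)
qed simp

text \<open>Deletion-contraction on the edges of \<open>E1\<close>, with \<open>R1\<close> arbitrary
  to record contractions. By \<open>conn_glue_local\<close> an edge is a loop or a bridge of the
  glued graph exactly if it is one of its own piece, so both sides obey the same recursion.\<close>

lemma forest_poly_glue: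
  assumes E: "finite E1" "finite E2" "two_ends N E1" "two_ends N E2" "E1 \<inter> E2 = {}"
    and V: "V1 \<inter> V2 = {}" and R: "R1 \<subseteq> V1 \<times> V1" "R2 \<subseteq> V2 \<times> V2"
    and N: "\<And>e. e \<in> E1 \<Longrightarrow> N e \<subseteq> V1" "\<And>e. e \<in> E2 \<Longrightarrow> N e \<subseteq> V2"
    and Q: "Q \<subseteq> {(x1, x2)}" "x1 \<in> V1" "x2 \<in> V2"
  shows "forest_poly N (Q \<union> R1 \<union> R2) (E1 \<union> E2) x = forest_poly N R1 E1 x * forest_poly N R2 E2 x"
  using E(1,3,5) R(1) N(1)
proof (induction E1 arbitrary: R1 rule: finite_induct)
  case empty
  then show ?case using forest_poly_glue_base[OF V empty.prems(3) R(2) N(2) Q] by simp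
next
  case (insert g E1)
  obtain a b where ab: "N g = {a, b}" using insert.prems by (auto elim: two_endsE)
  have abV: "a \<in> V1" "b \<in> V1" using insert.prems(4)[of g] ab by auto
  have t: "two_ends N E1" using insert.prems(1) by (rule two_ends_subset) auto
  have t': "two_ends N (E1 \<union> E2)" using t E(4) by (auto simp: two_ends_def)
  have g: "g \<notin> E1 \<union> E2" and disj: "E1 \<inter> E2 = {}" using insert by auto
  have IH: "forest_poly N (Q \<union> R \<union> R2) (E1 \<union> E2) x = forest_poly N R E1 x * forest_poly N R2 E2 x"
    if "R \<subseteq> V1 \<times> V1" for R
    using insert.IH[OF t disj that] insert.prems(4) by blast
  have loc: "(a, b) \<in> conn N (Q \<union> R1 \<union> R2) (S1 \<union> S2) \<longleftrightarrow> (a, b) \<in> conn N R1 S1"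
    if "S1 \<subseteq> E1" "S2 \<subseteq> E2" for S1 S2
    by (rule conn_glue_local[OF V insert.prems(3) R(2) _ _ _ Q(2,3) abV])
      (use that insert.prems(4) N(2) Q(1) in blast)+
  show ?case
  proof (cases "(a, b) \<in> conn N R1 {}")
    case True
    then have "(a, b) \<in> conn N (Q \<union> R1 \<union> R2) {}" using loc[of "{}" "{}"] by simp
    then show ?thesis
      using forest_poly_loop[where N = N and e = g, OF g ab] forest_poly_loop[where N = N and e = g, OF insert.hyps(2) ab True] IH[OF insert.prems(3)] by simp
  next
    case False
    then have n: "(a, b) \<notin> conn N (Q \<union> R1 \<union> R2) {}" using loc[of "{}" "{}"] by simp
    have fin: "finite (E1 \<union> E2)" using insert.hyps(1) E(2) by simp
    have i: "insert (a, b) (Q \<union> R1 \<union> R2) = Q \<union> insert (a, b) R1 \<union> R2" by auto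
    have R1': "insert (a, b) R1 \<subseteq> V1 \<times> V1" using abV insert.prems(3) by auto
    have l: "(a, b) \<in> conn N (Q \<union> R1 \<union> R2) (E1 \<union> E2) \<longleftrightarrow> (a, b) \<in> conn N R1 E1"
      by (rule loc) auto
    show ?thesis
      unfolding Un_insert_left forest_poly_insert[where N = N and e = g, OF g ab fin t' n]
        forest_poly_insert[where N = N and e = g, OF insert.hyps(2) ab insert.hyps(1) t False]
        i IH[OF insert.prems(3)] IH[OF R1'] l
      by (simp add: distrib_right)
  qed
qed

text \<open>In a forest of the glued graph the terminals are joined inside exactly one piece, and
  the other piece contributes a forest of its contraction. The conditionals remove the first term if
  piece 1 cannot join them and the second if they already coincide there.\<close>

lemma forest_poly_two_terminal:
  assumes E: "finite E1" "finite E2" "two_ends N E1" "two_ends N E2" "E1 \<inter> E2 = {}"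
    and V: "V1 \<inter> V2 = {}" and R: "R1 \<subseteq> V1 \<times> V1" "R2 \<subseteq> V2 \<times> V2"
    and N: "\<And>e. e \<in> E1 \<Longrightarrow> N e \<subseteq> V1" "\<And>e. e \<in> E2 \<Longrightarrow> N e \<subseteq> V2"
    and xy: "x1 \<in> V1" "x2 \<in> V2" "y1 \<in> V1" "y2 \<in> V2"
    and mid: "(x2, y2) \<notin> conn N R2 {}" "(x2, y2) \<in> conn N R2 E2"
  shows "forest_poly N ({(x1, x2), (y1, y2)} \<union> R1 \<union> R2) (E1 \<union> E2) x =
    (if (x1, y1) \<in> conn N R1 E1 then forest_poly N R1 E1 x else 0) * forest_poly N (insert (x2, y2) R2) E2 x +
    (if (x1, y1) \<in> conn N R1 {} then 0 else forest_poly N (insert (x1, y1) R1) E1 x) * forest_poly N R2 E2 x"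
  using E(1,3,5) R(1) N(1)
proof (induction E1 arbitrary: R1 rule: finite_induct)
  case empty
  let ?Q = "{(x1, x2), (y1, y2)}"
  have "(u, v) \<in> conn N (?Q \<union> R1 \<union> R2) S \<longleftrightarrow>
      (u, v) \<in> conn N (if (x1, y1) \<in> conn N R1 {} then insert (x2, y2) R2 else R2) S"
    if S: "S \<subseteq> E2" "e \<in> E2" "u \<in> N e" "v \<in> N e" for S e u v
  proof -
    have "conn N (?Q \<union> R1 \<union> R2) S = conn N ({(x2, x1), (y2, y1)} \<union> R2 \<union> R1) (S \<union> {})"
      unfolding Un_empty_right by (rule conn_cong_rel) (auto intro: conn_rel conn_sym[OF conn_rel])
    also have "(u, v) \<in> \<dots> \<longleftrightarrow> (u, v) \<in> conn N (if (x1, y1) \<in> conn N R1 {} then insert (x2, y2) R2 else R2) S"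
      by (rule conn_parallel_local[where ?V1.0 = V2 and ?V2.0 = V1]) (use V R empty.prems S N(2) xy in blast)+
    finally show ?thesis .
  qed
  then have "forest_poly N (?Q \<union> R1 \<union> R2) E2 x =
      forest_poly N (if (x1, y1) \<in> conn N R1 {} then insert (x2, y2) R2 else R2) E2 x"
    by (intro forest_poly_cong) auto
  then show ?case by simp
next
  case (insert g E1)
  let ?Q = "{(x1, x2), (y1, y2)}"
  obtain a b where ab: "N g = {a, b}" using insert.prems by (auto elim: two_endsE)
  have abV: "a \<in> V1" "b \<in> V1" using insert.prems(4)[of g] ab by auto
  have t: "two_ends N E1" using insert.prems(1) by (rule two_ends_subset) auto
  have t': "two_ends N (E1 \<union> E2)" using t E(4) by (auto simp: two_ends_def)
  have g: "g \<notin> E1 \<union> E2" and disj: "E1 \<inter> E2 = {}" using insert by auto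
  \<comment> \<open>\<open>A\<close> stands for forests of piece 1 that join the terminals,
    \<open>B\<close> for those that keep them apart. The claim follows once both obey the recursion
    of the glued graph.\<close>
  define A where "A R S = (if (x1, y1) \<in> conn N R S then forest_poly N R S x else 0)" for R S
  define B where "B R S = (if (x1, y1) \<in> conn N R {} then 0 else forest_poly N (insert (x1, y1) R) S x)" for R S
  have IH: "forest_poly N (?Q \<union> R \<union> R2) (E1 \<union> E2) x =
      A R E1 * forest_poly N (insert (x2, y2) R2) E2 x + B R E1 * forest_poly N R2 E2 x"
    if "R \<subseteq> V1 \<times> V1" for R
    using insert.IH[OF t disj that] insert.prems(4) unfolding A_def B_def by blast
  have loc: "(a, b) \<in> conn N (?Q \<union> R1 \<union> R2) (S1 \<union> S2) \<longleftrightarrow>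
      (a, b) \<in> conn N (if (x2, y2) \<in> conn N R2 S2 then insert (x1, y1) R1 else R1) S1"
    if "S1 \<subseteq> E1" "S2 \<subseteq> E2" for S1 S2
    by (rule conn_parallel_local[OF V insert.prems(3) R(2) _ _ xy abV])
      (use that insert.prems(4) N(2) in blast)+
  have loc0: "(a, b) \<in> conn N (?Q \<union> R1 \<union> R2) {} \<longleftrightarrow> (a, b) \<in> conn N R1 {}"
    using loc[of "{}" "{}"] mid(1) by simp
  show ?case
  proof (cases "(a, b) \<in> conn N R1 {}")
    case True
    then have 1: "(a, b) \<in> conn N (?Q \<union> R1 \<union> R2) {}" unfolding loc0 .
    have 2: "(a, b) \<in> conn N (insert (x1, y1) R1) {}" using True conn_insert_subset by fast
    have "(a, b) \<in> conn N R1 E1" using True conn_mono[of R1 R1 "{}" E1 N] by auto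
    then have 3: "conn N R1 (insert g E1) = conn N R1 E1"
      using conn_insert_edge[of N g a b R1 E1, OF ab] conn_insert_absorb by metis
    show ?thesis
      using forest_poly_loop[where N = N and e = g, OF g ab 1] forest_poly_loop[where N = N and e = g, OF insert.hyps(2) ab True]
        forest_poly_loop[where N = N and e = g, OF insert.hyps(2) ab 2] IH[OF insert.prems(3)] 3 unfolding A_def B_def by simp
  next
    case False
    then have n: "(a, b) \<notin> conn N (?Q \<union> R1 \<union> R2) {}" unfolding loc0 .
    have fin: "finite (E1 \<union> E2)" using insert.hyps(1) E(2) by simp
    have i: "insert (a, b) (?Q \<union> R1 \<union> R2) = ?Q \<union> insert (a, b) R1 \<union> R2" by auto
    have R1': "insert (a, b) R1 \<subseteq> V1 \<times> V1" using abV insert.prems(3) by auto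
    \<comment> \<open>\<open>k\<close> is 0 exactly if \<open>g\<close> is a bridge of the glued
      graph; since piece 2 joins the terminals, this is tested in piece 1 with the terminals
      merged.\<close>
    define k where "k = (if (a, b) \<in> conn N (insert (x1, y1) R1) E1 then 1 else 0 :: real)"
    have "(a, b) \<in> conn N (?Q \<union> R1 \<union> R2) (E1 \<union> E2) \<longleftrightarrow> (a, b) \<in> conn N (insert (x1, y1) R1) E1"
      using loc[of E1 E2] mid(2) by simp
    then have f: "forest_poly N (?Q \<union> R1 \<union> R2) (insert g (E1 \<union> E2)) x =
        k * (A R1 E1 * forest_poly N (insert (x2, y2) R2) E2 x + B R1 E1 * forest_poly N R2 E2 x) +
        x g * (A (insert (a, b) R1) E1 * forest_poly N (insert (x2, y2) R2) E2 x +
          B (insert (a, b) R1) E1 * forest_poly N R2 E2 x)"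
      
      unfolding forest_poly_insert[where N = N and e = g, OF g ab fin t' n] i IH[OF insert.prems(3)] IH[OF R1']
      by (simp add: k_def)
    have c: "conn N R1 (insert g E1) = conn N (insert (a, b) R1) E1" by (rule conn_insert_edge) (rule ab)
    have eA: "A R1 (insert g E1) = k * A R1 E1 + x g * A (insert (a, b) R1) E1"
    proof (cases "(a, b) \<in> conn N R1 E1")
      case True
      then have "(a, b) \<in> conn N (insert (x1, y1) R1) E1" using conn_insert_subset by fast
      then show ?thesis
        using forest_poly_insert[where N = N and e = g, OF insert.hyps(2) ab insert.hyps(1) t False, where x = x] True conn_insert_absorb[OF True]
        by (simp add: A_def k_def c)
    next
      case nab: False
      \<comment> \<open>If \<open>E1\<close> already joined the terminals, merging them would change
        nothing and \<open>g\<close> would stay a bridge: either \<open>k\<close> or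
        \<open>A R1 E1\<close> vanishes.\<close>
      have "k * A R1 E1 = 0"
        using nab conn_insert_absorb[of x1 y1 N R1 E1] by (auto simp: k_def A_def)
      then show ?thesis
        using forest_poly_insert[where N = N and e = g, OF insert.hyps(2) ab insert.hyps(1) t False, where x = x] nab by (simp add: A_def c)
    qed
    have eB: "B R1 (insert g E1) = k * B R1 E1 + x g * B (insert (a, b) R1) E1"
    proof (cases "(x1, y1) \<in> conn N R1 {}")
      case True
      then have "(x1, y1) \<in> conn N (insert (a, b) R1) {}" using conn_insert_subset by fast
      with True show ?thesis by (simp add: B_def)
    next
      case nxy: False
      show ?thesis
      proof (cases "(a, b) \<in> conn N (insert (x1, y1) R1) {}")
        case True
        \<comment> \<open>Merging the terminals makes \<open>g\<close> a loop, so by exchange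
          contracting \<open>g\<close> merges the terminals, and the contracted \<open>B\<close>
          term vanishes.\<close>
        have "(x1, y1) \<in> conn N (insert (a, b) R1) {}" by (rule conn_exchange[OF True False])
        moreover have "(a, b) \<in> conn N (insert (x1, y1) R1) E1"
          using True conn_mono[of "insert (x1, y1) R1" "insert (x1, y1) R1" "{}" E1 N] by auto
        ultimately show ?thesis
          using nxy forest_poly_loop[where N = N and e = g, OF insert.hyps(2) ab True] by (simp add: B_def k_def)
      next
        case nab: False
        have "(x1, y1) \<notin> conn N (insert (a, b) R1) {}" using conn_exchange[of x1 y1 N a b R1 "{}"] nxy nab by blast
        then show ?thesis
          using nxy forest_poly_insert[where N = N and e = g, OF insert.hyps(2) ab insert.hyps(1) t nab, where x = x]
          by (simp add: B_def k_def insert_commute)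
      qed
    qed
    have "forest_poly N (?Q \<union> R1 \<union> R2) (insert g E1 \<union> E2) x =
        A R1 (insert g E1) * forest_poly N (insert (x2, y2) R2) E2 x + B R1 (insert g E1) * forest_poly N R2 E2 x"
      unfolding eA eB Un_insert_left[of g E1 E2] f by (simp add: algebra_simps)
    then show ?thesis unfolding A_def B_def .
  qed
qed

section \<open>Maximal spanning forests\<close>

lemma forest_poly_disjoint:
  assumes E: "finite E1" "finite E2" "two_ends N E1" "two_ends N E2" "E1 \<inter> E2 = {}"
    and V: "V1 \<inter> V2 = {}" and N: "\<And>e. e \<in> E1 \<Longrightarrow> N e \<subseteq> V1" "\<And>e. e \<in> E2 \<Longrightarrow> N e \<subseteq> V2"
  shows "forest_poly N {} (E1 \<union> E2) x = forest_poly N {} E1 x * forest_poly N {} E2 x"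
proof (cases "V1 = {} \<or> V2 = {}")
  case True
  \<comment> \<open>\<open>forest_poly_glue\<close> names a vertex of each piece; a piece without
    vertices has no edges either, because every edge has an end.\<close>
  have "E1 = {}" if "V1 = {}"
    using E(3) N(1) that by (force simp: two_ends_def)
  moreover have "E2 = {}" if "V2 = {}"
    using E(4) N(2) that by (force simp: two_ends_def)
  ultimately show ?thesis using True by auto
next
  case False
  then obtain x1 x2 where "x1 \<in> V1" "x2 \<in> V2" by blast
  from forest_poly_glue[OF E V _ _ N _ this, of "{}" "{}" "{}" x] show ?thesis by simp
qed

lemma two_ends_multigraph: "multigraph G \<Longrightarrow> two_ends (ends G) (edges G)"
proof -
  assume G: "multigraph G"
  have "\<exists>a b. ends G e = {a, b}" if e: "e \<in> edges G" for e
  proof -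
    have "card (ends G e) = 1 \<or> card (ends G e) = 2" using G e by (auto simp: multigraph_def)
    then show ?thesis
    proof
      assume "card (ends G e) = 1"
      then obtain a where "ends G e = {a}" by (rule card_1_singletonE)
      then have "ends G e = {a, a}" by simp
      then show ?thesis by blast
    next
      assume "card (ends G e) = 2"
      then show ?thesis by (auto simp: card_2_iff)
    qed
  qed
  then show ?thesis by (simp add: two_ends_def)
qed

lemma adjacency_rtrancl:
  assumes "two_ends (ends H) (edges H)"
  shows "(adjacency H)\<^sup>* = conn (ends H) {} (edges H)"
proof (rule antisym)
  show "(adjacency H)\<^sup>* \<subseteq> conn (ends H) {} (edges H)"
    unfolding conn_def by (rule rtrancl_mono) (auto simp: adjacency_def)
  have "(u, v) \<in> (adjacency H)\<^sup>*" if e: "e \<in> edges H" "u \<in> ends H e" "v \<in> ends H e" for e u v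
  proof (cases "u = v")
    case False
    obtain a b where "ends H e = {a, b}" using assms e by (auto elim: two_endsE)
    then have "ends H e = {u, v}" using False e by auto
    then have "(u, v) \<in> adjacency H" using e by (auto simp: adjacency_def)
    then show ?thesis by blast
  qed simp
  then show "conn (ends H) {} (edges H) \<subseteq> (adjacency H)\<^sup>*"
    unfolding conn_def by (intro rtrancl_subset_rtrancl) auto
qed

text \<open>Indexed like \<open>graph_cycle\<close>, so that appending an edge between
  \<open>b\<close> and \<open>a\<close> to \<open>es\<close> closes the path into a cycle on the
  same \<open>vs\<close>.\<close>

definition simple_path :: "('e \<Rightarrow> 'v set) \<Rightarrow> 'e set \<Rightarrow> 'v \<Rightarrow> 'v \<Rightarrow> 'v list \<Rightarrow> 'e list \<Rightarrow> bool" where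
  "simple_path N S a b vs es \<longleftrightarrow> length vs = Suc (length es) \<and> distinct vs \<and> set es \<subseteq> S \<and>
     vs ! 0 = a \<and> vs ! length es = b \<and> (\<forall>i<length es. N (es ! i) = {vs ! i, vs ! Suc i})"

lemma conn_imp_simple_path:
  assumes N: "two_ends N S" and ab: "(a, b) \<in> conn N {} S"
  shows "\<exists>vs es. simple_path N S a b vs es"
  using ab unfolding conn_def
proof (induction rule: rtrancl_induct)
  case base
  have "simple_path N S a a [a] []" by (simp add: simple_path_def)
  then show ?case by blast
next
  case (step v w)
  obtain vs es where p: "simple_path N S a v vs es" using step.IH by blast
  obtain f where f: "f \<in> S" "v \<in> N f" "w \<in> N f" using step.hyps(2) by auto
  show ?case
  proof (cases "w \<in> set vs")
    \<comment> \<open>The walk returns to a vertex already visited: cut the path off there.\<close>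
    case True
    then obtain k where k: "k < length vs" "vs ! k = w" by (auto simp: in_set_conv_nth)
    then have "k \<le> length es" using p by (simp add: simple_path_def)
    with k have "simple_path N S a w (take (Suc k) vs) (take k es)"
      using p set_take_subset[of k es] by (auto simp: simple_path_def min_def)
    then show ?thesis by blast
  next
    case False
    have "v \<in> set vs" using p by (auto simp: simple_path_def in_set_conv_nth)
    then have "v \<noteq> w" using False by auto
    then have "N f = {v, w}" using f N by (auto elim: two_endsE)
    then have "simple_path N S a w (vs @ [w]) (es @ [f])"
      using p False f(1) by (auto simp: simple_path_def nth_append less_Suc_eq)
    then show ?thesis by blast
  qed
qed

lemma cycle_imp_not_indep:
  assumes c: "graph_cycle H vs es"
  shows "\<not> indep (ends H) {} (edges H)"
proof -
  define k where "k = length es"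
  have k: "0 < k" and d: "distinct es" and es: "set es \<subseteq> edges H"
    and e: "\<And>i. i < k \<Longrightarrow> ends H (es ! i) = {vs ! i, vs ! (Suc i mod k)}"
    using c by (auto simp: graph_cycle_def k_def)
  define C where "C = conn (ends H) {} (edges H - {es ! 0})"
  \<comment> \<open>Walk around the cycle from position 1 back to position 0 without its first edge.
    For a loop \<open>1 mod k\<close> is 0 and the walk is trivial.\<close>
  have "(vs ! (1 mod k), vs ! (Suc j mod k)) \<in> C" if "j < k" for j
    using that
  proof (induction j)
    case 0
    then show ?case by (simp add: C_def)
  next
    case (Suc j)
    have "es ! Suc j \<noteq> es ! 0" using d Suc.prems k by (simp add: nth_eq_iff_index_eq k_def)
    moreover have "es ! Suc j \<in> edges H" using es Suc.prems by (auto simp: k_def)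
    ultimately have "(vs ! Suc j, vs ! (Suc (Suc j) mod k)) \<in> C"
      unfolding C_def using e[OF Suc.prems] by (intro conn_edge[of "es ! Suc j"]) auto
    moreover have "Suc j mod k = Suc j" using Suc.prems by simp
    ultimately show ?case using Suc unfolding C_def by (metis Suc_lessD conn_trans)
  qed
  from this[of "k - 1"] have "(vs ! (1 mod k), vs ! 0) \<in> C" using k by simp
  then have "(vs ! 0, vs ! (1 mod k)) \<in> C" unfolding C_def by (rule conn_sym)
  moreover have "ends H (es ! 0) = {vs ! 0, vs ! (1 mod k)}" using e[OF k] by simp
  ultimately have "ends H (es ! 0) \<times> ends H (es ! 0) \<subseteq> conn (ends H) {} (edges H - {es ! 0})"
    unfolding C_def by (subst spans_iff) auto
  moreover have "es ! 0 \<in> edges H" using es k by (auto simp: k_def)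
  ultimately show ?thesis unfolding indep_def by blast
qed

lemma not_indep_imp_cycle:
  assumes N: "two_ends (ends H) (edges H)" and i: "\<not> indep (ends H) {} (edges H)"
  shows "\<exists>vs es. graph_cycle H vs es"
proof -
  obtain e where e: "e \<in> edges H" "ends H e \<times> ends H e \<subseteq> conn (ends H) {} (edges H - {e})"
    using i unfolding indep_def by blast
  obtain a b where ab: "ends H e = {a, b}" using N e(1) by (auto elim: two_endsE)
  show ?thesis
  proof (cases "a = b")
    case True
    have "graph_cycle H [a] [e]" using True ab e(1) by (simp add: graph_cycle_def)
    then show ?thesis by blast
  next
    case False
    have t: "two_ends (ends H) (edges H - {e})" using N by (rule two_ends_subset) auto
    have "(a, b) \<in> conn (ends H) {} (edges H - {e})" using e(2) ab by auto
    from conn_imp_simple_path[OF t this]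
    obtain vs es where p: "simple_path (ends H) (edges H - {e}) a b vs es" by blast
    have d: "distinct vs" and l: "length vs = Suc (length es)"
      and E: "\<And>i. i < length es \<Longrightarrow> ends H (es ! i) = {vs ! i, vs ! Suc i}"
      using p by (auto simp: simple_path_def)
    \<comment> \<open>Since the vertices are distinct, different positions carry different pairs of
      consecutive vertices, hence different edges.\<close>
    have "distinct es"
      unfolding distinct_conv_nth
    proof (intro allI impI)
      fix i j assume ij: "i < length es" "j < length es" "i \<noteq> j"
      have "vs ! i \<noteq> vs ! j" "vs ! Suc i \<noteq> vs ! Suc j" "\<not> (vs ! i = vs ! Suc j \<and> vs ! Suc i = vs ! j)"
        using d l ij by (auto simp: nth_eq_iff_index_eq)
      then have "{vs ! i, vs ! Suc i} \<noteq> {vs ! j, vs ! Suc j}" by (auto simp: doubleton_eq_iff)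
      then show "es ! i \<noteq> es ! j" using E[OF ij(1)] E[OF ij(2)] by auto
    qed
    moreover have "ends H ((es @ [e]) ! i) = {vs ! i, vs ! (Suc i mod length (es @ [e]))}"
      if "i < length (es @ [e])" for i
      using that p E[of i] ab by (cases "i = length es") (auto simp: simple_path_def nth_append)
    ultimately have "graph_cycle H vs (es @ [e])"
      using p d l e(1) unfolding graph_cycle_def by (auto simp: simple_path_def)
    then show ?thesis by blast
  qed
qed

lemma graph_acyclic_iff_indep:
  "two_ends (ends H) (edges H) \<Longrightarrow> graph_acyclic H \<longleftrightarrow> indep (ends H) {} (edges H)"
  unfolding graph_acyclic_def using cycle_imp_not_indep not_indep_imp_cycle by metis

text \<open>The edges inside a component connect it, so a subset of them is connected on
  \<open>C\<close> as soon as it spans each of them; acyclicity is independence.\<close>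

lemma spanning_trees_component:
  assumes G: "multigraph G" and C: "C \<in> component_sets G"
  shows "spanning_trees (induced G C) = bases (ends G) {} {e \<in> edges G. ends G e \<subseteq> C}"
proof -
  let ?N = "ends G" and ?E = "{e \<in> edges G. ends G e \<subseteq> C}"
  have N: "two_ends ?N (edges G)" using G by (rule two_ends_multigraph)
  obtain r where r: "r \<in> verts G" "C = {w. (r, w) \<in> conn ?N {} (edges G)}"
    using C unfolding component_sets_def quotient_def adjacency_rtrancl[OF N] by auto
  have closed: "?N f \<subseteq> C" if "f \<in> edges G" "v \<in> ?N f" "v \<in> C" for f v
  proof
    fix w assume "w \<in> ?N f"
    then have "(v, w) \<in> conn ?N {} (edges G)" using that by (intro conn_edge[of f]) auto
    then show "w \<in> C" using that(3) r(2) conn_trans by fast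
  qed
  have inC: "v \<in> C \<and> (u, v) \<in> conn ?N {} ?E" if "(u, v) \<in> conn ?N {} (edges G)" "u \<in> C" for u v
    using that(1) unfolding conn_def[of _ _ "edges G"]
  proof (induction rule: rtrancl_induct)
    case (step v w)
    then obtain f where f: "f \<in> edges G" "v \<in> ?N f" "w \<in> ?N f" by auto
    then have "?N f \<subseteq> C" using step.IH closed by blast
    moreover have "(v, w) \<in> conn ?N {} ?E" using f calculation by (intro conn_edge[of f]) auto
    ultimately show ?case using step.IH f conn_trans by fast
  qed (use that in simp)
  have conC: "(u, v) \<in> conn ?N {} ?E" if "u \<in> C" "v \<in> C" for u v
  proof -
    have "(u, v) \<in> conn ?N {} (edges G)" using that r(2) conn_trans conn_sym by fast
    then show ?thesis using inC that by blast
  qed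
  have "graph_connected ((induced G C)\<lparr>edges := T\<rparr>) \<and> graph_acyclic ((induced G C)\<lparr>edges := T\<rparr>) \<longleftrightarrow>
      indep ?N {} T \<and> (\<forall>e\<in>?E. ?N e \<times> ?N e \<subseteq> conn ?N {} T)" if T: "T \<subseteq> ?E" for T
  proof -
    let ?H = "(induced G C)\<lparr>edges := T\<rparr>"
    have H: "ends ?H = ?N" "edges ?H = T" "verts ?H = C" by (simp_all add: induced_def)
    have N': "two_ends (ends ?H) (edges ?H)" unfolding H using N by (rule two_ends_subset) (use T in auto)
    have "r \<in> C" using r(2) by simp
    have "graph_connected ?H \<longleftrightarrow> (\<forall>e\<in>?E. ?N e \<times> ?N e \<subseteq> conn ?N {} T)"
    proof
      assume "graph_connected ?H"
      then show "\<forall>e\<in>?E. ?N e \<times> ?N e \<subseteq> conn ?N {} T"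
        unfolding graph_connected_def adjacency_rtrancl[OF N'] H by blast
    next
      assume "\<forall>e\<in>?E. ?N e \<times> ?N e \<subseteq> conn ?N {} T"
      then have "conn ?N {} ?E \<subseteq> conn ?N {} T" by (intro conn_least) auto
      then show "graph_connected ?H"
        unfolding graph_connected_def adjacency_rtrancl[OF N'] H using conC \<open>r \<in> C\<close> by blast
    qed
    then show ?thesis using graph_acyclic_iff_indep[OF N'] H by auto
  qed
  then show ?thesis unfolding spanning_trees_def bases_def by (auto simp: induced_def)
qed

lemma spanning_tree_poly_eq_forest_poly:
  assumes G: "multigraph G"
  shows "spanning_tree_poly G x = forest_poly (ends G) {} (edges G) x"
proof -
  let ?N = "ends G" and ?E = "\<lambda>C. {e \<in> edges G. ends G e \<subseteq> C}"
  have N: "two_ends ?N (edges G)" using G by (rule two_ends_multigraph)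
  have fin: "finite (edges G)" "finite (verts G)" using G by (auto simp: multigraph_def)
  have classes: "component_sets G = (\<lambda>r. {w. (r, w) \<in> conn ?N {} (edges G)}) ` verts G"
    unfolding component_sets_def quotient_def adjacency_rtrancl[OF N] by auto
  have disj: "C \<inter> D = {}"
    if CD: "C \<in> component_sets G" "D \<in> component_sets G" and neq: "C \<noteq> D" for C D
  proof (rule ccontr)
    obtain r s where rs: "C = {w. (r, w) \<in> conn ?N {} (edges G)}" "D = {w. (s, w) \<in> conn ?N {} (edges G)}"
      using CD unfolding classes by blast
    assume "C \<inter> D \<noteq> {}"
    then obtain w where "(r, w) \<in> conn ?N {} (edges G)" "(s, w) \<in> conn ?N {} (edges G)"
      using rs by blast
    then have "(r, s) \<in> conn ?N {} (edges G)" using conn_trans conn_sym by fast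
    then have "C = D" unfolding rs using conn_trans conn_sym by fast
    with neq show False ..
  qed
  \<comment> \<open>Stated for any finite set of components so that they can be split off one by
    one; distinct components are vertex-disjoint.\<close>
  have prod: "forest_poly ?N {} (\<Union>C\<in>\<C>. ?E C) x = (\<Prod>C\<in>\<C>. forest_poly ?N {} (?E C) x)"
    if "finite \<C>" "\<C> \<subseteq> component_sets G" for \<C>
    using that
  proof (induction \<C> rule: finite_induct)
    case (insert C \<C>)
    have "C \<inter> D = {}" if "D \<in> \<C>" for D
      by (rule disj) (use that insert.hyps(2) insert.prems in auto)
    then have d: "C \<inter> \<Union>\<C> = {}" by blast
    have ne: "ends G e \<noteq> {}" if "e \<in> edges G" for e using N that by (auto elim: two_endsE)
    have "forest_poly ?N {} (?E C \<union> (\<Union>C\<in>\<C>. ?E C)) x =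
        forest_poly ?N {} (?E C) x * forest_poly ?N {} (\<Union>C\<in>\<C>. ?E C) x"
    proof (rule forest_poly_disjoint[OF _ _ _ _ _ d])
      show "?E C \<inter> (\<Union>C\<in>\<C>. ?E C) = {}" using d ne by blast
    qed (use fin insert.hyps in \<open>auto intro: two_ends_subset[OF N]\<close>)
    with insert show ?case by simp
  qed simp
  have "edges G = (\<Union>C\<in>component_sets G. ?E C)"
  proof (intro antisym subsetI)
    fix e assume e: "e \<in> edges G"
    obtain a b where ab: "ends G e = {a, b}" using N e by (auto elim: two_endsE)
    then have "a \<in> verts G" using G e by (auto simp: multigraph_def)
    moreover have "(a, b) \<in> conn ?N {} (edges G)" using e ab by (intro conn_edge[of e]) auto
    ultimately show "e \<in> (\<Union>C\<in>component_sets G. ?E C)" unfolding classes using e ab by auto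
  qed auto
  moreover have "spanning_tree_poly G x = (\<Prod>C\<in>component_sets G. forest_poly ?N {} (?E C) x)"
    unfolding spanning_tree_poly_def forest_poly_def
    by (rule prod.cong) (auto simp: spanning_trees_component[OF G])
  ultimately show ?thesis using prod[of "component_sets G"] fin(2) by (simp add: classes)
qed

section \<open>Forest polynomials of graph operations\<close>

lemma conn_empty [simp]: "conn N {} {} = Id"
  by (simp add: conn_def)

text \<open>In the contracted graph every \<open>w\<close> is connected to
  \<open>merge_vertex x y w\<close>, so merging before or recording the pair gives the same
  connectivity. \<open>R\<close> is carried along because a parallel connection identifies
  twice.\<close>

lemma forest_poly_identify:
  "forest_poly (\<lambda>e. merge_vertex x y ` N e) (map_prod (merge_vertex x y) (merge_vertex x y) ` R) E z =
   forest_poly N (insert (x, y) R) E z"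
proof -
  let ?m = "merge_vertex x y"
  let ?N = "\<lambda>e. ?m ` N e" and ?R = "map_prod ?m ?m ` R"
  have "(?m u, ?m v) \<in> conn ?N ?R S \<longleftrightarrow> (u, v) \<in> conn N (insert (x, y) R) S" for S u v
  proof
    have w: "(?m w, w) \<in> conn N (insert (x, y) R) S" for w
      by (auto simp: merge_vertex_def intro: conn_rel)
    assume "(?m u, ?m v) \<in> conn ?N ?R S"
    then have "(id (?m u), id (?m v)) \<in> conn N (insert (x, y) R) S"
    proof (rule conn_map[rotated 2])
      fix a b assume "(a, b) \<in> ?R"
      then obtain c d where "(c, d) \<in> R" "a = ?m c" "b = ?m d" by auto
      then show "(id a, id b) \<in> conn N (insert (x, y) R) S"
        using conn_trans[OF w conn_trans[OF conn_rel conn_sym[OF w]]] by simp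
    next
      fix e a b assume "e \<in> S" "a \<in> ?N e" "b \<in> ?N e"
      then obtain c d where "c \<in> N e" "d \<in> N e" "a = ?m c" "b = ?m d" by auto
      moreover from this have "(c, d) \<in> conn N (insert (x, y) R) S"
        using \<open>e \<in> S\<close> by (intro conn_edge[of e])
      ultimately show "(id a, id b) \<in> conn N (insert (x, y) R) S"
        using conn_trans[OF w conn_trans[OF _ conn_sym[OF w]]] by simp
    qed
    then show "(u, v) \<in> conn N (insert (x, y) R) S"
      using conn_trans[OF conn_sym[OF w] conn_trans[OF _ w]] by simp
  next
    assume "(u, v) \<in> conn N (insert (x, y) R) S"
    then show "(?m u, ?m v) \<in> conn ?N ?R S"
    proof (rule conn_map[rotated 2])
      fix a b assume "(a, b) \<in> insert (x, y) R"
      then consider "a = x" "b = y" | "(a, b) \<in> R" by blast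
      then show "(?m a, ?m b) \<in> conn ?N ?R S"
      proof cases
        case 1
        then show ?thesis by (simp add: merge_vertex_def)
      next
        case 2
        then have "(?m a, ?m b) \<in> ?R" by force
        then show ?thesis by (rule conn_rel)
      qed
    next
      fix e a b assume "e \<in> S" "a \<in> N e" "b \<in> N e"
      then show "(?m a, ?m b) \<in> conn ?N ?R S" by (intro conn_edge[of e]) auto
    qed
  qed
  then show ?thesis
    using forest_poly_map[of id E E ?N ?m N ?R "insert (x, y) R" z] by simp
qed

lemma forest_poly_identify_graph:
  "forest_poly (ends (identify x y G)) {} (edges (identify x y G)) z = forest_poly (ends G) {(x, y)} (edges G) z"
  using forest_poly_identify[of x y "ends G" "{}" "edges G" z] by (simp add: identify_def)

lemma forest_poly_graph_iso:
  assumes G: "multigraph G" and f: "bij_betw f (verts G) (verts H)" and g: "bij_betw g (edges G) (edges H)"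
    and fg: "\<And>e. e \<in> edges G \<Longrightarrow> ends H (g e) = f ` ends G e"
  shows "forest_poly (ends H) {} (edges H) x = forest_poly (ends G) {} (edges G) (x \<circ> g)"
proof (rule forest_poly_map[where f = f, OF g])
  show "ends H (g e) = f ` ends G e" if "e \<in> edges G" for e using that by (rule fg)
  have sub: "ends G e \<subseteq> verts G" if "e \<in> edges G" for e using G that by (auto simp: multigraph_def)
  define h where "h = inv_into (verts G) f"
  have h: "h (f v) = v" if "v \<in> verts G" for v
    unfolding h_def using f that by (auto simp: bij_betw_def inv_into_f_f)
  fix S e u v assume S: "S \<subseteq> edges G" and e: "e \<in> edges G" "u \<in> ends G e" "v \<in> ends G e"
  have uv: "u \<in> verts G" "v \<in> verts G" using sub e by auto
  show "(f u, f v) \<in> conn (ends H) {} (g ` S) \<longleftrightarrow> (u, v) \<in> conn (ends G) {} S"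
  proof
    assume "(f u, f v) \<in> conn (ends H) {} (g ` S)"
    then have "(h (f u), h (f v)) \<in> conn (ends G) {} S"
    proof (rule conn_map[rotated 2])
      fix e' a b assume "e' \<in> g ` S" "a \<in> ends H e'" "b \<in> ends H e'"
      then obtain e c d where e: "e \<in> S" "c \<in> ends G e" "d \<in> ends G e" "a = f c" "b = f d"
        using S fg by blast
      moreover have "h a = c" "h b = d" using e S sub h by auto
      ultimately show "(h a, h b) \<in> conn (ends G) {} S" by (auto intro: conn_edge)
    qed simp
    then show "(u, v) \<in> conn (ends G) {} S" using h uv by simp
  next
    assume "(u, v) \<in> conn (ends G) {} S"
    then show "(f u, f v) \<in> conn (ends H) {} (g ` S)"
    proof (rule conn_map[rotated 2])
      fix e a b assume "e \<in> S" "a \<in> ends G e" "b \<in> ends G e"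
      then show "(f a, f b) \<in> conn (ends H) {} (g ` S)" using S fg by (intro conn_edge[of "g e"]) auto
    qed simp
  qed
qed

lemma forest_poly_edge:
  assumes e: "e \<in> E" "N e = {x, y}" and E: "finite E" "two_ends N E"
  shows "forest_poly N {} E z =
    (if (x, y) \<in> conn N {} (E - {e}) then forest_poly N {} (E - {e}) z else 0) +
    z e * (if x = y then 0 else forest_poly N {(x, y)} (E - {e}) z)"
proof -
  have E': "insert e (E - {e}) = E" "e \<notin> E - {e}" "finite (E - {e})" "two_ends N (E - {e})"
    using e E two_ends_subset[OF E(2), of "E - {e}"] by auto
  show ?thesis
  proof (cases "x = y")
    case True
    then show ?thesis using forest_poly_loop[where N = N, OF E'(2) e(2), of "{}" z] E'(1) by simp
  next
    case False
    then show ?thesis using forest_poly_insert[where N = N, OF E'(2) e(2) E'(3,4), of "{}" z] E'(1) by simp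
  qed
qed

text \<open>The two graphs without their marked edges but with the ends of these as terminals: the
  common setting of parallel and series connection.\<close>

locale two_pieces =
  fixes N :: "'e \<Rightarrow> 'v set" and E1 E2 :: "'e set" and V1 V2 :: "'v set" and x1 y1 x2 y2 :: 'v
  assumes fin: "finite E1" "finite E2" and two: "two_ends N E1" "two_ends N E2"
    and E_disjoint: "E1 \<inter> E2 = {}" and V_disjoint: "V1 \<inter> V2 = {}"
    and N: "\<And>e. e \<in> E1 \<Longrightarrow> N e \<subseteq> V1" "\<And>e. e \<in> E2 \<Longrightarrow> N e \<subseteq> V2"
    and x: "x1 \<in> V1" "x2 \<in> V2" and y: "y1 \<in> V1" "y2 \<in> V2"
begin

lemma two_union: "two_ends N (E1 \<union> E2)"
  using two by (auto simp: two_ends_def)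

lemma glue_poly: "forest_poly N {(x1, x2)} (E1 \<union> E2) z = forest_poly N {} E1 z * forest_poly N {} E2 z"
  using forest_poly_glue[OF fin two E_disjoint V_disjoint _ _ N _ x, of "{}" "{}" "{(x1, x2)}"] by simp

text \<open>Once \<open>x1\<close> and \<open>y1\<close> are merged, all four terminals coincide,
  which is the same as contracting each terminal pair and gluing at one vertex.\<close>

lemma glue_contracted_poly:
  "forest_poly N {(x1, y1), (x1, x2), (y1, y2)} (E1 \<union> E2) z =
   forest_poly N {(x1, y1)} E1 z * forest_poly N {(x2, y2)} E2 z"
proof -
  have "forest_poly N {(x1, y1), (x1, x2), (y1, y2)} (E1 \<union> E2) z =
      forest_poly N ({(x1, x2)} \<union> {(x1, y1)} \<union> {(x2, y2)}) (E1 \<union> E2) z"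
  proof (rule forest_poly_cong_rel)
    let ?C = "conn N ({(x1, x2)} \<union> {(x1, y1)} \<union> {(x2, y2)}) {}"
    have 1: "(x1, x2) \<in> ?C" "(x1, y1) \<in> ?C" "(x2, y2) \<in> ?C" by (auto intro: conn_rel)
    have "(y1, y2) \<in> ?C" using conn_trans[OF conn_sym[OF 1(2)] conn_trans[OF 1(1) 1(3)]] .
    with 1 show "{(x1, y1), (x1, x2), (y1, y2)} \<subseteq> ?C" by blast
    let ?D = "conn N {(x1, y1), (x1, x2), (y1, y2)} {}"
    have 2: "(x1, x2) \<in> ?D" "(x1, y1) \<in> ?D" "(y1, y2) \<in> ?D" by (auto intro: conn_rel)
    have "(x2, y2) \<in> ?D" using conn_trans[OF conn_sym[OF 2(1)] conn_trans[OF 2(2) 2(3)]] .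
    with 2 show "{(x1, x2)} \<union> {(x1, y1)} \<union> {(x2, y2)} \<subseteq> ?D" by blast
  qed
  also have "\<dots> = forest_poly N {(x1, y1)} E1 z * forest_poly N {(x2, y2)} E2 z"
    by (rule forest_poly_glue[OF fin two E_disjoint V_disjoint _ _ N _ x]) (use x y in auto)
  finally show ?thesis .
qed

lemma conn_stays:
  assumes S: "S1 \<subseteq> E1" "S2 \<subseteq> E2" and uv: "(u, v) \<in> conn N {} (S1 \<union> S2)"
  shows "u \<in> V1 \<longleftrightarrow> v \<in> V1"
proof -
  \<comment> \<open>Membership in \<open>V1\<close> is mapped into an edgeless graph on
    \<open>bool\<close>, where connectivity is equality; so it is constant along paths.\<close>
  have "(u \<in> V1, v \<in> V1) \<in> conn (\<lambda>_::unit. {}) {} {}"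
    using uv
  proof (rule conn_map[rotated 2, where f = "\<lambda>w. w \<in> V1"])
    fix e u v assume e: "e \<in> S1 \<union> S2" "u \<in> N e" "v \<in> N e"
    then have "N e \<subseteq> V1 \<or> N e \<subseteq> V2" using N S by blast
    then have "u \<in> V1 \<longleftrightarrow> v \<in> V1" using e V_disjoint by blast
    then show "(u \<in> V1, v \<in> V1) \<in> conn (\<lambda>_. {}) {} {}" by simp
  qed simp
  then show ?thesis by simp
qed

lemma conn_local:
  assumes S: "S1 \<subseteq> E1" "S2 \<subseteq> E2"
  shows "u \<in> V1 \<Longrightarrow> v \<in> V1 \<Longrightarrow> (u, v) \<in> conn N {} (S1 \<union> S2) \<longleftrightarrow> (u, v) \<in> conn N {} S1"
    and "u \<in> V2 \<Longrightarrow> v \<in> V2 \<Longrightarrow> (u, v) \<in> conn N {} (S1 \<union> S2) \<longleftrightarrow> (u, v) \<in> conn N {} S2"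
proof -
  show "(u, v) \<in> conn N {} (S1 \<union> S2) \<longleftrightarrow> (u, v) \<in> conn N {} S1" if "u \<in> V1" "v \<in> V1"
  proof -
    have "(u, v) \<in> conn N ({} \<union> {} \<union> {}) (S1 \<union> S2) \<longleftrightarrow> (u, v) \<in> conn N {} S1"
      by (rule conn_glue_local[OF V_disjoint _ _ _ _ _ x that]) (use N S in blast)+
    then show ?thesis by simp
  qed
  show "(u, v) \<in> conn N {} (S1 \<union> S2) \<longleftrightarrow> (u, v) \<in> conn N {} S2" if "u \<in> V2" "v \<in> V2"
  proof -
    have "V2 \<inter> V1 = {}" using V_disjoint by blast
    then have "(u, v) \<in> conn N ({} \<union> {} \<union> {}) (S2 \<union> S1) \<longleftrightarrow> (u, v) \<in> conn N {} S2"
      by (rule conn_glue_local[OF _ _ _ _ _ _ x(2,1) that]) (use N S in blast)+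
    then show ?thesis by (simp add: Un_commute)
  qed
qed

text \<open>Any path between the pieces has to pass through the single gluing vertex.\<close>

lemma conn_across:
  assumes S: "S1 \<subseteq> E1" "S2 \<subseteq> E2"
  shows "(y1, y2) \<in> conn N {(x1, x2)} (S1 \<union> S2) \<longleftrightarrow>
    (x1, y1) \<in> conn N {} S1 \<and> (x2, y2) \<in> conn N {} S2"
proof
  have nV: "y2 \<notin> V1" "x2 \<notin> V1" using x y V_disjoint by auto
  assume "(y1, y2) \<in> conn N {(x1, x2)} (S1 \<union> S2)"
  then have "(y1, x1) \<in> conn N {} (S1 \<union> S2) \<and> (x2, y2) \<in> conn N {} (S1 \<union> S2)"
    using conn_insert_cases[of y1 y2 N x1 x2 "{}" "S1 \<union> S2"] conn_stays[OF S] x y nV by blast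
  then show "(x1, y1) \<in> conn N {} S1 \<and> (x2, y2) \<in> conn N {} S2"
    using conn_local(1)[OF S y(1) x(1)] conn_local(2)[OF S x(2) y(2)] conn_sym by metis
next
  let ?C = "conn N {(x1, x2)} (S1 \<union> S2)"
  assume a: "(x1, y1) \<in> conn N {} S1 \<and> (x2, y2) \<in> conn N {} S2"
  have m: "conn N {} S1 \<subseteq> ?C" "conn N {} S2 \<subseteq> ?C" by (rule conn_mono; auto)+
  have b: "(x1, x2) \<in> ?C" by (auto intro: conn_rel)
  have c: "(x1, y1) \<in> ?C" "(x2, y2) \<in> ?C" using a m by auto
  show "(y1, y2) \<in> ?C" using conn_trans[OF conn_sym[OF c(1)] conn_trans[OF b c(2)]] .
qed

lemma conn_parallel:
  assumes S: "S1 \<subseteq> E1" "S2 \<subseteq> E2"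
  shows "(x1, y1) \<in> conn N {(x1, x2), (y1, y2)} (S1 \<union> S2) \<longleftrightarrow>
    (x1, y1) \<in> conn N {} S1 \<or> (x2, y2) \<in> conn N {} S2"
proof -
  have "(x1, y1) \<in> conn N ({(x1, x2), (y1, y2)} \<union> {} \<union> {}) (S1 \<union> S2) \<longleftrightarrow>
      (x1, y1) \<in> conn N (if (x2, y2) \<in> conn N {} S2 then insert (x1, y1) {} else {}) S1"
    by (rule conn_parallel_local[OF V_disjoint _ _ _ _ x y(1) y(2) x(1) y(1)]) (use N S in blast)+
  moreover have "(x1, y1) \<in> conn N {(x1, y1)} S1" by (simp add: conn_rel)
  ultimately show ?thesis by (simp split: if_splits)
qed

text \<open>\<open>forest_poly_two_terminal\<close> wants the second piece to join its terminals. If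
  it does not, merging \<open>y1\<close> and \<open>y2\<close> after the gluing merges two
  disconnected vertices, and the polynomial factors.\<close>

lemma parallel_poly:
  assumes ne: "x1 \<noteq> y1" "x2 \<noteq> y2"
  shows "(if (x1, y1) \<in> conn N {(x1, x2), (y1, y2)} (E1 \<union> E2)
      then forest_poly N {(x1, x2), (y1, y2)} (E1 \<union> E2) z else 0) =
    (if (x1, y1) \<in> conn N {} E1 then forest_poly N {} E1 z else 0) * forest_poly N {(x2, y2)} E2 z +
    forest_poly N {(x1, y1)} E1 z * (if (x2, y2) \<in> conn N {} E2 then forest_poly N {} E2 z else 0)"
proof (cases "(x2, y2) \<in> conn N {} E2")
  case True
  have "forest_poly N ({(x1, x2), (y1, y2)} \<union> {} \<union> {}) (E1 \<union> E2) z =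
    (if (x1, y1) \<in> conn N {} E1 then forest_poly N {} E1 z else 0) * forest_poly N (insert (x2, y2) {}) E2 z +
    (if (x1, y1) \<in> conn N {} {} then 0 else forest_poly N (insert (x1, y1) {}) E1 z) * forest_poly N {} E2 z"
    by (rule forest_poly_two_terminal[OF fin two E_disjoint V_disjoint _ _ N x y]) (use ne True in auto)
  then show ?thesis using True ne conn_parallel[of E1 E2] by simp
next
  case False
  have B2: "forest_poly N {(x2, y2)} E2 z = forest_poly N {} E2 z"
    by (rule forest_poly_bridge[OF two(2) False])
  have "(y1, y2) \<notin> conn N {(x1, x2)} (E1 \<union> E2)" using conn_across[of E1 E2] False by simp
  from forest_poly_bridge[OF two_union this]
  have "forest_poly N {(x1, x2), (y1, y2)} (E1 \<union> E2) z = forest_poly N {} E1 z * forest_poly N {} E2 z"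
    by (simp add: insert_commute glue_poly)
  then show ?thesis using False B2 conn_parallel[of E1 E2] by simp
qed

text \<open>Merging \<open>y1\<close> with \<open>y2\<close> is the contraction of the new edge. For
  \<open>x2 = y2\<close> the two-terminal formula does not apply, but then the identifications
  already merge \<open>x1\<close> with \<open>y1\<close> and the pieces meet in one vertex.\<close>

lemma series_poly:
  assumes c: "(x1, y1) \<in> conn N {} E1" "(x2, y2) \<in> conn N {} E2" and ne: "x1 \<noteq> y1 \<or> x2 \<noteq> y2"
  shows "forest_poly N {(x1, x2), (y1, y2)} (E1 \<union> E2) z =
    forest_poly N {} E1 z * (if x2 = y2 then 0 else forest_poly N {(x2, y2)} E2 z) +
    (if x1 = y1 then 0 else forest_poly N {(x1, y1)} E1 z) * forest_poly N {} E2 z"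
proof (cases "x2 = y2")
  case False
  have "forest_poly N ({(x1, x2), (y1, y2)} \<union> {} \<union> {}) (E1 \<union> E2) z =
    (if (x1, y1) \<in> conn N {} E1 then forest_poly N {} E1 z else 0) * forest_poly N (insert (x2, y2) {}) E2 z +
    (if (x1, y1) \<in> conn N {} {} then 0 else forest_poly N (insert (x1, y1) {}) E1 z) * forest_poly N {} E2 z"
    by (rule forest_poly_two_terminal[OF fin two E_disjoint V_disjoint _ _ N x y]) (use False c in auto)
  then show ?thesis using c False by simp
next
  case True
  then have "x1 \<noteq> y1" using ne by simp
  have l: "(x1, y1) \<in> conn N {(x1, x2), (y1, y2)} {}" using conn_parallel[of "{}" "{}"] True by simp
  have "forest_poly N {(x1, x2), (y1, y2)} (E1 \<union> E2) z =
      forest_poly N {(x1, y1)} E1 z * forest_poly N {(x2, y2)} E2 z"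
    using glue_contracted_poly[of z] unfolding forest_poly_insert_absorb[OF l] .
  moreover have "forest_poly N {(x2, y2)} E2 z = forest_poly N {} E2 z"
    using True by (intro forest_poly_insert_absorb) simp
  ultimately show ?thesis using True \<open>x1 \<noteq> y1\<close> by simp
qed

end

lemma two_pieces_graphs:
  assumes G: "multigraph G1" "multigraph G2" "disjoint_graphs G1 G2"
    and e1: "e1 \<in> edges G1" "ends G1 e1 = {x1, y1}" and e2: "e2 \<in> edges G2" "ends G2 e2 = {x2, y2}"
    and N: "\<And>e. e \<in> edges G1 - {e1} \<Longrightarrow> N e = ends G1 e" "\<And>e. e \<in> edges G2 - {e2} \<Longrightarrow> N e = ends G2 e"
  shows "two_pieces N (edges G1 - {e1}) (edges G2 - {e2}) (verts G1) (verts G2) x1 y1 x2 y2"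
proof
  show "two_ends N (edges G1 - {e1})" "two_ends N (edges G2 - {e2})"
    using two_ends_multigraph[OF G(1)] two_ends_multigraph[OF G(2)] N by (auto simp: two_ends_def)
  show "N e \<subseteq> verts G1" if "e \<in> edges G1 - {e1}" for e
    using G(1) N(1)[OF that] that by (auto simp: multigraph_def)
  show "N e \<subseteq> verts G2" if "e \<in> edges G2 - {e2}" for e
    using G(2) N(2)[OF that] that by (auto simp: multigraph_def)
  show "x1 \<in> verts G1" "y1 \<in> verts G1"
    using G(1) e1 by (auto simp: multigraph_def)
  show "x2 \<in> verts G2" "y2 \<in> verts G2"
    using G(2) e2 by (auto simp: multigraph_def)
qed (use G in \<open>auto simp: multigraph_def disjoint_graphs_def\<close>)

section \<open>Edge coefficients and the polynomials of the graph operations\<close>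

definition deleted_poly :: "('v, 'e) mgraph \<Rightarrow> 'e \<Rightarrow> ('e \<Rightarrow> real) \<Rightarrow> real" where
  "deleted_poly G e = forest_poly (ends G) {} (edges G - {e})"

definition contracted_poly :: "('v, 'e) mgraph \<Rightarrow> 'e \<Rightarrow> 'v \<Rightarrow> 'v \<Rightarrow> ('e \<Rightarrow> real) \<Rightarrow> real" where
  "contracted_poly G e x y = forest_poly (ends G) {(x, y)} (edges G - {e})"

definition bridge :: "('v, 'e) mgraph \<Rightarrow> 'e \<Rightarrow> 'v \<Rightarrow> 'v \<Rightarrow> bool" where
  "bridge G e x y \<longleftrightarrow> (x, y) \<notin> conn (ends G) {} (edges G - {e})"

text \<open>Both polynomials count maximal forests and are positive even for bridges and loops, so
  the coefficients that vanish have to be set to 0 explicitly.\<close>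

lemma spanning_tree_poly_edge:
  assumes "multigraph G" "e \<in> edges G" "ends G e = {x, y}"
  shows "spanning_tree_poly G z = (if bridge G e x y then 0 else deleted_poly G e z) +
    z e * (if x = y then 0 else contracted_poly G e x y z)"
  using forest_poly_edge[where N = "ends G", OF assms(2,3) _ two_ends_multigraph[OF assms(1)], of z] assms(1)
  by (simp add: spanning_tree_poly_eq_forest_poly bridge_def deleted_poly_def contracted_poly_def multigraph_def)

lemma spanning_tree_poly_delete_edge:
  "multigraph G \<Longrightarrow> spanning_tree_poly (delete_edge e G) z = deleted_poly G e z"
  by (simp add: spanning_tree_poly_eq_forest_poly[OF multigraph_delete_edge])
    (simp add: deleted_poly_def delete_edge_def)

lemma spanning_tree_poly_contract_edge:
  "multigraph G \<Longrightarrow> spanning_tree_poly (contract_edge e x y G) z = contracted_poly G e x y z"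
  unfolding contract_edge_def contracted_poly_def
  by (simp add: spanning_tree_poly_eq_forest_poly multigraph_delete_edge multigraph_identify
      forest_poly_identify_graph) (simp add: delete_edge_def)

lemma contracted_poly_bridge:
  "multigraph G \<Longrightarrow> bridge G e x y \<Longrightarrow> contracted_poly G e x y z = deleted_poly G e z"
  unfolding contracted_poly_def deleted_poly_def bridge_def
  by (intro forest_poly_bridge two_ends_subset[OF two_ends_multigraph]) auto

lemma contracted_poly_loop: "contracted_poly G e x x z = deleted_poly G e z"
  unfolding contracted_poly_def deleted_poly_def by (rule forest_poly_insert_absorb) simp

lemma spanning_tree_poly_graph_union:
  assumes G: "multigraph G1" "multigraph G2" "disjoint_graphs G1 G2"
  shows "spanning_tree_poly (graph_union G1 G2) z = spanning_tree_poly G1 z * spanning_tree_poly G2 z"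
proof -
  let ?N = "\<lambda>e. if e \<in> edges G1 then ends G1 e else ends G2 e"
  have d: "verts G1 \<inter> verts G2 = {}" "edges G1 \<inter> edges G2 = {}"
    using G(3) by (auto simp: disjoint_graphs_def)
  have N: "?N e = ends G1 e" if "e \<in> edges G1" for e using that by simp
  have N': "?N e = ends G2 e" if "e \<in> edges G2" for e using that d(2) by auto
  have t: "two_ends ?N (edges G1)" "two_ends ?N (edges G2)"
    using two_ends_multigraph[OF G(1)] two_ends_multigraph[OF G(2)] N N' by (auto simp: two_ends_def)
  have "forest_poly ?N {} (edges G1 \<union> edges G2) z = forest_poly ?N {} (edges G1) z * forest_poly ?N {} (edges G2) z"
    by (rule forest_poly_disjoint[OF _ _ t d(2,1)]) (use G N N' in \<open>auto simp: multigraph_def\<close>)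
  also have "\<dots> = forest_poly (ends G1) {} (edges G1) z * forest_poly (ends G2) {} (edges G2) z"
    using forest_poly_cong_ends[of "edges G1" ?N "ends G1", OF N] forest_poly_cong_ends[of "edges G2" ?N "ends G2", OF N'] by simp
  finally show ?thesis using G
    by (simp add: spanning_tree_poly_eq_forest_poly multigraph_graph_union) (simp add: graph_union_def)
qed

text \<open>The glued vertices lie in different components of the union, so
  \<open>forest_poly_bridge\<close> reduces gluing to disjoint union.\<close>

lemma spanning_tree_poly_glue:
  assumes G: "multigraph G1" "multigraph G2" "disjoint_graphs G1 G2" and x: "x1 \<in> verts G1" "x2 \<in> verts G2"
  shows "spanning_tree_poly (identify x1 x2 (graph_union G1 G2)) z = spanning_tree_poly G1 z * spanning_tree_poly G2 z"
proof -
  let ?U = "graph_union G1 G2"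
  have U: "multigraph ?U" using G by (intro multigraph_graph_union)
  have d: "verts G1 \<inter> verts G2 = {}" using G(3) by (auto simp: disjoint_graphs_def)
  have "(x1, x2) \<notin> conn (ends ?U) {} (edges ?U)"
  proof
    assume "(x1, x2) \<in> conn (ends ?U) {} (edges ?U)"
    then have "(x1 \<in> verts G1, x2 \<in> verts G1) \<in> conn (\<lambda>_::unit. {}) {} {}"
    proof (rule conn_map[rotated 2, where f = "\<lambda>w. w \<in> verts G1"])
      fix e u v assume e: "e \<in> edges ?U" "u \<in> ends ?U e" "v \<in> ends ?U e"
      then have "ends ?U e \<subseteq> verts G1 \<or> ends ?U e \<subseteq> verts G2"
        using G by (auto simp: multigraph_def graph_union_def)
      then have "u \<in> verts G1 \<longleftrightarrow> v \<in> verts G1" using e d by blast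
      then show "(u \<in> verts G1, v \<in> verts G1) \<in> conn (\<lambda>_. {}) {} {}" by simp
    qed simp
    then show False using x d by auto
  qed
  from forest_poly_bridge[OF two_ends_multigraph[OF U] this]
  show ?thesis
    using U G by (simp add: spanning_tree_poly_eq_forest_poly[OF multigraph_identify] forest_poly_identify_graph
        flip: spanning_tree_poly_eq_forest_poly spanning_tree_poly_graph_union)
qed

lemma spanning_tree_poly_parallel:
  assumes G: "multigraph G1" "multigraph G2" "disjoint_graphs G1 G2"
    and e1: "e1 \<in> edges G1" "ends G1 e1 = {x1, y1}" and e2: "e2 \<in> edges G2" "ends G2 e2 = {x2, y2}"
  shows "spanning_tree_poly (parallel_connection G1 e1 x1 y1 G2 e2 x2 y2) z =
    (if x1 = y1 \<or> x2 = y2 then contracted_poly G1 e1 x1 y1 z * contracted_poly G2 e2 x2 y2 z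
     else (if bridge G1 e1 x1 y1 then 0 else deleted_poly G1 e1 z) * contracted_poly G2 e2 x2 y2 z +
       contracted_poly G1 e1 x1 y1 z * (if bridge G2 e2 x2 y2 then 0 else deleted_poly G2 e2 z) +
       z e1 * (contracted_poly G1 e1 x1 y1 z * contracted_poly G2 e2 x2 y2 z))"
proof -
  let ?P = "parallel_connection G1 e1 x1 y1 G2 e2 x2 y2" and ?m = "merge_vertex x1 x2"
  define N where "N = ends (graph_union G1 G2)"
  define F1 where "F1 = edges G1 - {e1}"
  define F2 where "F2 = edges G2 - {e2}"
  have d: "edges G1 \<inter> edges G2 = {}" using G(3) by (auto simp: disjoint_graphs_def)
  have N1: "N e = ends G1 e" if "e \<in> edges G1" for e using that by (simp add: N_def graph_union_def)
  have N2: "N e = ends G2 e" if "e \<in> edges G2" for e using that d by (auto simp: N_def graph_union_def)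
  interpret two_pieces N F1 F2 "verts G1" "verts G2" x1 y1 x2 y2
    unfolding F1_def F2_def by (rule two_pieces_graphs[OF G e1 e2]) (auto simp: N1 N2)
  have P: "multigraph ?P"
    using G unfolding parallel_connection_def
    by (intro multigraph_delete_edge multigraph_identify multigraph_graph_union)
  have E: "edges ?P = insert e1 (F1 \<union> F2)" "e1 \<notin> F1 \<union> F2"
    using e1 e2 d by (auto simp: parallel_connection_def delete_edge_def identify_def graph_union_def F1_def F2_def)
  have "spanning_tree_poly ?P z =
      forest_poly (\<lambda>e. merge_vertex (?m y1) (?m y2) ` (?m ` N e)) {} (edges ?P) z"
    unfolding spanning_tree_poly_eq_forest_poly[OF P]
    by (simp add: parallel_connection_def delete_edge_def identify_def N_def)
  \<comment> \<open>The outer identification is undone first; its pair of merged vertices becomes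
    (y1, y2) when the inner one is undone.\<close>
  also have "\<dots> = forest_poly (\<lambda>e. ?m ` N e) {(?m y1, ?m y2)} (edges ?P) z"
    using forest_poly_identify[of "?m y1" "?m y2" "\<lambda>e. ?m ` N e" "{}"] by simp
  also have "\<dots> = forest_poly N {(x1, x2), (y1, y2)} (edges ?P) z"
    using forest_poly_identify[of x1 x2 N "{(y1, y2)}"] by simp
  finally have T: "spanning_tree_poly ?P z = forest_poly N {(x1, x2), (y1, y2)} (insert e1 (F1 \<union> F2)) z"
    unfolding E(1) .
  have c: "forest_poly N {} F1 z = deleted_poly G1 e1 z" "forest_poly N {} F2 z = deleted_poly G2 e2 z"
    "forest_poly N {(x1, y1)} F1 z = contracted_poly G1 e1 x1 y1 z"
    "forest_poly N {(x2, y2)} F2 z = contracted_poly G2 e2 x2 y2 z"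
    unfolding deleted_poly_def contracted_poly_def F1_def F2_def
    by (rule forest_poly_cong_ends; simp add: N1 N2)+
  have "conn N {} F1 = conn (ends G1) {} F1" "conn N {} F2 = conn (ends G2) {} F2"
    by (rule conn_cong_ends; simp add: N1 N2 F1_def F2_def)+
  then have b: "bridge G1 e1 x1 y1 \<longleftrightarrow> (x1, y1) \<notin> conn N {} F1" "bridge G2 e2 x2 y2 \<longleftrightarrow> (x2, y2) \<notin> conn N {} F2"
    by (simp_all add: bridge_def F1_def F2_def)
  have e1': "N e1 = {x1, y1}" using N1[OF e1(1)] e1(2) by simp
  show ?thesis
  proof (cases "x1 = y1 \<or> x2 = y2")
    case True
    then have "(x1, y1) \<in> conn N {(x1, x2), (y1, y2)} {}" using conn_parallel[of "{}" "{}"] by auto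
    then show ?thesis
      using forest_poly_loop[where N = N, OF E(2) e1'] forest_poly_insert_absorb[of x1 y1 N "{(x1, x2), (y1, y2)}"]
        glue_contracted_poly True unfolding T by (simp add: c)
  next
    case False
    then have "(x1, y1) \<notin> conn N {(x1, x2), (y1, y2)} {}" using conn_parallel[of "{}" "{}"] by auto
    then show ?thesis
      using forest_poly_insert[where N = N, OF E(2) e1' _ two_union] fin parallel_poly[of z] False glue_contracted_poly
      unfolding T by (simp add: b c)
  qed
qed

lemma spanning_tree_poly_series:
  assumes G: "multigraph G1" "multigraph G2" "disjoint_graphs G1 G2"
    and e1: "e1 \<in> edges G1" "ends G1 e1 = {x1, y1}" and e2: "e2 \<in> edges G2" "ends G2 e2 = {x2, y2}"
    and e: "e \<notin> edges G1 \<union> edges G2"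
  shows "spanning_tree_poly (series_connection G1 e1 x1 y1 G2 e2 x2 y2 e) z =
    (if bridge G1 e1 x1 y1 \<or> bridge G2 e2 x2 y2 then z e * (deleted_poly G1 e1 z * deleted_poly G2 e2 z)
     else deleted_poly G1 e1 z * deleted_poly G2 e2 z +
       z e * (deleted_poly G1 e1 z * (if x2 = y2 then 0 else contracted_poly G2 e2 x2 y2 z) +
         (if x1 = y1 then 0 else contracted_poly G1 e1 x1 y1 z) * deleted_poly G2 e2 z))"
proof -
  let ?S = "series_connection G1 e1 x1 y1 G2 e2 x2 y2 e" and ?m = "merge_vertex x1 x2"
  define F1 where "F1 = edges G1 - {e1}"
  define F2 where "F2 = edges G2 - {e2}"
  \<comment> \<open>The new edge gets its ends before the identification, so that the whole series
    connection is the image under one merge.\<close>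
  define N where "N = (ends (graph_union (delete_edge e1 G1) (delete_edge e2 G2)))(e := {y1, y2})"
  have d: "edges G1 \<inter> edges G2 = {}" using G(3) by (auto simp: disjoint_graphs_def)
  have N1: "N f = ends G1 f" if "f \<in> F1" for f
    using that e by (auto simp: N_def graph_union_def delete_edge_def F1_def)
  have N2: "N f = ends G2 f" if "f \<in> F2" for f
    using that e d by (auto simp: N_def graph_union_def delete_edge_def F2_def)
  interpret two_pieces N F1 F2 "verts G1" "verts G2" x1 y1 x2 y2
    unfolding F1_def F2_def by (rule two_pieces_graphs[OF G e1 e2]) (auto simp: N1 N2 F1_def F2_def)
  have S: "multigraph ?S"
    unfolding series_connection_def using G x y
    by (intro multigraph_add_edge multigraph_identify multigraph_graph_union multigraph_delete_edge)
      (auto simp: identify_def graph_union_def delete_edge_def)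
  have E: "edges ?S = insert e (F1 \<union> F2)" "e \<notin> F1 \<union> F2"
    using e by (auto simp: series_connection_def add_edge_def delete_edge_def identify_def graph_union_def F1_def F2_def)
  have "ends ?S = (\<lambda>f. ?m ` N f)"
    by (auto simp: series_connection_def add_edge_def identify_def N_def fun_eq_iff)
  then have "spanning_tree_poly ?S z = forest_poly (\<lambda>f. ?m ` N f) {} (edges ?S) z"
    by (simp add: spanning_tree_poly_eq_forest_poly[OF S])
  also have "\<dots> = forest_poly N {(x1, x2)} (edges ?S) z"
    using forest_poly_identify[of x1 x2 N "{}"] by simp
  finally have T: "spanning_tree_poly ?S z = forest_poly N {(x1, x2)} (insert e (F1 \<union> F2)) z"
    unfolding E(1) .
  have c: "forest_poly N {} F1 z = deleted_poly G1 e1 z" "forest_poly N {} F2 z = deleted_poly G2 e2 z"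
    "forest_poly N {(x1, y1)} F1 z = contracted_poly G1 e1 x1 y1 z"
    "forest_poly N {(x2, y2)} F2 z = contracted_poly G2 e2 x2 y2 z"
    unfolding deleted_poly_def contracted_poly_def F1_def[symmetric] F2_def[symmetric]
    by (rule forest_poly_cong_ends; simp add: N1 N2)+
  have "conn N {} F1 = conn (ends G1) {} F1" "conn N {} F2 = conn (ends G2) {} F2"
    by (rule conn_cong_ends; simp add: N1 N2)+
  then have b: "bridge G1 e1 x1 y1 \<longleftrightarrow> (x1, y1) \<notin> conn N {} F1" "bridge G2 e2 x2 y2 \<longleftrightarrow> (x2, y2) \<notin> conn N {} F2"
    by (simp_all add: bridge_def F1_def F2_def)
  have e': "N e = {y1, y2}" by (simp add: N_def)
  have across: "(y1, y2) \<in> conn N {(x1, x2)} (F1 \<union> F2) \<longleftrightarrow> \<not> bridge G1 e1 x1 y1 \<and> \<not> bridge G2 e2 x2 y2"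
    using conn_across[of F1 F2] b by simp
  have loop: "(y1, y2) \<in> conn N {(x1, x2)} {} \<longleftrightarrow> x1 = y1 \<and> x2 = y2"
    using conn_across[of "{}" "{}"] by simp
  show ?thesis
  proof (cases "x1 = y1 \<and> x2 = y2")
    case True
    then show ?thesis
      using forest_poly_loop[where N = N, OF E(2) e'] loop glue_poly b unfolding T by (simp add: c)
  next
    case False
    then have n: "(y1, y2) \<notin> conn N {(x1, x2)} {}" using loop by simp
    have "forest_poly N {(y1, y2), (x1, x2)} (F1 \<union> F2) z =
        (if bridge G1 e1 x1 y1 \<or> bridge G2 e2 x2 y2 then deleted_poly G1 e1 z * deleted_poly G2 e2 z
         else deleted_poly G1 e1 z * (if x2 = y2 then 0 else contracted_poly G2 e2 x2 y2 z) +
         (if x1 = y1 then 0 else contracted_poly G1 e1 x1 y1 z) * deleted_poly G2 e2 z)"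
    proof (cases "bridge G1 e1 x1 y1 \<or> bridge G2 e2 x2 y2")
      case True
      then have "(y1, y2) \<notin> conn N {(x1, x2)} (F1 \<union> F2)" using across by blast
      from forest_poly_bridge[OF two_union this] True show ?thesis by (simp add: glue_poly c)
    next
      case nb: False
      then have "(x1, y1) \<in> conn N {} F1" "(x2, y2) \<in> conn N {} F2" using b by auto
      from series_poly[OF this] nb False show ?thesis by (simp add: c insert_commute)
    qed
    then show ?thesis
      using forest_poly_insert[where N = N, OF E(2) e' _ two_union n] fin across glue_poly
      unfolding T by (auto simp: c)
  qed
qed

section \<open>Vertex elimination\<close>

definition vdeg :: "('v \<Rightarrow> 'v \<Rightarrow> real) \<Rightarrow> 'v list \<Rightarrow> 'v \<Rightarrow> real" where
  "vdeg w vs v = (\<Sum>i\<in>set vs. w i v)"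

text \<open>One step of Gaussian elimination on the weighted Laplacian: the Schur complement at
  \<open>v\<close> is the Laplacian with these weights.\<close>

definition eliminate :: "('v \<Rightarrow> 'v \<Rightarrow> real) \<Rightarrow> 'v list \<Rightarrow> 'v \<Rightarrow> 'v \<Rightarrow> 'v \<Rightarrow> real" where
  "eliminate w vs v = (\<lambda>i j. w i j + w i v * w j v / vdeg w vs v)"

text \<open>The product of the pivots, i.e. the determinant of the Laplacian without the row and
  column of the last vertex, so by the matrix-tree theorem the tree polynomial.\<close>

primrec tau :: "'v list \<Rightarrow> ('v \<Rightarrow> 'v \<Rightarrow> real) \<Rightarrow> real" where
  "tau [] w = 1"
| "tau (v # vs) w = (if vs = [] then 1 else vdeg w vs v * tau vs (eliminate w vs v))"

definition network :: "'v list \<Rightarrow> ('v \<Rightarrow> 'v \<Rightarrow> real) \<Rightarrow> bool" where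
  "network vs w \<longleftrightarrow> distinct vs \<and> (\<forall>i j. w i j = w j i) \<and>
     (\<forall>i\<in>set vs. \<forall>j\<in>set vs. i \<noteq> j \<longrightarrow> 0 < w i j)"

lemma network_sym: "network vs w \<Longrightarrow> w i j = w j i"
  by (simp add: network_def)

lemma network_set: "network vs w \<Longrightarrow> set vs' = set vs \<Longrightarrow> distinct vs' \<Longrightarrow> network vs' w"
  by (simp add: network_def)

lemma vdeg_pos: "network (v # vs) w \<Longrightarrow> vs \<noteq> [] \<Longrightarrow> 0 < vdeg w vs v"
  unfolding vdeg_def by (intro sum_pos) (auto simp: network_def)

lemma network_eliminate:
  assumes "network (v # vs) w" "vs \<noteq> []" shows "network vs (eliminate w vs v)"
proof -
  have "0 < eliminate w vs v i j" if "i \<in> set vs" "j \<in> set vs" "i \<noteq> j" for i j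
  proof -
    have "0 < w i j" "0 < w i v" "0 < w j v" using assms(1) that by (auto simp: network_def)
    then show ?thesis using vdeg_pos[OF assms] by (simp add: eliminate_def add_pos_pos)
  qed
  then show ?thesis using assms(1) by (simp add: network_def eliminate_def mult.commute)
qed

lemma tau_pos: "network vs w \<Longrightarrow> 0 < tau vs w"
  by (induction vs arbitrary: w) (auto intro!: mult_pos_pos vdeg_pos network_eliminate)

lemma vdeg_set: "set vs = set vs' \<Longrightarrow> vdeg w vs v = vdeg w vs' v"
  by (simp add: vdeg_def)

lemma eliminate_set: "set vs = set vs' \<Longrightarrow> eliminate w vs v = eliminate w vs' v"
  by (simp add: eliminate_def vdeg_set[of vs vs'])

lemma tau_cong:
  assumes "distinct vs" "\<And>i j. i \<in> set vs \<Longrightarrow> j \<in> set vs \<Longrightarrow> i \<noteq> j \<Longrightarrow> w i j = w' i j"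
  shows "tau vs w = tau vs w'"
  using assms
proof (induction vs arbitrary: w w')
  case (Cons v vs)
  have v: "v \<notin> set vs" using Cons.prems(1) by simp
  then have 1: "w i v = w' i v" if "i \<in> set vs" for i using Cons.prems(2) that by auto
  then have 2: "vdeg w vs v = vdeg w' vs v" unfolding vdeg_def by (intro sum.cong) auto
  have "tau vs (eliminate w vs v) = tau vs (eliminate w' vs v)"
    using Cons.prems 1 2 by (intro Cons.IH) (auto simp: eliminate_def)
  then show ?case using 2 by simp
qed simp

text \<open>Two successive eliminations amount to inverting the 2 by 2 block with diagonal c + A, c
  + B and off-diagonal -c. The right-hand side is invariant under exchanging A with B, p with r and
  q with t, i.e. the two eliminated vertices.\<close>

lemma elimination_identity:
  fixes A B c p q r t :: real
  assumes "0 < A" "0 < B" "0 < c"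
  shows "p * q / (c + A) + (r + p * c / (c + A)) * (t + q * c / (c + A)) / (B + c * A / (c + A)) =
    (p * q * (c + B) + r * t * (c + A) + c * (p * t + r * q)) / (A * B + A * c + B * c)"
proof -
  have 1: "B + c * A / (c + A) = (A * B + A * c + B * c) / (c + A)"
    using assms by (simp add: field_simps)
  have 2: "0 < A * B + A * c + B * c" "0 < c + A" using assms by (simp_all add: add_pos_pos)
  have 3: "r + p * c / (c + A) = (r * (c + A) + p * c) / (c + A)" "t + q * c / (c + A) = (t * (c + A) + q * c) / (c + A)"
    using 2 by (simp_all add: field_simps)
  define P where "P = A * B + A * c + B * c"
  define s where "s = c + A"
  have P: "P \<noteq> 0" "s \<noteq> 0" using 2 by (auto simp: P_def s_def)
  have 4: "P + c * c = s * (c + B)" by (simp add: P_def s_def algebra_simps)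
  have "p * q / s + ((r * s + p * c) / s) * ((t * s + q * c) / s) / (P / s) =
      (p * q * P + (r * s + p * c) * (t * s + q * c)) / (s * P)"
    using P by (simp add: field_simps)
  also have "p * q * P + (r * s + p * c) * (t * s + q * c) = p * q * (P + c * c) + r * t * s * s + c * s * (p * t + r * q)"
    by (simp add: algebra_simps)
  also have "\<dots> = s * (p * q * (c + B) + r * t * s + c * (p * t + r * q))"
    unfolding 4 by (simp add: algebra_simps)
  also have "\<dots> / (s * P) = (p * q * (c + B) + r * t * s + c * (p * t + r * q)) / P"
    using P by simp
  finally show ?thesis unfolding 1 3 P_def s_def .
qed

lemma tau_swap:
  assumes n: "network (u # v # vs) w"
  shows "tau (u # v # vs) w = tau (v # u # vs) w"
proof (cases "vs = []")
  case True
  then show ?thesis using network_sym[OF n, of u v] by (simp add: vdeg_def)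
next
  case False
  define c where "c = w u v"
  define A where "A = vdeg w vs u"
  define B where "B = vdeg w vs v"
  have d: "u \<noteq> v" "u \<notin> set vs" "v \<notin> set vs" "distinct vs" using n by (auto simp: network_def)
  have cvu: "w v u = c" using network_sym[OF n] by (simp add: c_def)
  have "network (u # vs) w" "network (v # vs) w" using n by (auto simp: network_def)
  from vdeg_pos[OF this(1) False] vdeg_pos[OF this(2) False] have AB: "0 < A" "0 < B" by (simp_all add: A_def B_def)
  have c: "0 < c" using n d by (auto simp: network_def c_def)
  have su: "vdeg w (v # vs) u = c + A" using d by (simp add: vdeg_def A_def cvu)
  have sv: "vdeg w (u # vs) v = c + B" using d by (simp add: vdeg_def B_def c_def)
  have s'v: "vdeg (eliminate w (v # vs) u) vs v = B + c * A / (c + A)"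
    unfolding vdeg_def[of "eliminate w (v # vs) u"] eliminate_def su cvu
    by (simp add: sum.distrib B_def A_def vdeg_def sum_divide_distrib[symmetric] sum_distrib_left[symmetric] sum_distrib_right[symmetric] mult.commute cvu)
  have s'u: "vdeg (eliminate w (u # vs) v) vs u = A + c * B / (c + B)"
    unfolding vdeg_def[of "eliminate w (u # vs) v"] eliminate_def sv c_def[symmetric]
    by (simp add: sum.distrib B_def A_def vdeg_def sum_divide_distrib[symmetric] sum_distrib_left[symmetric] sum_distrib_right[symmetric] mult.commute c_def)
  have "eliminate (eliminate w (v # vs) u) vs v = eliminate (eliminate w (u # vs) v) vs u"
  proof (intro ext)
    fix i j
    have "eliminate (eliminate w (v # vs) u) vs v i j = w i j + (w i u * w j u / (c + A) +
        (w i v + w i u * c / (c + A)) * (w j v + w j u * c / (c + A)) / (B + c * A / (c + A)))"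
      unfolding eliminate_def[of "eliminate w (v # vs) u"] s'v unfolding eliminate_def su by (simp add: cvu)
    moreover have "eliminate (eliminate w (u # vs) v) vs u i j = w i j + (w i v * w j v / (c + B) +
        (w i u + w i v * c / (c + B)) * (w j u + w j v * c / (c + B)) / (A + c * B / (c + B)))"
      unfolding eliminate_def[of "eliminate w (u # vs) v"] s'u unfolding eliminate_def sv by (simp add: c_def)
    ultimately show "eliminate (eliminate w (v # vs) u) vs v i j = eliminate (eliminate w (u # vs) v) vs u i j"
      unfolding elimination_identity[OF AB c] elimination_identity[OF AB(2,1) c]
      by (simp add: algebra_simps)
  qed
  \<comment> \<open>Both products of pivots equal the block determinant A B + A c + B c.\<close>
  moreover have "(c + A) * (B + c * A / (c + A)) = (c + B) * (A + c * B / (c + B))"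
    using AB c by (simp add: distrib_left) (simp add: algebra_simps)
  ultimately show ?thesis using False by (simp add: su sv s'v s'u flip: mult.assoc)
qed

lemma tau_move:
  "network (xs @ y # zs) w \<Longrightarrow> tau (xs @ y # zs) w = tau (y # xs @ zs) w"
proof (induction xs arbitrary: w)
  case (Cons x xs)
  have n: "network (xs @ y # zs) (eliminate w (xs @ y # zs) x)"
    using Cons.prems by (intro network_eliminate) auto
  have s: "set (xs @ y # zs) = set (y # xs @ zs)" by auto
  have "tau ((x # xs) @ y # zs) w = vdeg w (xs @ y # zs) x * tau (y # xs @ zs) (eliminate w (xs @ y # zs) x)"
    using Cons.IH[OF n] by (simp del: tau.simps(2) add: tau.simps(2)[of x])
  also have "\<dots> = tau (x # y # xs @ zs) w"
    unfolding vdeg_set[OF s] eliminate_set[OF s] by (simp del: tau.simps(2) add: tau.simps(2)[of x])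
  also have "\<dots> = tau (y # x # xs @ zs) w"
    using Cons.prems by (intro tau_swap) (auto simp: network_def)
  finally show ?case by simp
qed simp

lemma tau_permute:
  assumes "network vs w" "distinct vs'" "set vs' = set vs"
  shows "tau vs w = tau vs' w"
  using assms
proof (induction vs arbitrary: vs' w)
  case (Cons v vs)
  have v: "v \<notin> set vs" using Cons.prems(1) by (simp add: network_def)
  obtain xs zs where vs': "vs' = xs @ v # zs" using Cons.prems(3) by (metis list.set_intros(1) split_list)
  have d: "distinct (xs @ zs)" and s: "set (xs @ zs) = set vs"
    using Cons.prems v vs' by auto
  have "tau vs' w = tau (v # xs @ zs) w"
    unfolding vs' by (rule tau_move, rule network_set[OF Cons.prems(1)]) (use Cons.prems vs' in auto)
  also have "\<dots> = tau (v # vs) w"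
  proof (cases "vs = []")
    case True
    then show ?thesis using s by simp
  next
    case False
    then have ne: "xs @ zs \<noteq> []" using s by auto
    show ?thesis
      using Cons.IH[OF network_eliminate[OF Cons.prems(1) False] d s]
      unfolding tau.simps(2) vdeg_set[OF s] eliminate_set[OF s] if_not_P[OF ne] if_not_P[OF False] by simp
  qed
  finally show ?case by simp
qed simp

text \<open>Contraction of the last two vertices: \<open>m\<close> are the weights after merging \<open>j\<close> into \<open>i\<close>.\<close>

lemma tau_contract:
  assumes "distinct (vs @ [i, j])"
    and "\<And>k l. k \<in> set (vs @ [i, j]) \<Longrightarrow> l \<in> set (vs @ [i, j]) \<Longrightarrow> k \<noteq> l \<Longrightarrow>
      w' k l = w k l + (if {k, l} = {i, j} then t else 0)"
    and "\<And>k. k \<in> set vs \<Longrightarrow> m k i = w k i + w k j" "\<And>k. k \<in> set vs \<Longrightarrow> m i k = w i k + w j k"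
    and "\<And>k l. k \<in> set vs \<Longrightarrow> l \<in> set vs \<Longrightarrow> k \<noteq> l \<Longrightarrow> m k l = w k l"
  shows "tau (vs @ [i, j]) w' = tau (vs @ [i, j]) w + t * tau (vs @ [i]) m"
  using assms
proof (induction vs arbitrary: w w' m)
  case Nil
  then show ?case by (simp add: vdeg_def insert_commute)
next
  case (Cons v vs)
  have d: "v \<notin> set vs" "v \<noteq> i" "v \<noteq> j" "i \<noteq> j" "i \<notin> set vs" "j \<notin> set vs" using Cons.prems(1) by auto
  have wv: "w' k v = w k v" if "k \<in> set (vs @ [i, j])" for k
    using Cons.prems(2)[of k v] that d by (auto simp: doubleton_eq_iff)
  have mv: "m k v = w k v" if "k \<in> set vs" for k using Cons.prems(5)[of k v] that d by auto
  have miv: "m i v = w i v + w j v" using Cons.prems(4) by simp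
  have s': "vdeg w' (vs @ [i, j]) v = vdeg w (vs @ [i, j]) v"
    unfolding vdeg_def by (rule sum.cong) (use wv in auto)
  have "vdeg m (vs @ [i]) v = m i v + (\<Sum>k\<in>set vs. m k v)" using d by (simp add: vdeg_def)
  also have "(\<Sum>k\<in>set vs. m k v) = (\<Sum>k\<in>set vs. w k v)" by (rule sum.cong) (use mv in auto)
  finally have sm: "vdeg m (vs @ [i]) v = vdeg w (vs @ [i, j]) v" using d by (simp add: vdeg_def miv)
  \<comment> \<open>Eliminating \<open>v\<close> commutes with adding \<open>t\<close> to the weight
    between \<open>i\<close> and \<open>j\<close> and with merging \<open>j\<close> into
    \<open>i\<close>, and all three networks have the same pivot at \<open>v\<close>.\<close>
  have "tau (vs @ [i, j]) (eliminate w' (vs @ [i, j]) v) =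
      tau (vs @ [i, j]) (eliminate w (vs @ [i, j]) v) + t * tau (vs @ [i]) (eliminate m (vs @ [i]) v)"
  proof (rule Cons.IH)
    show "eliminate w' (vs @ [i, j]) v k l = eliminate w (vs @ [i, j]) v k l + (if {k, l} = {i, j} then t else 0)"
      if "k \<in> set (vs @ [i, j])" "l \<in> set (vs @ [i, j])" "k \<noteq> l" for k l
      unfolding eliminate_def s' wv[OF that(1)] wv[OF that(2)] using Cons.prems(2)[of k l] that by auto
    show "eliminate m (vs @ [i]) v k i = eliminate w (vs @ [i, j]) v k i + eliminate w (vs @ [i, j]) v k j"
      if "k \<in> set vs" for k
      unfolding eliminate_def sm miv mv[OF that] using Cons.prems(3)[of k] that
      by (simp add: distrib_left add_divide_distrib)
    show "eliminate m (vs @ [i]) v i k = eliminate w (vs @ [i, j]) v i k + eliminate w (vs @ [i, j]) v j k"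
      if "k \<in> set vs" for k
      unfolding eliminate_def sm miv mv[OF that] using Cons.prems(4)[of k] that
      by (simp add: distrib_right add_divide_distrib)
    show "eliminate m (vs @ [i]) v k l = eliminate w (vs @ [i, j]) v k l"
      if "k \<in> set vs" "l \<in> set vs" "k \<noteq> l" for k l
      unfolding eliminate_def sm mv[OF that(1)] mv[OF that(2)] using Cons.prems(5)[of k l] that by simp
  qed (use Cons.prems(1) in auto)
  then show ?case by (simp add: s' sm distrib_left)
qed

lemma tau_scale:
  assumes "c \<noteq> 0" shows "tau vs (\<lambda>i j. c * w i j) = c ^ (length vs - 1) * tau vs w"
proof (induction vs arbitrary: w)
  case (Cons v vs)
  have v: "vdeg (\<lambda>i j. c * w i j) vs v = c * vdeg w vs v" by (simp add: vdeg_def sum_distrib_left)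
  have e: "eliminate (\<lambda>i j. c * w i j) vs v = (\<lambda>i j. c * eliminate w vs v i j)"
    unfolding eliminate_def v using assms by (intro ext) (simp add: distrib_left)
  show ?case
  proof (cases "vs = []")
    case False
    then have "length (v # vs) - 1 = Suc (length vs - 1)" by (cases vs) auto
    then show ?thesis unfolding tau.simps(2) if_not_P[OF False] v e Cons.IH by (simp only: power_Suc mult_ac)
  qed simp
qed simp

section \<open>Spring energies, and restoring eliminated vertices by Gaussian integrals\<close>

definition energy :: "'v list \<Rightarrow> ('v \<Rightarrow> 'v \<Rightarrow> real) \<Rightarrow> ('v \<Rightarrow> nat \<Rightarrow> real) \<Rightarrow> nat \<Rightarrow> real" where
  "energy vs w u d = (\<Sum>i\<in>set vs. \<Sum>j\<in>set vs. w i j * (\<Sum>k<d. (u i k - u j k)\<^sup>2)) / 2"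

lemma energy_Cons:
  assumes n: "network (v # vs) w"
  shows "energy (v # vs) w u d = energy vs w u d + (\<Sum>i\<in>set vs. w i v * (\<Sum>k<d. (u v k - u i k)\<^sup>2))"
proof -
  have v: "v \<notin> set vs" using n by (simp add: network_def)
  have 1: "(\<Sum>j\<in>set vs. w v j * (\<Sum>k<d. (u v k - u j k)\<^sup>2)) = (\<Sum>i\<in>set vs. w i v * (\<Sum>k<d. (u v k - u i k)\<^sup>2))"
    by (simp add: network_sym[OF n, of v])
  have 2: "(\<Sum>i\<in>set vs. w i v * (\<Sum>k<d. (u i k - u v k)\<^sup>2)) = (\<Sum>i\<in>set vs. w i v * (\<Sum>k<d. (u v k - u i k)\<^sup>2))"
    by (simp add: power2_commute)
  show ?thesis unfolding energy_def using v by (simp add: sum.distrib 1 2 add_divide_distrib)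
qed

text \<open>The extra term is the exponent left by \<open>fdcm_gaussian_multi\<close>: integrating
  out the position of \<open>v\<close> replaces its star of springs by the mesh.\<close>

lemma energy_eliminate:
  "energy vs (eliminate w vs v) u d = energy vs w u d +
    (\<Sum>i\<in>set vs. \<Sum>j\<in>set vs. w i v * w j v * (\<Sum>k<d. (u i k - u j k)\<^sup>2)) / (2 * vdeg w vs v)"
proof -
  have "(\<Sum>i\<in>set vs. \<Sum>j\<in>set vs. eliminate w vs v i j * (\<Sum>k<d. (u i k - u j k)\<^sup>2)) =
      (\<Sum>i\<in>set vs. \<Sum>j\<in>set vs. w i j * (\<Sum>k<d. (u i k - u j k)\<^sup>2)) +
      (\<Sum>i\<in>set vs. \<Sum>j\<in>set vs. w i v * w j v * (\<Sum>k<d. (u i k - u j k)\<^sup>2)) / vdeg w vs v"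
    unfolding eliminate_def by (simp add: distrib_right sum.distrib sum_divide_distrib)
  then show ?thesis unfolding energy_def by (simp add: add_divide_distrib mult.commute)
qed

text \<open>
  \<open>D n\<close> is the dimension of the Euclidean space in which the points attached to the last \<open>n\<close>
  vertices live: constant for half-integral \<open>\<beta>\<close>, and \<open>n - 1\<close> for large \<open>\<beta>\<close>.
\<close>

lemma fdcm_tau:
  assumes "vs \<noteq> []" and net: "\<And>x. pos_fun x \<Longrightarrow> network vs (W x)"
    and D: "\<And>n. 1 \<le> n \<Longrightarrow> n < length vs \<Longrightarrow> real (D n) / 2 \<le> \<beta> \<and>
      (D (Suc n) = Suc (D n) \<or> D (Suc n) = D n \<and> \<beta> = real (D n) / 2)"
    and fd: "\<And>u. fdcm (\<lambda>x. c x * exp (- energy vs (W x) u (D (length vs))))"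
  shows "fdcm (\<lambda>x. c x * tau vs (W x) powr - \<beta>)"
  using assms
proof (induction vs arbitrary: c W)
  case (Cons v vs)
  show ?case
  proof (cases "vs = []")
    case True
    have "energy [v] (W x) u d = 0" for x u d by (simp add: energy_def)
    then show ?thesis using Cons.prems(4) True by simp
  next
    case False
    define d where "d = D (length vs)"
    define s where "s x = vdeg (W x) vs v" for x
    have net: "network (v # vs) (W x)" if "pos_fun x" for x using Cons.prems(2) that by simp
    have s: "0 < s x" if "pos_fun x" for x unfolding s_def by (rule vdeg_pos[OF net[OF that] False])
    have v: "v \<notin> set vs" using net[of "\<lambda>_. 1"] by (simp add: network_def pos_fun_def)
    have dim: "real d / 2 \<le> \<beta>" "D (length (v # vs)) = Suc d \<or> D (length (v # vs)) = d \<and> \<beta> = real d / 2"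
      using Cons.prems(3)[of "length vs"] False by (auto simp: d_def Suc_le_eq)
    have nn: "0 \<le> \<beta> - real d / 2" using dim(1) by simp
    \<comment> \<open>The pivot at \<open>v\<close> moves into the prefactor, which is why
      \<open>c\<close> is arbitrary in the induction.\<close>
    have "fdcm (\<lambda>x. (c x * s x powr - \<beta>) * tau vs (eliminate (W x) vs v) powr - \<beta>)"
    proof (rule Cons.IH[OF False])
      show "network vs (eliminate (W x) vs v)" if "pos_fun x" for x
        by (rule network_eliminate[OF net[OF that] False])
      fix u :: "'a \<Rightarrow> nat \<Rightarrow> real"
      define q where "q z x = (\<Sum>i\<in>set vs. W x i v * (\<Sum>k<d. (z k - u i k)\<^sup>2))" for z x
      have "fdcm (\<lambda>x. (c x * exp (- energy vs (W x) u d) * s x powr - (\<beta> - real d / 2)) *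
          ((\<Sum>i\<in>set vs. W x i v) powr - (real d / 2) *
           exp (- ((\<Sum>i\<in>set vs. \<Sum>j\<in>set vs. W x i v * W x j v * (\<Sum>k<d. (u i k - u j k)\<^sup>2)) /
             (2 * (\<Sum>i\<in>set vs. W x i v))))))"
      proof (rule fdcm_gaussian_multi)
        show "0 < W x i v" if "i \<in> set vs" "pos_fun x" for i x
          using net[OF that(2)] that(1) v by (auto simp: network_def)
        fix z :: "nat \<Rightarrow> real"
        \<comment> \<open>Integration over \<open>z\<close> will supply s^(-d/2); the rest of
          s^(-\<beta>) must be present under the integral.\<close>
        have "fdcm (\<lambda>x. (c x * exp (- energy vs (W x) u d) * exp (- q z x)) * s x powr - (\<beta> - real d / 2))"
          using dim(2)
        proof
          assume D': "D (length (v # vs)) = Suc d"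
          show ?thesis
          proof (rule fdcm_laplace_powr[OF _ s])
            fix t :: real assume t: "0 \<le> t"
            \<comment> \<open>The old points stay at height 0 in the new coordinate and
              \<open>v\<close> is lifted to height \<open>sqrt t\<close>, so each spring at
              \<open>v\<close> gains \<open>t\<close> and the energy gains
              \<open>t * s x\<close>.\<close>
            define u' where "u' i = (if i = v then z(d := sqrt t) else (u i)(d := 0))" for i
            have e: "energy (v # vs) (W x) u' (Suc d) = energy vs (W x) u d + q z x + t * s x"
              if "pos_fun x" for x
            proof -
              have 1: "(\<Sum>k<Suc d. (u' i k - u' j k)\<^sup>2) = (\<Sum>k<d. (u i k - u j k)\<^sup>2)"
                if "i \<in> set vs" "j \<in> set vs" for i j
                using that v by (auto simp: u'_def intro!: sum.cong)
              have 2: "(\<Sum>k<Suc d. (u' v k - u' i k)\<^sup>2) = (\<Sum>k<d. (z k - u i k)\<^sup>2) + t"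
                if "i \<in> set vs" for i
                using that v t by (auto simp: u'_def intro!: sum.cong)
              have "energy vs (W x) u' (Suc d) = energy vs (W x) u d"
                unfolding energy_def using 1 by simp
              moreover have "(\<Sum>i\<in>set vs. W x i v * (\<Sum>k<Suc d. (u' v k - u' i k)\<^sup>2)) = q z x + t * s x"
                using 2 by (simp add: q_def s_def vdeg_def distrib_left sum.distrib sum_distrib_left mult.commute)
              ultimately show ?thesis unfolding energy_Cons[OF net[OF that]] by simp
            qed
            show "fdcm (\<lambda>x. c x * exp (- energy vs (W x) u d) * exp (- q z x) * exp (- (t * s x)))"
            proof (rule fdcm_cong[OF _ Cons.prems(4)[of u']])
              fix x :: "'b \<Rightarrow> real" assume "pos_fun x"
              then show "c x * exp (- energy (v # vs) (W x) u' (D (length (v # vs)))) =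
                  c x * exp (- energy vs (W x) u d) * exp (- q z x) * exp (- (t * s x))"
                unfolding D' e[OF \<open>pos_fun x\<close>] by (simp only: minus_add_distrib exp_add mult.assoc)
            qed
          qed (use nn in auto)
        next
          assume D': "D (length (v # vs)) = d \<and> \<beta> = real d / 2"
          \<comment> \<open>Here the remaining exponent is 0, and \<open>v\<close> is placed at
            \<open>z\<close> without a new coordinate.\<close>
          define u' where "u' i = (if i = v then z else u i)" for i
          show ?thesis
          proof (rule fdcm_cong[OF _ Cons.prems(4)[of u']])
            fix x :: "'b \<Rightarrow> real" assume x: "pos_fun x"
            have u': "u' v = z" "i \<in> set vs \<Longrightarrow> u' i = u i" for i using v by (auto simp: u'_def)
            have e: "energy vs (W x) u' d = energy vs (W x) u d" unfolding energy_def by (simp add: u')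
            have "energy (v # vs) (W x) u' d = energy vs (W x) u d + q z x"
              unfolding energy_Cons[OF net[OF x]] e q_def by (simp add: u')
            then show "c x * exp (- energy (v # vs) (W x) u' (D (length (v # vs)))) =
                c x * exp (- energy vs (W x) u d) * exp (- q z x) * s x powr - (\<beta> - real d / 2)"
              using s[OF x] unfolding conjunct1[OF D'] conjunct2[OF D']
              by (simp add: exp_add[symmetric] mult.assoc)
          qed
        qed
        then show "fdcm (\<lambda>x. (c x * exp (- energy vs (W x) u d) * s x powr - (\<beta> - real d / 2)) *
            exp (- (\<Sum>i\<in>set vs. W x i v * (\<Sum>k<d. (z k - u i k)\<^sup>2))))"
          unfolding q_def by (simp only: mult_ac)
      qed (use False in auto)
      then show "fdcm (\<lambda>x. c x * s x powr - \<beta> * exp (- energy vs (eliminate (W x) vs v) u (D (length vs))))"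
      proof (rule fdcm_cong[rotated])
        fix x :: "'b \<Rightarrow> real" assume x: "pos_fun x"
        have 1: "s x powr - (\<beta> - real d / 2) * s x powr - (real d / 2) = s x powr - \<beta>"
          by (simp flip: powr_add)
        show "c x * exp (- energy vs (W x) u d) * s x powr - (\<beta> - real d / 2) *
          ((\<Sum>i\<in>set vs. W x i v) powr - (real d / 2) *
           exp (- ((\<Sum>i\<in>set vs. \<Sum>j\<in>set vs. W x i v * W x j v * (\<Sum>k<d. (u i k - u j k)\<^sup>2)) /
             (2 * (\<Sum>i\<in>set vs. W x i v))))) =
          c x * s x powr - \<beta> * exp (- energy vs (eliminate (W x) vs v) u (D (length vs)))"
          unfolding energy_eliminate d_def[symmetric] vdeg_def[symmetric] s_def[symmetric] 1[symmetric]
            minus_add_distrib exp_add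
          by (simp only: mult_ac)
      qed
    qed (use Cons.prems(3) in simp)
    then show ?thesis
    proof (rule fdcm_cong[rotated])
      fix x :: "'b \<Rightarrow> real" assume x: "pos_fun x"
      show "c x * s x powr - \<beta> * tau vs (eliminate (W x) vs v) powr - \<beta> = c x * tau (v # vs) (W x) powr - \<beta>"
        using False s[OF x] tau_pos[OF network_eliminate[OF net[OF x] False]]
        by (simp add: s_def powr_mult)
    qed
  qed
qed simp

section \<open>Complete graphs\<close>

text \<open>\<open>r\<close> names the classes of contracted vertices; the sum collects the edges
  that contraction has made parallel.\<close>

definition weight :: "('e \<Rightarrow> 'v set) \<Rightarrow> 'e set \<Rightarrow> ('v \<Rightarrow> 'w) \<Rightarrow> ('e \<Rightarrow> real) \<Rightarrow> 'w \<Rightarrow> 'w \<Rightarrow> real" where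
  "weight N E r x i j = (\<Sum>e | e \<in> E \<and> r ` N e = {i, j}. x e)"

lemma network_weight:
  assumes E: "finite E" and x: "pos_fun x" and vs: "distinct vs"
    and complete: "\<And>i j. i \<in> set vs \<Longrightarrow> j \<in> set vs \<Longrightarrow> i \<noteq> j \<Longrightarrow> \<exists>e\<in>E. r ` N e = {i, j}"
  shows "network vs (weight N E r x)"
proof -
  have "0 < weight N E r x i j" if "i \<in> set vs" "j \<in> set vs" "i \<noteq> j" for i j
    unfolding weight_def using E x complete[OF that] by (intro sum_pos) (auto simp: pos_fun_def)
  then show ?thesis using vs by (simp add: network_def weight_def insert_commute)
qed

lemma weight_upd:
  assumes E: "finite E" "e \<in> E"
  shows "weight N E r (x(e := x e + t)) i j = weight N E r x i j + (if r ` N e = {i, j} then t else 0)"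
proof -
  let ?F = "{f \<in> E. r ` N f = {i, j}}"
  have fin: "finite ?F" using E by simp
  have "(\<Sum>f\<in>?F. (x(e := x e + t)) f) = (\<Sum>f\<in>?F. x f + (if f = e then t else 0))"
    by (rule sum.cong) auto
  also have "\<dots> = (\<Sum>f\<in>?F. x f) + (if e \<in> ?F then t else 0)"
    using fin by (simp add: sum.distrib sum.delta)
  finally show ?thesis using E(2) by (simp add: weight_def)
qed

lemma forest_poly_all_loops:
  assumes "finite E" "two_ends N E" "\<And>e u v. e \<in> E \<Longrightarrow> u \<in> N e \<Longrightarrow> v \<in> N e \<Longrightarrow> (u, v) \<in> conn N R {}"
  shows "forest_poly N R E x = 1"
  using assms
proof (induction E rule: finite_induct)
  case (insert e E)
  obtain a b where ab: "N e = {a, b}" using insert.prems(1) by (auto elim: two_endsE)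
  have "(a, b) \<in> conn N R {}" using insert.prems(2)[of e a b] ab by simp
  then have "forest_poly N R (insert e E) x = forest_poly N R E x"
    by (rule forest_poly_loop[where N = N, OF insert.hyps(2) ab])
  moreover have "forest_poly N R E x = 1"
    using insert.prems two_ends_subset[OF insert.prems(1), of E] by (intro insert.IH) auto
  ultimately show ?case by simp
qed simp

text \<open>The polynomial is affine in \<open>x e\<close> with the contraction as its slope. After
  contraction \<open>e\<close> is a loop, so it may stay in \<open>E\<close>, and the induction in
  \<open>forest_poly_eq_tau\<close> keeps one edge set.\<close>

lemma forest_poly_upd:
  assumes e: "e \<in> E" "N e = {a, b}" and E: "finite E" "two_ends N E" and ab: "(a, b) \<notin> conn N R {}"
  shows "forest_poly N R E (x(e := x e + t)) = forest_poly N R E x + t * forest_poly N (insert (a, b) R) E x"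
proof -
  have E': "insert e (E - {e}) = E" "e \<notin> E - {e}" "finite (E - {e})" "two_ends N (E - {e})"
    using e E two_ends_subset[OF E(2), of "E - {e}"] by auto
  have dep: "forest_poly N R' (E - {e}) (x(e := y)) = forest_poly N R' (E - {e}) x" for R' y
    by (rule forest_poly_depends) auto
  have "(a, b) \<in> conn N (insert (a, b) R) {}" by (simp add: conn_rel)
  from forest_poly_loop[where N = N, OF E'(2) e(2) this, of x]
  have 1: "forest_poly N (insert (a, b) R) (E - {e}) x = forest_poly N (insert (a, b) R) E x" using E'(1) by simp
  show ?thesis
    using forest_poly_insert[where N = N, OF E'(2) e(2) E'(3,4) ab, of x]
      forest_poly_insert[where N = N, OF E'(2) e(2) E'(3,4) ab, of "x(e := x e + t)"]
    unfolding E'(1) dep 1 by (simp add: distrib_right)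
qed

text \<open>An edge not spanned by \<open>R\<close> makes every basis nonempty, so each monomial has
  degree at least 1 and the polynomial tends to 0 with its variables.\<close>

lemma forest_poly_scale_le:
  assumes E: "finite E" and c: "0 < c" "c \<le> 1" and x: "pos_fun x"
    and e: "e \<in> E" "\<not> N e \<times> N e \<subseteq> conn N R {}"
  shows "forest_poly N R E (\<lambda>e. c * x e) \<le> c * forest_poly N R E x"
  unfolding forest_poly_def sum_distrib_left
proof (rule sum_mono)
  fix S assume S: "S \<in> bases N R E"
  then have "S \<noteq> {}" using e unfolding bases_def by blast
  moreover have "finite S" using S E finite_subset unfolding bases_def by blast
  ultimately have "1 \<le> card S" by (simp add: Suc_le_eq card_gt_0_iff)
  then have "c ^ card S \<le> c ^ 1" using c by (intro power_decreasing) auto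
  moreover have "0 \<le> (\<Prod>e\<in>S. x e)" using x by (intro prod_nonneg) (auto simp: pos_fun_def less_imp_le)
  ultimately show "(\<Prod>e\<in>S. c * x e) \<le> c * (\<Prod>e\<in>S. x e)"
    by (simp add: prod.distrib mult_right_mono)
qed

text \<open>
  Both sides have the same slope in every edge variable, by induction on the number of
  vertices, and both tend to 0 as all variables do.
\<close>

lemma forest_poly_eq_tau:
  assumes E: "finite E" "two_ends N E" and V: "\<And>e. e \<in> E \<Longrightarrow> N e \<subseteq> V"
    and vs: "distinct vs" "vs \<noteq> []" "r ` V \<subseteq> set vs"
    and R: "\<And>u v. u \<in> V \<Longrightarrow> v \<in> V \<Longrightarrow> (u, v) \<in> conn N R {} \<longleftrightarrow> r u = r v"
    and complete: "\<And>i j. i \<in> set vs \<Longrightarrow> j \<in> set vs \<Longrightarrow> i \<noteq> j \<Longrightarrow> \<exists>e\<in>E. r ` N e = {i, j}"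
    and x: "pos_fun x"
  shows "forest_poly N R E x = tau vs (weight N E r x)"
  using vs R complete x
proof (induction "length vs" arbitrary: vs r R x)
  case (Suc n)
  note vs = Suc.prems(1-3) and R = Suc.prems(4) and complete = Suc.prems(5)
  show ?case
  proof (cases "n = 0")
    case True
    then obtain v where v: "vs = [v]" using Suc.hyps(2)[symmetric] by (auto simp: length_Suc_conv)
    have "forest_poly N R E x = 1"
    proof (rule forest_poly_all_loops[OF E])
      fix e u w assume "e \<in> E" "u \<in> N e" "w \<in> N e"
      then have "u \<in> V" "w \<in> V" using V by auto
      moreover from this have "r u = v" "r w = v" using vs(3) v by auto
      ultimately show "(u, w) \<in> conn N R {}" using R by simp
    qed
    then show ?thesis by (simp add: v)
  next
    case False
    define Z where "Z x = forest_poly N R E x" for x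
    define T where "T x = tau vs (weight N E r x)" for x
    have net: "network vs (weight N E r x)" if "pos_fun x" for x
      by (rule network_weight[OF E(1) that vs(1)]) (rule complete)
    have slope: "Z (x(e := x e + t)) - T (x(e := x e + t)) = Z x - T x"
      if e: "e \<in> E" and x: "pos_fun x" and t: "0 \<le> t" for e t x
    proof -
      obtain a b where ab: "N e = {a, b}" using E(2) e by (auto elim: two_endsE)
      have abV: "a \<in> V" "b \<in> V" using V[OF e] ab by auto
      define i where "i = r a"
      define j where "j = r b"
      have ij: "i \<in> set vs" "j \<in> set vs" using vs(3) abV by (auto simp: i_def j_def)
      have x': "pos_fun (x(e := x e + t))" using x t by (auto simp: pos_fun_def add_pos_nonneg)
      have rN: "r ` N e = {i, j}" by (simp add: ab i_def j_def)
      show ?thesis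
      proof (cases "i = j")
        case True
        have "(a, b) \<in> conn N R {}" using R[OF abV] True by (simp add: i_def j_def)
        then have *: "forest_poly N R E y = forest_poly N R (E - {e}) y" for y
          using forest_poly_loop[where N = N and E = "E - {e}" and e = e, OF _ ab, of R y] e by (simp add: insert_absorb)
        have "Z (x(e := x e + t)) = Z x" unfolding Z_def * by (rule forest_poly_depends) auto
        moreover have "T (x(e := x e + t)) = T x"
          unfolding T_def weight_upd[OF E(1) e, abs_def] rN
          by (rule tau_cong[OF vs(1)]) (use True in auto)
        ultimately show ?thesis by simp
      next
        case ne: False
        \<comment> \<open>\<open>tau_contract\<close> wants \<open>i\<close> and \<open>j\<close> at
          the end of the list; \<open>tau_permute\<close> allows the reordering.\<close>
        define rest where "rest = filter (\<lambda>v. v \<noteq> i \<and> v \<noteq> j) vs"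
        define r' where "r' v = (if r v = j then i else r v)" for v
        have ds: "distinct (rest @ [i, j])" "set (rest @ [i, j]) = set vs"
          using vs(1) ij ne by (auto simp: rest_def)
        have di: "distinct (rest @ [i])" and ri: "i \<notin> set rest" "j \<notin> set rest" using ds(1) by auto
        have len: "length vs = Suc (length (rest @ [i]))"
          using distinct_card[OF vs(1)] distinct_card[OF ds(1)] ds(2) by simp
        have nab: "(a, b) \<notin> conn N R {}" using R[OF abV] ne by (simp add: i_def j_def)
        have Zs: "Z (x(e := x e + t)) = Z x + t * forest_poly N (insert (a, b) R) E x"
          unfolding Z_def by (rule forest_poly_upd[where N = N, OF e ab E nab])
        have "forest_poly N (insert (a, b) R) E x = tau (rest @ [i]) (weight N E r' x)"
        proof (rule Suc.hyps(1))
          show "n = length (rest @ [i])" using Suc.hyps(2) len by simp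
          show "r' ` V \<subseteq> set (rest @ [i])" using vs(3) ij by (auto simp: r'_def rest_def)
          show "(u, v) \<in> conn N (insert (a, b) R) {} \<longleftrightarrow> r' u = r' v" if uv: "u \<in> V" "v \<in> V" for u v
          proof
            assume "(u, v) \<in> conn N (insert (a, b) R) {}"
            from conn_insert_cases[OF this] show "r' u = r' v"
              using R abV uv by (auto simp: r'_def i_def j_def)
          next
            assume eq: "r' u = r' v"
            let ?C = "conn N (insert (a, b) R) {}"
            have ab': "(a, b) \<in> ?C" by (simp add: conn_rel)
            have inC: "(u, v) \<in> ?C" if "r u = r v" "u \<in> V" "v \<in> V" for u v
              using R[OF that(2,3)] that(1) conn_insert_subset[of N R "{}" "(a, b)"] by blast
            consider "r u = r v" | "r u = j" "r v = i" | "r u = i" "r v = j"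
              using eq by (auto simp: r'_def split: if_splits)
            then show "(u, v) \<in> ?C"
            proof cases
              case 1 then show ?thesis using inC uv by blast
            next
              case 2
              then have "(u, b) \<in> ?C" "(a, v) \<in> ?C" using inC uv abV by (auto simp: i_def j_def)
              then show ?thesis using conn_trans[OF _ conn_trans[OF conn_sym[OF ab']]] by blast
            next
              case 3
              then have "(u, a) \<in> ?C" "(b, v) \<in> ?C" using inC uv abV by (auto simp: i_def j_def)
              then show ?thesis using conn_trans[OF _ conn_trans[OF ab']] by blast
            qed
          qed
          show "\<exists>e\<in>E. r' ` N e = {k, l}" if kl: "k \<in> set (rest @ [i])" "l \<in> set (rest @ [i])" "k \<noteq> l" for k l
          proof -
            have "k \<in> set vs" "l \<in> set vs" "k \<noteq> j" "l \<noteq> j" using kl(1,2) ds ri ne by auto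
            then obtain f where f: "f \<in> E" "r ` N f = {k, l}" using complete kl(3) by blast
            have "r' ` N f = (\<lambda>w. if w = j then i else w) ` (r ` N f)" by (auto simp: r'_def image_image)
            also have "\<dots> = {k, l}" unfolding f(2) using \<open>k \<noteq> j\<close> \<open>l \<noteq> j\<close> by auto
            finally show ?thesis using f(1) by blast
          qed
        qed (use di x in auto)
        moreover have "T (x(e := x e + t)) = T x + t * tau (rest @ [i]) (weight N E r' x)"
        proof -
          have r'N: "r' ` N f = (\<lambda>w. if w = j then i else w) ` (r ` N f)" for f
            by (auto simp: r'_def image_image)
          have two: "\<exists>c d. r ` N f = {c, d}" if "f \<in> E" for f
            using E(2) that by (force simp: two_ends_def)
          have split: "weight N E r' x k i = weight N E r x k i + weight N E r x k j" if k: "k \<in> set rest" for k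
          proof -
            have kij: "k \<noteq> i" "k \<noteq> j" using k ri by auto
            have "{f \<in> E. r' ` N f = {k, i}} = {f \<in> E. r ` N f = {k, i}} \<union> {f \<in> E. r ` N f = {k, j}}"
            proof (intro set_eqI)
              fix f
              show "f \<in> {f \<in> E. r' ` N f = {k, i}} \<longleftrightarrow> f \<in> {f \<in> E. r ` N f = {k, i}} \<union> {f \<in> E. r ` N f = {k, j}}"
              proof (cases "f \<in> E")
                case True
                from two[OF this] obtain c d where "r ` N f = {c, d}" by blast
                then show ?thesis using kij ne True unfolding mem_Collect_eq Un_iff r'N
                  by (auto simp: doubleton_eq_iff)
              qed auto
            qed
            moreover have "{f \<in> E. r ` N f = {k, i}} \<inter> {f \<in> E. r ` N f = {k, j}} = {}"
              using kij ne by (auto simp: doubleton_eq_iff)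
            ultimately show ?thesis unfolding weight_def using E(1) by (simp add: sum.union_disjoint)
          qed
          have same: "weight N E r' x k l = weight N E r x k l" if kl: "k \<in> set rest" "l \<in> set rest" "k \<noteq> l" for k l
          proof -
            have n: "k \<noteq> i" "k \<noteq> j" "l \<noteq> i" "l \<noteq> j" using kl ri by auto
            have "r' ` N f = {k, l} \<longleftrightarrow> r ` N f = {k, l}" if "f \<in> E" for f
            proof -
              from two[OF that] obtain c d where cd: "r ` N f = {c, d}" by blast
              have "r' ` N f = {if c = j then i else c, if d = j then i else d}" unfolding r'N cd by simp
              then show ?thesis using n unfolding cd doubleton_eq_iff by (cases "c = j"; cases "d = j") auto
            qed
            then show ?thesis unfolding weight_def by (intro sum.cong) auto
          qed
          have sym: "weight N E q x k l = weight N E q x l k" for q k l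
            by (simp add: weight_def insert_commute)
          have "tau (rest @ [i, j]) (weight N E r (x(e := x e + t))) =
              tau (rest @ [i, j]) (weight N E r x) + t * tau (rest @ [i]) (weight N E r' x)"
          proof (rule tau_contract[OF ds(1)])
            show "weight N E r' x i k = weight N E r x i k + weight N E r x j k" if "k \<in> set rest" for k
              using split[OF that] sym[of _ k i] sym[of r k j] by simp
          qed (use split same in \<open>auto simp: weight_upd[OF E(1) e] rN insert_commute\<close>)
          then show ?thesis
            using tau_permute[OF net[OF x] ds] tau_permute[OF net[OF x'] ds] by (simp add: T_def)
        qed
        ultimately show ?thesis using Zs by simp
      qed
    qed
    \<comment> \<open>Equal slopes make the difference constant: change the variables one edge at a
      time.\<close>
    have const: "Z (\<lambda>e. if e \<in> F then x e + h e else x e) - T (\<lambda>e. if e \<in> F then x e + h e else x e) = Z x - T x"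
      if F: "F \<subseteq> E" and x: "pos_fun x" and h: "nonneg_fun h" for F x h
    proof -
      have "finite F" using F E(1) by (rule finite_subset)
      then show ?thesis using F
      proof (induction F rule: finite_induct)
        case (insert e F)
        let ?y = "\<lambda>e. if e \<in> F then x e + h e else x e"
        have "pos_fun ?y" using x h by (auto simp: pos_fun_def nonneg_fun_def add_pos_nonneg)
        moreover have "(\<lambda>f. if f \<in> insert e F then x f + h f else x f) = ?y(e := ?y e + h e)"
          using insert.hyps(2) by auto
        ultimately show ?case using slope[of e ?y "h e"] insert h by (simp add: nonneg_fun_def)
      qed simp
    qed
    \<comment> \<open>The increment \<open>(1 - c) * x\<close> leads from the scaled point back to
      \<open>x\<close>.\<close>
    have scale: "Z (\<lambda>e. c * x e) - T (\<lambda>e. c * x e) = Z x - T x"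
      if c: "0 < c" "c \<le> 1" and x: "pos_fun x" for c x
    proof -
      define y where "y = (\<lambda>e. c * x e)"
      define h where "h = (\<lambda>e. (1 - c) * x e)"
      have y: "pos_fun y" "nonneg_fun h" using c x by (auto simp: y_def h_def pos_fun_def nonneg_fun_def less_imp_le)
      have "Z (\<lambda>e. if e \<in> E then y e + h e else y e) = Z x"
        unfolding Z_def by (rule forest_poly_depends) (simp add: y_def h_def algebra_simps)
      moreover have "weight N E r (\<lambda>e. if e \<in> E then y e + h e else y e) = weight N E r x"
        by (intro ext) (simp add: weight_def y_def h_def algebra_simps)
      ultimately show ?thesis using const[OF subset_refl y] by (simp add: T_def y_def)
    qed
    have xpos: "pos_fun x" by (rule Suc.prems(6))
    obtain i js where vs': "vs = i # js" "js \<noteq> []" using Suc.hyps(2) False by (cases vs) auto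
    then obtain j where j: "i \<in> set vs" "j \<in> set vs" "i \<noteq> j" using vs(1) by (cases js) auto
    obtain e where e: "e \<in> E" "r ` N e = {i, j}" using complete[OF j] by blast
    \<comment> \<open>An edge between two different classes exists because at least two are left; it
      rules out the empty basis.\<close>
    have "\<not> N e \<times> N e \<subseteq> conn N R {}"
    proof
      assume sub: "N e \<times> N e \<subseteq> conn N R {}"
      obtain u v where uv: "u \<in> N e" "v \<in> N e" "r u = i" "r v = j"
        using e(2) by (metis imageE insertI1 insert_iff)
      then show False using sub R[of u v] V[OF e(1)] j(3) by auto
    qed
    note Zle = forest_poly_scale_le[OF E(1) _ _ xpos e(1) this, folded Z_def]
    have Tle: "\<bar>T (\<lambda>e. c * x e)\<bar> \<le> c * T x" if c: "0 < c" "c \<le> 1" for c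
    proof -
      have "weight N E r (\<lambda>e. c * x e) = (\<lambda>i j. c * weight N E r x i j)"
        by (intro ext) (simp add: weight_def sum_distrib_left)
      then have "T (\<lambda>e. c * x e) = c ^ n * T x"
        using tau_scale[of c vs "weight N E r x"] c Suc.hyps(2)[symmetric] by (simp add: T_def)
      moreover have "0 < T x" unfolding T_def by (rule tau_pos[OF net[OF xpos]])
      moreover have "c ^ n \<le> c ^ 1" using c False by (intro power_decreasing) auto
      ultimately show ?thesis using c by (simp add: mult_right_mono)
    qed
    \<comment> \<open>The difference is the same at \<open>x\<close> and at the scaled point, where
      both terms are at most \<open>c\<close> times their values at \<open>x\<close>;
      \<open>c\<close> may be arbitrarily small.\<close>
    have "\<bar>Z x - T x\<bar> \<le> c * (Z x + T x)" if c: "0 < c" "c \<le> 1" for c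
    proof -
      have "0 < Z (\<lambda>e. c * x e)" unfolding Z_def
        by (rule forest_poly_pos[OF E]) (use c xpos in \<open>simp add: pos_fun_def\<close>)
      then show ?thesis using scale[OF c xpos] Zle[OF c] Tle[OF c] by (simp add: distrib_left)
    qed
    then have le: "\<bar>Z x - T x\<bar> \<le> inverse (real (Suc n)) * (Z x + T x)" for n
      by (simp add: inverse_le_1_iff)
    have lim: "(\<lambda>n. inverse (real (Suc n)) * (Z x + T x)) \<longlonglongrightarrow> 0 * (Z x + T x)"
      by (intro tendsto_intros LIMSEQ_inverse_real_of_nat)
    have "\<bar>Z x - T x\<bar> \<le> 0 * (Z x + T x)"
      by (rule LIMSEQ_le_const[OF lim]) (intro exI allI impI le)
    then show ?thesis by (simp add: Z_def T_def)
  qed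
qed simp

section \<open>Closure under the graph operations\<close>

lemma two_ends_complete:
  assumes "complete_graph p G" shows "two_ends (ends G) (edges G)" "finite (edges G)"
    "\<And>e. e \<in> edges G \<Longrightarrow> ends G e \<subseteq> verts G"
proof -
  have G: "multigraph G" using assms by (rule multigraph_generated[OF generated.complete])
  show "two_ends (ends G) (edges G)" using G by (rule two_ends_multigraph)
  show "finite (edges G)" "\<And>e. e \<in> edges G \<Longrightarrow> ends G e \<subseteq> verts G"
    using G by (auto simp: multigraph_def)
qed

lemma fdcm_complete_graph:
  assumes K: "complete_graph p G" and p: "2 \<le> p"
    and \<beta>: "(\<exists>n::nat. \<beta> = real n / 2) \<or> \<beta> \<ge> (real p - 2) / 2"
  shows "fdcm (\<lambda>x. spanning_tree_poly G x powr - \<beta>)"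
proof -
  let ?N = "ends G" and ?E = "edges G"
  note E = two_ends_complete[OF K]
  have G: "multigraph G" using K by (rule multigraph_generated[OF generated.complete])
  obtain vs where vs: "set vs = verts G" "distinct vs"
    using K finite_distinct_list unfolding complete_graph_def by blast
  have len: "length vs = p" using K vs distinct_card[OF vs(2)] by (simp add: complete_graph_def)
  have ne: "vs \<noteq> []" using len p by auto
  have complete: "\<exists>e\<in>?E. id ` ?N e = {i, j}" if "i \<in> set vs" "j \<in> set vs" "i \<noteq> j" for i j
  proof -
    have "{i, j} \<in> {A. A \<subseteq> verts G \<and> card A = 2}" using that vs by auto
    then have "{i, j} \<in> ?N ` ?E" using K unfolding complete_graph_def bij_betw_def by blast
    then show ?thesis by auto
  qed
  have tau: "spanning_tree_poly G x = tau vs (weight ?N ?E id x)" if "pos_fun x" for x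
    unfolding spanning_tree_poly_eq_forest_poly[OF G]
    by (rule forest_poly_eq_tau[OF E(2,1,3) vs(2) ne _ _ complete that]) (use vs in auto)
  have fd: "fdcm (\<lambda>x. 1 * exp (- energy vs (weight ?N ?E id x) u d))" for u d
  proof -
    \<comment> \<open>The energy is a linear form in the edge variables; \<open>q e\<close> is the
      squared length of \<open>e\<close>, halved because both orders of its ends are summed.\<close>
    define q where "q e = (\<Sum>i\<in>set vs. \<Sum>j\<in>set vs. if id ` ?N e = {i, j} then (\<Sum>k<d. (u i k - u j k)\<^sup>2) else 0) / 2" for e
    have q: "0 \<le> q e" for e unfolding q_def by (intro divide_nonneg_pos sum_nonneg) (auto intro!: sum_nonneg)
    have "energy vs (weight ?N ?E id x) u d = (\<Sum>e\<in>?E. q e * x e)" for x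
    proof -
      have "weight ?N ?E id x i j * y = (\<Sum>e\<in>?E. (if id ` ?N e = {i, j} then y else 0) * x e)" for i j y
        unfolding weight_def sum_distrib_right sum.inter_filter[OF E(2)] by (rule sum.cong) auto
      then have "energy vs (weight ?N ?E id x) u d = (\<Sum>i\<in>set vs. \<Sum>j\<in>set vs. \<Sum>e\<in>?E.
          (if id ` ?N e = {i, j} then (\<Sum>k<d. (u i k - u j k)\<^sup>2) else 0) * x e) / 2"
        by (simp add: energy_def)
      also have "\<dots> = (\<Sum>i\<in>set vs. \<Sum>e\<in>?E. \<Sum>j\<in>set vs.
          (if id ` ?N e = {i, j} then (\<Sum>k<d. (u i k - u j k)\<^sup>2) else 0) * x e) / 2"
        by (simp only: sum.swap[of _ ?E "set vs"])
      also have "\<dots> = (\<Sum>e\<in>?E. \<Sum>i\<in>set vs. \<Sum>j\<in>set vs.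
          (if id ` ?N e = {i, j} then (\<Sum>k<d. (u i k - u j k)\<^sup>2) else 0) * x e) / 2"
        by (subst sum.swap) (rule refl)
      also have "\<dots> = (\<Sum>e\<in>?E. q e * x e)"
        unfolding q_def by (simp add: sum_divide_distrib sum_distrib_right)
      finally show ?thesis .
    qed
    then have "1 * exp (- energy vs (weight ?N ?E id x) u d) = (\<Prod>e\<in>?E. exp (- (q e * x e)))" for x
      using E(2) by (simp add: exp_sum[symmetric] sum_negf)
    moreover have "fdcm (\<lambda>x. \<Prod>e\<in>?E. exp (- (q e * x e)))" by (intro fdcm_prod fdcm_exp q)
    ultimately show ?thesis by simp
  qed
  have "fdcm (\<lambda>x. 1 * tau vs (weight ?N ?E id x) powr - \<beta>)"
  proof (cases "\<exists>n::nat. \<beta> = real n / 2")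
    case True
    then obtain n :: nat where "\<beta> = real n / 2" by blast
    then show ?thesis
      by (intro fdcm_tau[where D = "\<lambda>_. n", OF ne network_weight[OF E(2) _ vs(2) complete] _ fd]) auto
  next
    case False
    \<comment> \<open>The largest relevant \<open>k\<close> is p-1, so the condition reads (p-2)/2
      \<le> \<beta>: the origin of the bound.\<close>
    have "real (k - 1) / 2 \<le> \<beta> \<and> (Suc k - 1 = Suc (k - 1) \<or> Suc k - 1 = k - 1 \<and> \<beta> = real (k - 1) / 2)"
      if "1 \<le> k" "k < length vs" for k
      using that len \<beta> False by (auto simp: of_nat_diff field_simps)
    then show ?thesis
      by (intro fdcm_tau[where D = "\<lambda>k. k - 1", OF ne network_weight[OF E(2) _ vs(2) complete] _ fd]) auto
  qed
  then show ?thesis by (rule fdcm_cong[rotated]) (simp add: tau)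
qed

lemma deleted_poly_pos: "multigraph G \<Longrightarrow> pos_fun z \<Longrightarrow> 0 < deleted_poly G e z"
  unfolding deleted_poly_def
  by (rule forest_poly_pos[OF _ two_ends_subset[OF two_ends_multigraph]]) (auto simp: multigraph_def pos_fun_def)

lemma contracted_poly_pos: "multigraph G \<Longrightarrow> pos_fun z \<Longrightarrow> 0 < contracted_poly G e x y z"
  unfolding contracted_poly_def
  by (rule forest_poly_pos[OF _ two_ends_subset[OF two_ends_multigraph]]) (auto simp: multigraph_def pos_fun_def)

lemma spanning_tree_poly_pos: "multigraph G \<Longrightarrow> pos_fun z \<Longrightarrow> 0 < spanning_tree_poly G z"
  unfolding spanning_tree_poly_eq_forest_poly
  by (rule forest_poly_pos[OF _ two_ends_multigraph]) (auto simp: multigraph_def pos_fun_def)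

lemma deleted_poly_upd [simp]: "deleted_poly G e (z(e := t)) = deleted_poly G e z"
  unfolding deleted_poly_def by (rule forest_poly_depends) auto

lemma contracted_poly_upd [simp]: "contracted_poly G e x y (z(e := t)) = contracted_poly G e x y z"
  unfolding contracted_poly_def by (rule forest_poly_depends) auto

lemma fdcm_edge_power: "0 \<le> \<beta> \<Longrightarrow> fdcm (\<lambda>x. x e powr - \<beta>)"
  using fdcm_laplace_powr[of "\<lambda>_. 1" "\<lambda>x. x e" \<beta>] fdcm_exp[of _ e] by (simp add: pos_fun_def)

lemma fdcm_powr_mult:
  assumes "fdcm (\<lambda>x. f x powr - \<beta>)" "fdcm (\<lambda>x. g x powr - \<beta>)"
    and "\<And>x. pos_fun x \<Longrightarrow> 0 < f x" "\<And>x. pos_fun x \<Longrightarrow> 0 < g x"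
  shows "fdcm (\<lambda>x. (f x * g x) powr - \<beta>)"
  by (rule fdcm_cong[OF _ fdcm_mult[OF assms(1,2)]]) (use assms(3,4) in \<open>simp add: powr_mult less_imp_le\<close>)

text \<open>Let the edge variable tend to 0. For a bridge that limit would be 0 to a negative power;
  there T is \<open>x e\<close> times the deleted polynomial, and \<open>x e = 1\<close> gives the
  claim.\<close>

lemma fdcm_deleted_poly:
  assumes G: "multigraph G" and e: "e \<in> edges G" "ends G e = {x, y}"
    and fd: "fdcm (\<lambda>x. spanning_tree_poly G x powr - \<beta>)"
  shows "fdcm (\<lambda>x. deleted_poly G e x powr - \<beta>)"
proof (cases "bridge G e x y")
  case True
  then have "x \<noteq> y" by (auto simp: bridge_def)
  then show ?thesis
    using fdcm_fix[OF zero_less_one fd, of e] True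
    by (simp add: spanning_tree_poly_edge[OF G e] contracted_poly_bridge[OF G])
next
  case False
  show ?thesis
  proof (rule fdcm_limit)
    show "fdcm (\<lambda>x. spanning_tree_poly G (x(e := inverse (real (Suc n)))) powr - \<beta>)" for n
      by (rule fdcm_fix[OF _ fd]) simp
    fix z :: "'b \<Rightarrow> real" assume z: "pos_fun z"
    let ?b = "if x = y then 0 else contracted_poly G e x y z"
    have "(\<lambda>n. (deleted_poly G e z + inverse (real (Suc n)) * ?b) powr - \<beta>) \<longlonglongrightarrow> (deleted_poly G e z + 0 * ?b) powr - \<beta>"
      using deleted_poly_pos[OF G z, of e]
      by (intro tendsto_powr tendsto_add tendsto_mult tendsto_const LIMSEQ_inverse_real_of_nat) simp
    then show "(\<lambda>n. spanning_tree_poly G (z(e := inverse (real (Suc n)))) powr - \<beta>) \<longlonglongrightarrow> deleted_poly G e z powr - \<beta>"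
      using False by (simp add: spanning_tree_poly_edge[OF G e] cong: if_cong)
  qed
qed

text \<open>Let the edge variable tend to infinity after multiplying by its power \<beta>, which
  leaves the coefficient of \<open>x e\<close>. A loop has no such coefficient, but there
  contraction is deletion.\<close>

lemma fdcm_contracted_poly:
  assumes G: "multigraph G" and e: "e \<in> edges G" "ends G e = {x, y}"
    and fd: "fdcm (\<lambda>x. spanning_tree_poly G x powr - \<beta>)"
  shows "fdcm (\<lambda>z. contracted_poly G e x y z powr - \<beta>)"
proof (cases "x = y")
  case True
  then show ?thesis using fdcm_deleted_poly[OF assms] by (simp add: contracted_poly_loop)
next
  case False
  show ?thesis
  proof (rule fdcm_limit)
    show "fdcm (\<lambda>x. real (Suc n) powr \<beta> * spanning_tree_poly G (x(e := real (Suc n))) powr - \<beta>)" for n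
      by (intro fdcm_cmult fdcm_fix[OF _ fd]) simp_all
    fix z :: "'b \<Rightarrow> real" assume z: "pos_fun z"
    define a where "a = (if bridge G e x y then 0 else deleted_poly G e z)"
    define b where "b = contracted_poly G e x y z"
    have a: "0 \<le> a" using deleted_poly_pos[OF G z, of e] by (simp add: a_def)
    have b: "0 < b" unfolding b_def by (rule contracted_poly_pos[OF G z])
    have "(\<lambda>n. (a * inverse (real (Suc n)) + b) powr - \<beta>) \<longlonglongrightarrow> (a * 0 + b) powr - \<beta>"
      using b by (intro tendsto_powr tendsto_add tendsto_mult tendsto_const LIMSEQ_inverse_real_of_nat) simp
    moreover have "real (Suc n) powr \<beta> * spanning_tree_poly G (z(e := real (Suc n))) powr - \<beta> =
        (a * inverse (real (Suc n)) + b) powr - \<beta>" for n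
    proof -
      have "spanning_tree_poly G (z(e := real (Suc n))) = real (Suc n) * (a * inverse (real (Suc n)) + b)"
        unfolding spanning_tree_poly_edge[OF G e] using False by (simp add: a_def b_def distrib_left del: of_nat_Suc)
      moreover have "real (Suc n) powr \<beta> * real (Suc n) powr - \<beta> = 1" by (simp flip: powr_add)
      moreover have "0 \<le> a * inverse (real (Suc n)) + b" using a b by simp
      ultimately show ?thesis by (simp only: powr_mult of_nat_0_le_iff mult.assoc[symmetric] mult_1_left)
    qed
    ultimately show "(\<lambda>n. real (Suc n) powr \<beta> * spanning_tree_poly G (z(e := real (Suc n))) powr - \<beta>)
        \<longlonglongrightarrow> contracted_poly G e x y z powr - \<beta>"
      by (simp add: b_def)
  qed
qed

lemma fdcm_conductance:
  assumes G: "multigraph G" and e: "e \<in> edges G" "ends G e = {x, y}" "x \<noteq> y"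
    and fd: "fdcm (\<lambda>x. spanning_tree_poly G x powr - \<beta>)" and \<beta>: "0 < \<beta>" and t: "0 \<le> t"
  shows "fdcm (\<lambda>z. contracted_poly G e x y z powr - \<beta> *
    exp (- (t * ((if bridge G e x y then 0 else deleted_poly G e z) / contracted_poly G e x y z))))"
proof (rule fdcm_edge_exp[where e = e])
  show "fdcm (\<lambda>z. ((if bridge G e x y then 0 else deleted_poly G e z) + z e * contracted_poly G e x y z) powr - \<beta>)"
    using fd e(3) by (simp add: spanning_tree_poly_edge[OF G e(1,2)])
qed (use \<beta> t deleted_poly_pos[OF G] contracted_poly_pos[OF G] in \<open>auto intro: less_imp_le\<close>)

lemma fdcm_parallel_connection:
  assumes G: "multigraph G1" "multigraph G2" "disjoint_graphs G1 G2"
    and e1: "e1 \<in> edges G1" "ends G1 e1 = {x1, y1}" and e2: "e2 \<in> edges G2" "ends G2 e2 = {x2, y2}"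
    and fd: "fdcm (\<lambda>x. spanning_tree_poly G1 x powr - \<beta>)" "fdcm (\<lambda>x. spanning_tree_poly G2 x powr - \<beta>)"
    and \<beta>: "0 < \<beta>"
  shows "fdcm (\<lambda>x. spanning_tree_poly (parallel_connection G1 e1 x1 y1 G2 e2 x2 y2) x powr - \<beta>)"
proof (cases "x1 = y1 \<or> x2 = y2")
  case True
  then show ?thesis
    using fdcm_powr_mult[OF fdcm_contracted_poly[OF G(1) e1 fd(1)] fdcm_contracted_poly[OF G(2) e2 fd(2)]
        contracted_poly_pos[OF G(1)] contracted_poly_pos[OF G(2)]]
    by (simp add: spanning_tree_poly_parallel[OF G e1 e2])
next
  case False
  then have ne: "x1 \<noteq> y1" "x2 \<noteq> y2" by auto
  have "fdcm (\<lambda>z. ((if bridge G1 e1 x1 y1 then 0 else deleted_poly G1 e1 z) * contracted_poly G2 e2 x2 y2 z +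
       contracted_poly G1 e1 x1 y1 z * (if bridge G2 e2 x2 y2 then 0 else deleted_poly G2 e2 z) +
       z e1 * (contracted_poly G1 e1 x1 y1 z * contracted_poly G2 e2 x2 y2 z)) powr - \<beta>)"
    by (rule fdcm_parallel[OF fdcm_conductance[OF G(1) e1 ne(1) fd(1) \<beta>] fdcm_conductance[OF G(2) e2 ne(2) fd(2) \<beta>]])
      (use \<beta> deleted_poly_pos[OF G(1)] deleted_poly_pos[OF G(2)] contracted_poly_pos[OF G(1)]
        contracted_poly_pos[OF G(2)] in \<open>auto intro: less_imp_le\<close>)
  then show ?thesis using False by (simp add: spanning_tree_poly_parallel[OF G e1 e2])
qed

lemma fdcm_series_connection:
  assumes G: "multigraph G1" "multigraph G2" "disjoint_graphs G1 G2"
    and e1: "e1 \<in> edges G1" "ends G1 e1 = {x1, y1}" and e2: "e2 \<in> edges G2" "ends G2 e2 = {x2, y2}"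
    and e: "e \<notin> edges G1 \<union> edges G2"
    and fd: "fdcm (\<lambda>x. spanning_tree_poly G1 x powr - \<beta>)" "fdcm (\<lambda>x. spanning_tree_poly G2 x powr - \<beta>)"
    and \<beta>: "1/2 \<le> \<beta>"
  shows "fdcm (\<lambda>x. spanning_tree_poly (series_connection G1 e1 x1 y1 G2 e2 x2 y2 e) x powr - \<beta>)"
proof -
  note T = spanning_tree_poly_series[OF G e1 e2 e]
  note d = fdcm_deleted_poly[OF G(1) e1 fd(1)] fdcm_deleted_poly[OF G(2) e2 fd(2)]
  note dp = deleted_poly_pos[OF G(1), of _ e1] deleted_poly_pos[OF G(2), of _ e2]
  note cp = contracted_poly_pos[OF G(1), of _ e1 x1 y1] contracted_poly_pos[OF G(2), of _ e2 x2 y2]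
  consider "bridge G1 e1 x1 y1 \<or> bridge G2 e2 x2 y2"
    | "\<not> bridge G1 e1 x1 y1" "\<not> bridge G2 e2 x2 y2" "x1 = y1"
    | "\<not> bridge G1 e1 x1 y1" "\<not> bridge G2 e2 x2 y2" "x2 = y2"
    | "\<not> bridge G1 e1 x1 y1" "\<not> bridge G2 e2 x2 y2" "x1 \<noteq> y1" "x2 \<noteq> y2"
    by blast
  then show ?thesis
  proof cases
    case 1
    have "fdcm (\<lambda>z. (z e * (deleted_poly G1 e1 z * deleted_poly G2 e2 z)) powr - \<beta>)"
      by (intro fdcm_powr_mult fdcm_edge_power d) (use \<beta> dp in \<open>auto simp: pos_fun_def\<close>)
    then show ?thesis using 1 by (simp add: T)
  next
    case 2
    \<comment> \<open>With \<open>e1\<close> a loop, the first graph is only attached at a vertex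
      and \<open>e\<close> replaces \<open>e2\<close> in the second.\<close>
    have "fdcm (\<lambda>z. (deleted_poly G1 e1 z * spanning_tree_poly G2 (z(e2 := z e))) powr - \<beta>)"
      by (intro fdcm_powr_mult d fdcm_rename[OF fd(2)]) (use dp spanning_tree_poly_pos[OF G(2)] in \<open>auto simp: pos_fun_def\<close>)
    moreover have "deleted_poly G1 e1 z * spanning_tree_poly G2 (z(e2 := z e)) =
        spanning_tree_poly (series_connection G1 e1 x1 y1 G2 e2 x2 y2 e) z" for z
      unfolding T spanning_tree_poly_edge[OF G(2) e2] using 2 by (simp add: algebra_simps)
    ultimately show ?thesis by simp
  next
    case 3
    have "fdcm (\<lambda>z. (spanning_tree_poly G1 (z(e1 := z e)) * deleted_poly G2 e2 z) powr - \<beta>)"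
      by (intro fdcm_powr_mult d fdcm_rename[OF fd(1)]) (use dp spanning_tree_poly_pos[OF G(1)] in \<open>auto simp: pos_fun_def\<close>)
    moreover have "spanning_tree_poly G1 (z(e1 := z e)) * deleted_poly G2 e2 z =
        spanning_tree_poly (series_connection G1 e1 x1 y1 G2 e2 x2 y2 e) z" for z
      unfolding T spanning_tree_poly_edge[OF G(1) e1] using 3 by (simp add: algebra_simps)
    ultimately show ?thesis by simp
  next
    case 4
    define p1 where "p1 z = contracted_poly G1 e1 x1 y1 z" for z
    define p2 where "p2 z = contracted_poly G2 e2 x2 y2 z" for z
    define r1 where "r1 z = deleted_poly G1 e1 z / p1 z" for z
    define r2 where "r2 z = deleted_poly G2 e2 z / p2 z" for z
    have pos: "0 < p1 z" "0 < p2 z" "0 < r1 z" "0 < r2 z" if "pos_fun z" for z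
      using dp[OF that] cp[OF that] by (simp_all add: p1_def p2_def r1_def r2_def)
    have "fdcm (\<lambda>z. p1 z powr - \<beta> * p2 z powr - \<beta> * (r1 z * r2 z + z e * (r1 z + r2 z)) powr - \<beta>)"
    proof (rule fdcm_series[OF _ _ pos(3,4) \<beta>])
      fix t :: real assume t: "0 \<le> t"
      have "0 < \<beta>" using \<beta> by simp
      from fdcm_conductance[OF G(1) e1 4(3) fd(1) this t] fdcm_conductance[OF G(2) e2 4(4) fd(2) this t]
      show "fdcm (\<lambda>x. p1 x powr - \<beta> * exp (- (t * r1 x)))" "fdcm (\<lambda>x. p2 x powr - \<beta> * exp (- (t * r2 x)))"
        using 4(1,2) by (simp_all add: p1_def p2_def r1_def r2_def)
    qed auto
    then show ?thesis
    proof (rule fdcm_cong[rotated])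
      fix z :: "'b \<Rightarrow> real" assume z: "pos_fun z"
      note pos = pos[OF z]
      have ze: "0 < z e" using z by (simp add: pos_fun_def)
      have d: "deleted_poly G1 e1 z = p1 z * r1 z" "deleted_poly G2 e2 z = p2 z * r2 z"
        using pos by (simp_all add: r1_def r2_def)
      have "spanning_tree_poly (series_connection G1 e1 x1 y1 G2 e2 x2 y2 e) z =
          (p1 z * p2 z) * (r1 z * r2 z + z e * (r1 z + r2 z))"
        unfolding T d using 4 by (simp add: p1_def[symmetric] p2_def[symmetric] algebra_simps)
      moreover have "0 \<le> r1 z * r2 z + z e * (r1 z + r2 z)" using pos ze by simp
      ultimately show "p1 z powr - \<beta> * p2 z powr - \<beta> * (r1 z * r2 z + z e * (r1 z + r2 z)) powr - \<beta> =
          spanning_tree_poly (series_connection G1 e1 x1 y1 G2 e2 x2 y2 e) z powr - \<beta>"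
        using pos by (simp add: powr_mult)
    qed
  qed
qed

lemma spanning_tree_poly_graph_iso:
  assumes G: "multigraph G" and iso: "graph_iso G H"
  obtains g where "bij_betw g (edges G) (edges H)"
    "\<And>x. spanning_tree_poly H x = spanning_tree_poly G (x \<circ> g)"
proof -
  obtain f g where fg: "bij_betw f (verts G) (verts H)" "bij_betw g (edges G) (edges H)"
    "\<And>e. e \<in> edges G \<Longrightarrow> ends H (g e) = f ` ends G e"
    using iso unfolding graph_iso_def by blast
  then show thesis
    using that[OF fg(2)] forest_poly_graph_iso[OF G fg]
    by (simp add: spanning_tree_poly_eq_forest_poly G multigraph_graph_iso[OF G iso])
qed

lemma fdcm_graph_iso:
  assumes G: "multigraph G" "graph_iso G H"
    and fd: "fdcm (\<lambda>x. spanning_tree_poly G x powr - \<beta>)"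
  shows "fdcm (\<lambda>x. spanning_tree_poly H x powr - \<beta>)"
proof -
  obtain g where "\<And>x. spanning_tree_poly H x = spanning_tree_poly G (x \<circ> g)"
    by (rule spanning_tree_poly_graph_iso[OF G]) blast
  then show ?thesis using fdcm_comp[OF fd, of g] by simp
qed

text \<open>The bound \<open>1/2 \<le> \<beta>\<close> is imposed for all operations because a
  series connection may occur anywhere in the construction.\<close>

lemma fdcm_generated:
  assumes "generated p G" "2 \<le> p" "(\<exists>n::nat. \<beta> = real n / 2) \<or> \<beta> \<ge> (real p - 2) / 2" and \<beta>: "1/2 \<le> \<beta>"
  shows "fdcm (\<lambda>x. spanning_tree_poly G x powr - \<beta>)"
  using assms(1)
proof (induction rule: generated.induct)
  case (complete G)
  then show ?case using assms(2,3) by (rule fdcm_complete_graph)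
next
  case (iso G H)
  then show ?case using fdcm_graph_iso multigraph_generated by blast
next
  case (disjoint_union G1 G2)
  note G = multigraph_generated[OF disjoint_union.hyps(1)] multigraph_generated[OF disjoint_union.hyps(2)]
  show ?case
    unfolding spanning_tree_poly_graph_union[OF G disjoint_union.hyps(3)]
    by (intro fdcm_powr_mult disjoint_union.IH spanning_tree_poly_pos G)
next
  case (glue G1 G2 x1 x2)
  note G = multigraph_generated[OF glue.hyps(1)] multigraph_generated[OF glue.hyps(2)]
  show ?case
    unfolding spanning_tree_poly_glue[OF G glue.hyps(3-5)]
    by (intro fdcm_powr_mult glue.IH spanning_tree_poly_pos G)
next
  case (parallel G1 G2 e1 x1 y1 e2 x2 y2)
  note G = multigraph_generated[OF parallel.hyps(1)] multigraph_generated[OF parallel.hyps(2)]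
  show ?case by (rule fdcm_parallel_connection[OF G parallel.hyps(3-7) parallel.IH]) (use \<beta> in simp)
next
  case (series G1 G2 e1 x1 y1 e2 x2 y2 e)
  note G = multigraph_generated[OF series.hyps(1)] multigraph_generated[OF series.hyps(2)]
  show ?case by (rule fdcm_series_connection[OF G series.hyps(3-8) series.IH \<beta>])
next
  case (deletion G e)
  have G: "multigraph G" using deletion.hyps(1) by (rule multigraph_generated)
  obtain x y where "ends G e = {x, y}" using two_endsE[OF two_ends_multigraph[OF G] deletion.hyps(2)] .
  from fdcm_deleted_poly[OF G deletion.hyps(2) this deletion.IH]
  show ?case by (simp add: spanning_tree_poly_delete_edge[OF G])
next
  case (contraction G e x y)
  have G: "multigraph G" using contraction.hyps(1) by (rule multigraph_generated)
  from fdcm_contracted_poly[OF G contraction.hyps(2,3) contraction.IH]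
  show ?case by (simp add: spanning_tree_poly_contract_edge[OF G])
qed

section \<open>The case p = 2: forests\<close>

definition monomial_graph :: "('v, 'e) mgraph \<Rightarrow> bool" where
  "monomial_graph G \<longleftrightarrow> (\<forall>z. pos_fun z \<longrightarrow> spanning_tree_poly G z = (\<Prod>e\<in>edges G. z e))"

text \<open>T is affine in \<open>x e\<close> and the monomial has no constant term there, while the
  deleted polynomial is positive; so \<open>e\<close> must be a bridge. Comparing the values 1 and 2
  of \<open>x e\<close> isolates the constant term.\<close>

lemma monomial_graph_edge:
  assumes G: "multigraph G" "monomial_graph G" and e: "e \<in> edges G" "ends G e = {x, y}"
  shows "bridge G e x y" "x \<noteq> y"
    "\<And>z. pos_fun z \<Longrightarrow> contracted_poly G e x y z = (\<Prod>f\<in>edges G - {e}. z f)"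
    "\<And>z. pos_fun z \<Longrightarrow> deleted_poly G e z = (\<Prod>f\<in>edges G - {e}. z f)"
proof -
  have fin: "finite (edges G)" using G by (simp add: multigraph_def)
  define P where "P z = (\<Prod>f\<in>edges G - {e}. z f)" for z :: "'b \<Rightarrow> real"
  have T: "(if bridge G e x y then 0 else deleted_poly G e z) +
      t * (if x = y then 0 else contracted_poly G e x y z) = t * P z" if z: "pos_fun z" and t: "0 < t" for z t
  proof -
    have "pos_fun (z(e := t))" using z t by (simp add: pos_fun_def)
    then have "spanning_tree_poly G (z(e := t)) = t * P z"
      using G(2) prod.remove[OF fin e(1), of "z(e := t)"] by (simp add: monomial_graph_def P_def)
    then show ?thesis by (simp add: spanning_tree_poly_edge[OF G(1) e] cong: if_cong)
  qed
  have one: "pos_fun (\<lambda>_::'b. 1 :: real)" by (simp add: pos_fun_def)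
  have "(if bridge G e x y then 0 else deleted_poly G e (\<lambda>_. 1)) = 0"
    using T[OF one, of 1] T[OF one, of 2] by simp
  then show b: "bridge G e x y"
    using deleted_poly_pos[OF G(1) one, of e] by (simp split: if_splits)
  then show ne: "x \<noteq> y" by (auto simp: bridge_def)
  show c: "contracted_poly G e x y z = (\<Prod>f\<in>edges G - {e}. z f)" if "pos_fun z" for z
    using T[OF that, of 1] b ne by (simp add: P_def)
  show "deleted_poly G e z = (\<Prod>f\<in>edges G - {e}. z f)" if "pos_fun z" for z
    using c[OF that] contracted_poly_bridge[OF G(1) b] by simp
qed

lemma monomial_graph_complete:
  assumes K: "complete_graph 2 G" shows "monomial_graph G"
proof -
  have G: "multigraph G" using K by (rule multigraph_generated[OF generated.complete])
  have "A = verts G" if "A \<subseteq> verts G" "card A = 2" for A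
    using card_subset_eq[of "verts G" A] that K by (simp add: complete_graph_def)
  then have "{A. A \<subseteq> verts G \<and> card A = 2} = {verts G}"
    using K unfolding complete_graph_def by blast
  then have b: "bij_betw (ends G) (edges G) {verts G}" using K by (simp add: complete_graph_def)
  then have "card (edges G) = 1" using bij_betw_same_card[OF b] by simp
  then obtain e where e: "edges G = {e}" by (rule card_1_singletonE)
  have "card (ends G e) = 2" using b e K by (simp add: bij_betw_def complete_graph_def)
  then obtain x y where xy: "ends G e = {x, y}" "x \<noteq> y" by (auto simp: card_2_iff)
  show ?thesis unfolding monomial_graph_def
    using spanning_tree_poly_edge[OF G _ xy(1)] e xy(2) by (simp add: bridge_def contracted_poly_def)
qed

lemma monomial_graph_iso:
  assumes G: "multigraph G" "graph_iso G H" and m: "monomial_graph G"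
  shows "monomial_graph H"
proof -
  obtain g where g: "bij_betw g (edges G) (edges H)"
    and T: "\<And>x. spanning_tree_poly H x = spanning_tree_poly G (x \<circ> g)"
    by (rule spanning_tree_poly_graph_iso[OF G]) blast
  have "(\<Prod>e\<in>edges G. (x \<circ> g) e) = (\<Prod>e\<in>edges H. x e)" for x :: "'d \<Rightarrow> real"
    using prod.reindex_bij_betw[OF g, of x] by simp
  moreover have "pos_fun (x \<circ> g)" if "pos_fun x" for x :: "'d \<Rightarrow> real" using that by (simp add: pos_fun_def)
  ultimately show ?thesis using m T by (simp add: monomial_graph_def)
qed

lemma monomial_graph_generated: "generated 2 G \<Longrightarrow> monomial_graph G"
proof (induction rule: generated.induct)
  case (complete G)
  then show ?case by (rule monomial_graph_complete)
next
  case (iso G H)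
  then show ?case using monomial_graph_iso multigraph_generated by blast
next
  case (disjoint_union G1 G2)
  note G = multigraph_generated[OF disjoint_union.hyps(1)] multigraph_generated[OF disjoint_union.hyps(2)]
  have "edges (graph_union G1 G2) = edges G1 \<union> edges G2" by (simp add: graph_union_def)
  then show ?case
    using disjoint_union.IH disjoint_union.hyps(3) G
    unfolding monomial_graph_def spanning_tree_poly_graph_union[OF G disjoint_union.hyps(3)]
    by (simp add: prod.union_disjoint disjoint_graphs_def multigraph_def)
next
  case (glue G1 G2 x1 x2)
  note G = multigraph_generated[OF glue.hyps(1)] multigraph_generated[OF glue.hyps(2)]
  have "edges (identify x1 x2 (graph_union G1 G2)) = edges G1 \<union> edges G2"
    by (simp add: graph_union_def identify_def)
  then show ?case
    using glue.IH glue.hyps(3) G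
    unfolding monomial_graph_def spanning_tree_poly_glue[OF G glue.hyps(3-5)]
    by (simp add: prod.union_disjoint disjoint_graphs_def multigraph_def)
next
  case (parallel G1 G2 e1 x1 y1 e2 x2 y2)
  note G = multigraph_generated[OF parallel.hyps(1)] multigraph_generated[OF parallel.hyps(2)]
  note m1 = monomial_graph_edge[OF G(1) parallel.IH(1) parallel.hyps(4,5)]
  note m2 = monomial_graph_edge[OF G(2) parallel.IH(2) parallel.hyps(6,7)]
  let ?P = "parallel_connection G1 e1 x1 y1 G2 e2 x2 y2"
  have fin: "finite (edges G1)" "finite (edges G2)" and d: "edges G1 \<inter> edges G2 = {}"
    using G parallel.hyps(3) by (auto simp: multigraph_def disjoint_graphs_def)
  have E: "edges ?P = edges G1 \<union> (edges G2 - {e2})"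
    using d parallel.hyps(6) by (auto simp: parallel_connection_def delete_edge_def identify_def graph_union_def)
  have "(\<Prod>e\<in>edges ?P. z e) = (\<Prod>e\<in>edges G1. z e) * (\<Prod>e\<in>edges G2 - {e2}. z e)" for z :: "'b \<Rightarrow> real"
    unfolding E by (rule prod.union_disjoint) (use fin d in auto)
  moreover have "(\<Prod>e\<in>edges G1. z e) * (\<Prod>e\<in>edges G2 - {e2}. z e) = z e1 * (\<Prod>e\<in>edges G1 - {e1}. z e) * (\<Prod>e\<in>edges G2 - {e2}. z e)" for z :: "'b \<Rightarrow> real"
    using prod.remove[OF fin(1) parallel.hyps(4), of z] by simp
  ultimately show ?case
    unfolding monomial_graph_def spanning_tree_poly_parallel[OF G parallel.hyps(3-7)]
    using m1 m2 by simp
next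
  case (series G1 G2 e1 x1 y1 e2 x2 y2 e)
  note G = multigraph_generated[OF series.hyps(1)] multigraph_generated[OF series.hyps(2)]
  note m1 = monomial_graph_edge[OF G(1) series.IH(1) series.hyps(4,5)]
  note m2 = monomial_graph_edge[OF G(2) series.IH(2) series.hyps(6,7)]
  let ?S = "series_connection G1 e1 x1 y1 G2 e2 x2 y2 e"
  have fin: "finite (edges G1)" "finite (edges G2)" and d: "edges G1 \<inter> edges G2 = {}"
    using G series.hyps(3) by (auto simp: multigraph_def disjoint_graphs_def)
  have E: "edges ?S = insert e ((edges G1 - {e1}) \<union> (edges G2 - {e2}))"
    by (simp add: series_connection_def add_edge_def delete_edge_def identify_def graph_union_def)
  have "(\<Prod>f\<in>edges ?S. z f) = z e * (\<Prod>f\<in>(edges G1 - {e1}) \<union> (edges G2 - {e2}). z f)" for z :: "'b \<Rightarrow> real"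
    unfolding E by (rule prod.insert) (use fin series.hyps(8) in auto)
  moreover have "(\<Prod>f\<in>(edges G1 - {e1}) \<union> (edges G2 - {e2}). z f) =
      (\<Prod>f\<in>edges G1 - {e1}. z f) * (\<Prod>f\<in>edges G2 - {e2}. z f)" for z :: "'b \<Rightarrow> real"
    by (rule prod.union_disjoint) (use fin d in auto)
  ultimately show ?case
    unfolding monomial_graph_def spanning_tree_poly_series[OF G series.hyps(3-8)]
    using m1 m2 by simp
next
  case (deletion G e)
  have G: "multigraph G" using deletion.hyps(1) by (rule multigraph_generated)
  obtain x y where "ends G e = {x, y}" using two_endsE[OF two_ends_multigraph[OF G] deletion.hyps(2)] .
  from monomial_graph_edge(4)[OF G deletion.IH deletion.hyps(2) this]
  show ?case unfolding monomial_graph_def by (simp add: spanning_tree_poly_delete_edge[OF G]) (simp add: delete_edge_def)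
next
  case (contraction G e x y)
  have G: "multigraph G" using contraction.hyps(1) by (rule multigraph_generated)
  from monomial_graph_edge(3)[OF G contraction.IH contraction.hyps(2,3)]
  show ?case unfolding monomial_graph_def
    by (simp add: spanning_tree_poly_contract_edge[OF G]) (simp add: contract_edge_def identify_def delete_edge_def)
qed

lemma fdcm_obtainable:
  assumes p: "2 \<le> p" and G: "obtainable_from_complete p G"
    and \<beta>: "(\<exists>n::nat. \<beta> = real n / 2) \<or> \<beta> \<ge> (real p - 2) / 2"
  shows "fdcm (\<lambda>x. spanning_tree_poly G x powr - \<beta>)"
proof -
  obtain H :: "(nat, nat) mgraph" where H: "generated p H" "graph_iso H G"
    using G unfolding obtainable_from_complete_def by blast
  have mH: "multigraph H" using H(1) by (rule multigraph_generated)
  have "fdcm (\<lambda>x. spanning_tree_poly H x powr - \<beta>)"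
  proof (cases "1/2 \<le> \<beta>")
    case True
    then show ?thesis by (rule fdcm_generated[OF H(1) p \<beta>])
  next
    case False
    have "0 \<le> \<beta>" using \<beta> p by (auto intro: order_trans[rotated])
    show ?thesis
    proof (cases "\<beta> = 0")
      case True
      have "fdcm (\<lambda>x::nat \<Rightarrow> real. 1)" by (rule fdcm_const) simp
      then show ?thesis
        by (rule fdcm_cong[rotated]) (use True spanning_tree_poly_pos[OF mH] in \<open>simp add: less_imp_neq[symmetric]\<close>)
    next
      case ne: False
      \<comment> \<open>For p \<ge> 3 the bound (p-2)/2 is at least 1/2, so an exponent below 1/2
        would be half-integral and hence 0.\<close>
      have "p = 2"
      proof (rule ccontr)
        assume "p \<noteq> 2"
        then have "1/2 \<le> (real p - 2) / 2" using p by simp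
        then obtain n :: nat where "\<beta> = real n / 2" using \<beta> False by auto
        then show False using False ne by (cases n) auto
      qed
      then have "monomial_graph H" using monomial_graph_generated H(1) by simp
      moreover have "fdcm (\<lambda>x. \<Prod>e\<in>edges H. x e powr - \<beta>)"
        by (intro fdcm_prod fdcm_edge_power \<open>0 \<le> \<beta>\<close>)
      ultimately show ?thesis
        by (rule_tac fdcm_cong[rotated]) (auto simp: monomial_graph_def pos_fun_def prod_powr_distrib less_imp_le)
    qed
  qed
  then show ?thesis by (rule fdcm_graph_iso[OF mH H(2)])
qed

theorem proposition1p12:
  fixes p :: nat and G :: "('v, 'e) mgraph" and \<beta> :: real
  assumes "p \<ge> 2"
    and "obtainable_from_complete p G"
    and "(\<exists>n::nat. \<beta> = real n / 2) \<or> \<beta> \<ge> (real p - 2) / 2"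
  shows "completely_monotone (edges G) (\<lambda>x. spanning_tree_poly G x powr (- \<beta>))"
proof (rule completely_monotone_if_fdcm)
  have G: "multigraph G" using assms(2) by (rule multigraph_obtainable)
  have E: "finite (edges G)" "two_ends (ends G) (edges G)"
    using G two_ends_multigraph by (auto simp: multigraph_def)
  show "smooth_fun (edges G) (\<lambda>x. spanning_tree_poly G x powr - \<beta>)"
    unfolding spanning_tree_poly_eq_forest_poly[OF G]
    by (intro smooth_fun.powr smooth_fun_forest_poly forest_poly_pos E) simp
  show "fdcm (\<lambda>x. spanning_tree_poly G x powr - \<beta>)" by (rule fdcm_obtainable[OF assms])
  show "spanning_tree_poly G x powr - \<beta> = spanning_tree_poly G y powr - \<beta>"
    if "\<And>e. e \<in> edges G \<Longrightarrow> x e = y e" for x y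
    unfolding spanning_tree_poly_eq_forest_poly[OF G] by (subst forest_poly_depends[OF that]) auto
qed

end
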